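(* Assume the non-oscillatory case $G^h=G|_{\bar\Omega^h}$ with $G\in\mathcal C^\infty(\bar\Omega,\mathbb R^{3\times3}_{\mathrm{sym,pos}})$, that $\lim_{h\to0}\frac1{h^2}\inf\mathcal E^h=0$, and that all Riemann curvatures of $G$ vanish on $\omega\times\{0\}$. Let $y_0\in\mathcal C^\infty(\bar\omega,\mathbb R^3)$ satisfy $(\nabla y_0)^{\mathsf T}\nabla y_0=\bar{\mathcal G}_{2\times2}$ and $((\nabla y_0)^{\mathsf T}\nabla\vec b_0)_{\mathrm{sym}}=\frac12\partial_3G(x',0)_{2\times2}$. Then for $(V,\mathbb S)\in\mathscr V\times\mathscr S$, $\mathcal I_4(V,\mathbb S)=0$ if and only if $$V=Sy_0+c\quad\text{and}\quad\mathbb S=\frac12\Big((\nabla y_0)^{\mathsf T}\nabla\big(S^2y_0+\tfrac1{12}\tilde d_0\big)\Big)_{\mathrm{sym}}\ \text{on }\omega,$$ for some skew-symmetric $S\in so(3)$ and some $c\in\mathbb R^3$.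
   Context: $\omega\subset\mathbb R^2$ open, bounded, connected, Lipschitz; $\Omega^h=\omega\times(-h/2,h/2)$, $\Omega=\omega\times(-1/2,1/2)$. $W:\mathbb R^{3\times3}\to[0,\infty]$ Borel with $W(RF)=W(F)$ for $R\in SO(3)$, $W=0$ on $SO(3)$, $W(F)\ge c\,\mathrm{dist}^2(F,SO(3))$ ($c>0$), $W$ finite and $\mathcal C^2$ near $SO(3)$. $\mathcal E^h(u)=\frac1h\int_{\Omega^h}W(\nabla u\,(G^h)^{-1/2})dx$. $\bar{\mathcal G}=G(\cdot,0)$. $\vec b_0=(\nabla y_0)(\bar{\mathcal G}_{2\times2})^{-1}(\bar{\mathcal G}_{13},\bar{\mathcal G}_{23})^{\mathsf T}+\sqrt{\det\bar{\mathcal G}/\det\bar{\mathcal G}_{2\times2}}\frac{\partial_1y_0\times\partial_2y_0}{|\cdot|}$; $Q_0=[\partial_1y_0,\partial_2y_0,\vec b_0]$; $\tilde d_0=Q_0^{-\mathsf T}\big(\partial_3G(x',0)e_3-\frac12\partial_3G(x',0)_{33}e_3-[(\nabla\vec b_0)^{\mathsf T}\vec b_0;0]\big)$; $\vec p=-Q_0^{-\mathsf T}[\nabla V^{\mathsf T}\vec b_0;0]$. $\mathscr V=\{V\in W^{2,2}(\omega,\mathbb R^3):((\nabla y_0)^{\mathsf T}\nabla V)_{\mathrm{sym}}=0\}$; $\mathscr S$ = $L^2$-closure of $\{((\nabla y_0)^{\mathsf T}\nabla w)_{\mathrm{sym}}:w\in W^{1,2}(\omega,\mathbb R^3)\}$.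 $\mathcal I_4(V,\mathbb S)=\frac12\int_\omega\mathcal Q_2\big(x',\mathbb S+\frac12\nabla V^{\mathsf T}\nabla V+\frac1{24}\nabla\vec b_0^{\mathsf T}\nabla\vec b_0-\frac1{48}\partial_{33}G(x',0)_{2\times2}\big)dx'+\frac1{24}\int_\omega\mathcal Q_2(x',\nabla y_0^{\mathsf T}\nabla\vec p+\nabla V^{\mathsf T}\nabla\vec b_0)dx'+\frac1{1440}\int_\omega\mathcal Q_2(x',[R_{i3j3}(x',0)]_{i,j=1,2})dx'$. $\bar A=\bar{\mathcal G}^{1/2}$, $\mathcal Q_3(F)=D^2W(Id_3)(F,F)$, $\mathcal Q_2(x',F)=\min\{\mathcal Q_3(\bar A^{-1}\tilde F\bar A^{-1}):\tilde F_{2\times2}=F\}$. Riemann curvatures $R_{iklm}=\frac12(\partial_{kl}G_{im}+\partial_{im}G_{kl}-\partial_{km}G_{il}-\partial_{il}G_{km})+G_{np}(\Gamma^n_{kl}\Gamma^p_{im}-\Gamma^n_{km}\Gamma^p_{il})$, $\Gamma^i_{kl}=\frac12G^{im}(\partial_lG_{mk}+\partial_kG_{ml}-\partial_mG_{kl})$. *)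

theory Defs
  imports "HOL-Analysis.Analysis"
begin

definition pd :: "'n::finite \<Rightarrow> (real^'n \<Rightarrow> 'a::real_normed_vector) \<Rightarrow> real^'n \<Rightarrow> 'a" where
  "pd i f x = vector_derivative (\<lambda>t. f (x + t *\<^sub>R axis i 1)) (at 0)"

fun pds :: "'n::finite list \<Rightarrow> (real^'n \<Rightarrow> 'a::real_normed_vector) \<Rightarrow> real^'n \<Rightarrow> 'a" where
  "pds [] f = f"
| "pds (i # is) f = pd i (pds is f)"

definition smooth_on :: "(real^'n::finite) set \<Rightarrow> (real^'n \<Rightarrow> 'a::real_normed_vector) \<Rightarrow> bool" where
  "smooth_on S f \<longleftrightarrow> (\<forall>is. continuous_on S (pds is f) \<and>
      (\<forall>x\<in>S. \<forall>i. (\<lambda>t. pds is f (x + t *\<^sub>R axis i 1)) differentiable (at 0)))"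

definition smooth_closure :: "(real^'n::finite) set \<Rightarrow> (real^'n \<Rightarrow> 'a::real_normed_vector) \<Rightarrow> bool" where
  "smooth_closure S f \<longleftrightarrow> smooth_on S f \<and> continuous_on (closure S) f \<and>
      (\<forall>is. \<exists>g. continuous_on (closure S) g \<and> (\<forall>x\<in>S. g x = pds is f x))"

definition cgrad :: "(real^'n::finite \<Rightarrow> real^'m::finite) \<Rightarrow> real^'n \<Rightarrow> real^'n^'m" where
  "cgrad f x = (\<chi> j k. pd k f x $ j)"

definition test_fun :: "(real^'n::finite) set \<Rightarrow> (real^'n \<Rightarrow> real) \<Rightarrow> bool" where
  "test_fun U \<phi> \<longleftrightarrow> smooth_on UNIV \<phi> \<and> compact (closure {x. \<phi> x \<noteq> 0})
      \<and> closure {x. \<phi> x \<noteq> 0} \<subseteq> U"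

definition L2 :: "(real^'n::finite) set \<Rightarrow> (real^'n \<Rightarrow> real) \<Rightarrow> bool" where
  "L2 U f \<longleftrightarrow> f \<in> borel_measurable (lebesgue_on U) \<and> integrable (lebesgue_on U) (\<lambda>x. (f x)^2)"

definition weak_deriv :: "(real^'n::finite) set \<Rightarrow> 'n list \<Rightarrow> (real^'n \<Rightarrow> real) \<Rightarrow> (real^'n \<Rightarrow> real) \<Rightarrow> bool" where
  "weak_deriv U is f g \<longleftrightarrow> (\<forall>\<phi>. test_fun U \<phi> \<longrightarrow>
      (\<integral>x. f x * pds is \<phi> x \<partial>lebesgue_on U) = (-1)^(length is) * (\<integral>x. g x * \<phi> x \<partial>lebesgue_on U))"

definition sobolev_r :: "nat \<Rightarrow> (real^'n::finite) set \<Rightarrow> (real^'n \<Rightarrow> real) \<Rightarrow> bool" where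
  "sobolev_r k U f \<longleftrightarrow> L2 U f \<and> (\<forall>is. length is \<le> k \<longrightarrow> (\<exists>g. L2 U g \<and> weak_deriv U is f g))"

definition sobolev :: "nat \<Rightarrow> (real^'n::finite) set \<Rightarrow> (real^'n \<Rightarrow> real^'m::finite) \<Rightarrow> bool" where
  "sobolev k U f \<longleftrightarrow> (\<forall>j. sobolev_r k U (\<lambda>x. f x $ j))"

definition wpartial :: "(real^'n::finite) set \<Rightarrow> 'n list \<Rightarrow> (real^'n \<Rightarrow> real^'m::finite) \<Rightarrow> real^'n \<Rightarrow> real^'m" where
  "wpartial U is f x = (\<chi> j. (SOME g. L2 U g \<and> weak_deriv U is (\<lambda>y. f y $ j) g) x)"

definition wgrad :: "(real^'n::finite) set \<Rightarrow> (real^'n \<Rightarrow> real^'m::finite) \<Rightarrow> real^'n \<Rightarrow> real^'n^'m" where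
  "wgrad U f x = (\<chi> j k. wpartial U [k] f x $ j)"

definition lipschitz_boundary :: "(real^2) set \<Rightarrow> bool" where
  "lipschitz_boundary \<omega> \<longleftrightarrow> (\<forall>p\<in>frontier \<omega>. \<exists>r>0. \<exists>Q::real^2^2. \<exists>\<gamma>::real\<Rightarrow>real. \<exists>C.
      orthogonal_matrix Q \<and> C-lipschitz_on UNIV \<gamma> \<and>
      \<omega> \<inter> ball p r = {x \<in> ball p r. (Q *v (x - p)) $ 2 < \<gamma> ((Q *v (x - p)) $ 1)})"

definition xy :: "real^3 \<Rightarrow> real^2" where "xy x = vector [x $ 1, x $ 2]"
definition pt :: "real^2 \<Rightarrow> real \<Rightarrow> real^3" where "pt x' t = vector [x' $ 1, x' $ 2, t]"
definition ext3 :: "real^2 \<Rightarrow> real^3" where "ext3 v = vector [v $ 1, v $ 2, 0]"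

text \<open>Omega^h = omega x (-h/2, h/2); Omega = Omega^1.\<close>
definition Omega_h :: "(real^2) set \<Rightarrow> real \<Rightarrow> (real^3) set" where
  "Omega_h \<omega> h = {x. xy x \<in> \<omega> \<and> \<bar>x $ 3\<bar> < h / 2}"

definition SO3 :: "(real^3^3) set" where
  "SO3 = {R. orthogonal_matrix R \<and> det R = 1}"

definition posdef :: "real^'n^'n \<Rightarrow> bool" where
  "posdef A \<longleftrightarrow> (\<forall>v. v \<noteq> 0 \<longrightarrow> v \<bullet> (A *v v) > 0)"

definition sym_posdef :: "real^'n^'n \<Rightarrow> bool" where
  "sym_posdef A \<longleftrightarrow> transpose A = A \<and> posdef A"

definition sqrt_spd :: "real^'n^'n \<Rightarrow> real^'n^'n" where
  "sqrt_spd A = (THE B. sym_posdef B \<and> B ** B = A)"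

definition msym :: "real^'n^'n \<Rightarrow> real^'n^'n" where
  "msym A = (1/2) *\<^sub>R (A + transpose A)"

definition e23 :: "2 \<Rightarrow> 3" where "e23 i = (if i = 1 then 1 else 2)"

definition blk2 :: "real^3^3 \<Rightarrow> real^2^2" where
  "blk2 A = (\<chi> i j. A $ e23 i $ e23 j)"

definition Wr :: "(real^3^3 \<Rightarrow> ennreal) \<Rightarrow> real^3^3 \<Rightarrow> real" where
  "Wr W F = enn2real (W F)"

definition C2_on :: "'a::real_normed_vector set \<Rightarrow> ('a \<Rightarrow> real) \<Rightarrow> bool" where
  "C2_on U f \<longleftrightarrow> (\<exists>D D2. (\<forall>x\<in>U. (f has_derivative blinfun_apply (D x)) (at x)) \<and>
      (\<forall>x\<in>U. (D has_derivative blinfun_apply (D2 x)) (at x)) \<and> continuous_on U D2)"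

text \<open>Q_3(F) = D^2 W(Id)(F,F), written as the second derivative of t |-> W(Id + tF) at 0.\<close>
definition Q3 :: "(real^3^3 \<Rightarrow> ennreal) \<Rightarrow> real^3^3 \<Rightarrow> real" where
  "Q3 W F = deriv (deriv (\<lambda>t. Wr W (mat 1 + t *\<^sub>R F))) 0"

definition Gbar :: "(real^3 \<Rightarrow> real^3^3) \<Rightarrow> real^2 \<Rightarrow> real^3^3" where
  "Gbar G x' = G (pt x' 0)"

definition Q2 :: "(real^3^3 \<Rightarrow> ennreal) \<Rightarrow> (real^3 \<Rightarrow> real^3^3) \<Rightarrow> real^2 \<Rightarrow> real^2^2 \<Rightarrow> real" where
  "Q2 W G x' F = Inf {Q3 W (matrix_inv (sqrt_spd (Gbar G x')) ** Ft ** matrix_inv (sqrt_spd (Gbar G x')))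
                      | Ft. blk2 Ft = F}"

definition energy :: "(real^3^3 \<Rightarrow> ennreal) \<Rightarrow> (real^3 \<Rightarrow> real^3^3) \<Rightarrow> (real^2) set \<Rightarrow> real \<Rightarrow> (real^3 \<Rightarrow> real^3) \<Rightarrow> ennreal" where
  "energy W G \<omega> h u = ennreal (1 / h) *
     (\<integral>\<^sup>+x\<in>Omega_h \<omega> h. W (wgrad (Omega_h \<omega> h) u x ** matrix_inv (sqrt_spd (G x))) \<partial>lborel)"

definition inf_energy :: "(real^3^3 \<Rightarrow> ennreal) \<Rightarrow> (real^3 \<Rightarrow> real^3^3) \<Rightarrow> (real^2) set \<Rightarrow> real \<Rightarrow> ennreal" where
  "inf_energy W G \<omega> h = (INF u \<in> {u. sobolev 1 (Omega_h \<omega> h) u}. energy W G \<omega> h u)"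

definition christoffel :: "(real^3 \<Rightarrow> real^3^3) \<Rightarrow> real^3 \<Rightarrow> 3 \<Rightarrow> 3 \<Rightarrow> 3 \<Rightarrow> real" where
  "christoffel G x i k l = (1/2) * (\<Sum>m\<in>UNIV. matrix_inv (G x) $ i $ m *
      (pd l G x $ m $ k + pd k G x $ m $ l - pd m G x $ k $ l))"

definition riemann :: "(real^3 \<Rightarrow> real^3^3) \<Rightarrow> real^3 \<Rightarrow> 3 \<Rightarrow> 3 \<Rightarrow> 3 \<Rightarrow> 3 \<Rightarrow> real" where
  "riemann G x i k l m =
     (1/2) * (pds [k, l] G x $ i $ m + pds [i, m] G x $ k $ l - pds [k, m] G x $ i $ l - pds [i, l] G x $ k $ m)
     + (\<Sum>n\<in>UNIV. \<Sum>p\<in>UNIV. G x $ n $ p *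
         (christoffel G x n k l * christoffel G x p i m - christoffel G x n k m * christoffel G x p i l))"

definition b0 :: "(real^3 \<Rightarrow> real^3^3) \<Rightarrow> (real^2 \<Rightarrow> real^3) \<Rightarrow> real^2 \<Rightarrow> real^3" where
  "b0 G y0 x' = cgrad y0 x' *v (matrix_inv (blk2 (Gbar G x')) *v vector [Gbar G x' $ 1 $ 3, Gbar G x' $ 2 $ 3])
     + sqrt (det (Gbar G x') / det (blk2 (Gbar G x')))
       *\<^sub>R ((1 / norm (cross3 (pd 1 y0 x') (pd 2 y0 x'))) *\<^sub>R cross3 (pd 1 y0 x') (pd 2 y0 x'))"

definition Q0 :: "(real^3 \<Rightarrow> real^3^3) \<Rightarrow> (real^2 \<Rightarrow> real^3) \<Rightarrow> real^2 \<Rightarrow> real^3^3" where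
  "Q0 G y0 x' = (\<chi> j k. if k = 1 then pd 1 y0 x' $ j else if k = 2 then pd 2 y0 x' $ j else b0 G y0 x' $ j)"

definition d0 :: "(real^3 \<Rightarrow> real^3^3) \<Rightarrow> (real^2 \<Rightarrow> real^3) \<Rightarrow> real^2 \<Rightarrow> real^3" where
  "d0 G y0 x' = matrix_inv (transpose (Q0 G y0 x')) *v
     (pd 3 G (pt x' 0) *v axis 3 1 - ((1/2) * (pd 3 G (pt x' 0) $ 3 $ 3)) *\<^sub>R axis 3 1
      - ext3 (transpose (cgrad (b0 G y0) x') *v b0 G y0 x'))"

definition pvec :: "(real^3 \<Rightarrow> real^3^3) \<Rightarrow> (real^2 \<Rightarrow> real^3) \<Rightarrow> (real^2) set \<Rightarrow> (real^2 \<Rightarrow> real^3) \<Rightarrow> real^2 \<Rightarrow> real^3" where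
  "pvec G y0 \<omega> V x' = - (matrix_inv (transpose (Q0 G y0 x')) *v ext3 (transpose (wgrad \<omega> V x') *v b0 G y0 x'))"

definition I4 :: "(real^3^3 \<Rightarrow> ennreal) \<Rightarrow> (real^3 \<Rightarrow> real^3^3) \<Rightarrow> (real^2 \<Rightarrow> real^3) \<Rightarrow> (real^2) set
                   \<Rightarrow> (real^2 \<Rightarrow> real^3) \<Rightarrow> (real^2 \<Rightarrow> real^2^2) \<Rightarrow> ennreal" where
  "I4 W G y0 \<omega> V S =
     ennreal (1/2) * (\<integral>\<^sup>+x\<in>\<omega>. ennreal (Q2 W G x (S x
          + (1/2) *\<^sub>R (transpose (wgrad \<omega> V x) ** wgrad \<omega> V x)
          + (1/24) *\<^sub>R (transpose (cgrad (b0 G y0) x) ** cgrad (b0 G y0) x)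
          - (1/48) *\<^sub>R blk2 (pds [3, 3] G (pt x 0)))) \<partial>lborel)
   + ennreal (1/24) * (\<integral>\<^sup>+x\<in>\<omega>. ennreal (Q2 W G x
          (transpose (cgrad y0 x) ** wgrad \<omega> (pvec G y0 \<omega> V) x
           + transpose (wgrad \<omega> V x) ** cgrad (b0 G y0) x)) \<partial>lborel)
   + ennreal (1/1440) * (\<integral>\<^sup>+x\<in>\<omega>. ennreal (Q2 W G x
          (\<chi> i j. riemann G (pt x 0) (e23 i) 3 (e23 j) 3)) \<partial>lborel)"

definition Vspace :: "(real^2 \<Rightarrow> real^3) \<Rightarrow> (real^2) set \<Rightarrow> (real^2 \<Rightarrow> real^3) set" where
  "Vspace y0 \<omega> = {V. sobolev 2 \<omega> V \<and>
      (AE x in lebesgue_on \<omega>. msym (transpose (cgrad y0 x) ** wgrad \<omega> V x) = 0)}"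

definition Sspace :: "(real^2 \<Rightarrow> real^3) \<Rightarrow> (real^2) set \<Rightarrow> (real^2 \<Rightarrow> real^2^2) set" where
  "Sspace y0 \<omega> = {S. (\<forall>i j. L2 \<omega> (\<lambda>x. S x $ i $ j)) \<and>
      (\<exists>w :: nat \<Rightarrow> real^2 \<Rightarrow> real^3. (\<forall>n. sobolev 1 \<omega> (w n)) \<and>
         ((\<lambda>n. \<integral>\<^sup>+x\<in>\<omega>. ennreal ((norm (msym (transpose (cgrad y0 x) ** wgrad \<omega> (w n) x) - S x))^2) \<partial>lborel)
           \<longlonglongrightarrow> 0))}"

end

theory Submission
  imports Defs
begin

text \<open>
  The form \<open>Q\<^sub>3\<close> dominates \<open>|sym F|\<^sup>2\<close> and vanishes on skew matrices, so \<open>I\<^sub>4 = 0\<close> says that the symmetric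
  parts of the arguments of \<open>Q\<^sub>2\<close> in the stretching and the bending term vanish almost everywhere.

  Let \<open>X = [\<partial>\<^sub>1y\<^sub>0, \<partial>\<^sub>2y\<^sub>0, b\<^sub>0]\<close>, so that \<open>X\<^sup>T X\<close> is the metric on the midplate, and
  \<open>M = [\<partial>\<^sub>1V, \<partial>\<^sub>2V, p]\<close>. By the constraint on \<open>V\<close> and the definition of \<open>p\<close>, the field
  \<open>S = M X\<^sup>-\<^sup>1\<close> is skew. Symmetry of the second derivatives of \<open>V\<close> and vanishing of the bending term
  force its weak gradient to vanish, hence \<open>S\<close> is constant and \<open>V = S y\<^sub>0 + c\<close>.

  The metric induced by \<open>y\<^sub>0 + t b\<^sub>0 + t\<^sup>2 d\<^sub>0 / 2\<close> agrees with \<open>G\<close> to first order in \<open>t\<close>, so the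
  curvatures \<open>R\<^sub>i\<^sub>3\<^sub>j\<^sub>3\<close> of \<open>G\<close> equal
  \<open>sym(\<nabla>y\<^sub>0\<^sup>T \<nabla>d\<^sub>0) + \<nabla>b\<^sub>0\<^sup>T \<nabla>b\<^sub>0 - \<partial>\<^sub>3\<^sub>3G / 2\<close>. Flatness of \<open>G\<close> on the midplate turns the
  stretching term into the difference of the two sides of the formula for the strain.
\<close>

section \<open>Partial derivatives and smooth functions\<close>

text \<open>\<open>V\<close> has only two weak derivatives in L2, so \<open>S\<close> has only a
  weak gradient and every identity along the midplate that involves \<open>V\<close> holds merely
  almost everywhere. The proof therefore needs weak derivatives that can be multiplied by the
  entries of \<open>X\<close> and of its inverse. These entries contain quotients and square roots;
  they are kept in the class \<open>smooth_bdd\<close> of functions all of whose partial derivatives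
  are bounded, and the lower bounds for the denominators come from positive definiteness of
  \<open>G\<close> on the compact closure.

  That the gradient of \<open>S\<close> vanishes is a matter of six linear equations for six
  unknowns. The unknowns are two skew matrices \<open>A 1\<close> and \<open>A 2\<close>, the weak
  partial derivatives of \<open>S\<close>. Symmetry of second derivatives gives the vector equation
  \<open>A 1 *v pd 2 y0 x = A 2 *v pd 1 y0 x\<close>, and the bending term, a symmetric 2x2 matrix,
  reduces to the symmetrised products of \<open>pd k y0 x\<close> with
  \<open>A l *v b x\<close>.\<close>

definition has_pd :: "'n::finite \<Rightarrow> (real^'n \<Rightarrow> 'a::real_normed_vector) \<Rightarrow> real^'n \<Rightarrow> 'a \<Rightarrow> bool" where
  "has_pd i f x D \<longleftrightarrow> ((\<lambda>t. f (x + t *\<^sub>R axis i 1)) has_vector_derivative D) (at 0)"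

lemma has_pd_imp_pd: "has_pd i f x D \<Longrightarrow> pd i f x = D"
  unfolding has_pd_def pd_def by (rule vector_derivative_at)

lemma has_pd_imp_differentiable:
  "has_pd i f x D \<Longrightarrow> (\<lambda>t. f (x + t *\<^sub>R axis i 1)) differentiable (at 0)"
  unfolding has_pd_def by (rule differentiableI_vector)

lemma differentiable_imp_has_pd:
  "(\<lambda>t. f (x + t *\<^sub>R axis i 1)) differentiable (at 0) \<Longrightarrow> has_pd i f x (pd i f x)"
  unfolding has_pd_def pd_def using vector_derivative_works by blast

lemma has_pd_cong_open:
  assumes "has_pd i f x D" "open S" "x \<in> S" "\<And>y. y \<in> S \<Longrightarrow> f y = g y"
  shows "has_pd i g x D"
  unfolding has_pd_def
proof (rule has_vector_derivative_transform_within_open)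
  show "((\<lambda>t. f (x + t *\<^sub>R axis i 1)) has_vector_derivative D) (at 0)"
    using assms(1) unfolding has_pd_def .
  have "open ((\<lambda>t. x + t *\<^sub>R axis i 1) -` S)"
    by (intro open_vimage assms continuous_intros)
  then show "open {t. x + t *\<^sub>R axis i 1 \<in> S}" by (simp add: vimage_def)
qed (use assms in auto)

text \<open>\<open>vector_derivative\<close> depends only on the germ of its argument, so no
  differentiability is required; iterated derivatives can thus be rewritten on an open set before
  their existence is known.\<close>

lemma pd_cong_open:
  assumes "open S" "x \<in> S" "\<And>y. y \<in> S \<Longrightarrow> f y = g y"
  shows "pd i f x = pd i g x"
proof -
  have "open ((\<lambda>t. x + t *\<^sub>R axis i 1) -` S)"
    by (intro open_vimage assms continuous_intros)
  moreover have "0 \<in> (\<lambda>t. x + t *\<^sub>R axis i 1) -` S" using assms by simp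
  ultimately have "\<forall>\<^sub>F t in nhds 0. x + t *\<^sub>R axis i 1 \<in> S"
    unfolding eventually_nhds by blast
  then have "\<forall>\<^sub>F t in nhds 0. t \<in> UNIV \<longrightarrow> f (x + t *\<^sub>R axis i 1) = g (x + t *\<^sub>R axis i 1)"
    by eventually_elim (use assms in auto)
  then show ?thesis
    unfolding pd_def by (intro vector_derivative_cong_eq) auto
qed

lemma pds_cong_open:
  assumes "open S" "\<And>y. y \<in> S \<Longrightarrow> f y = g y" "x \<in> S"
  shows "pds is f x = pds is g x"
  using assms(3)
proof (induction "is" arbitrary: x)
  case (Cons i "is")
  show ?case using pd_cong_open[OF assms(1) Cons.prems Cons.IH] by simp
qed (use assms in auto)

lemma pds_append: "pds (is @ js) f = pds is (pds js f)"
  by (induction "is") auto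

lemma has_pd_const: "has_pd i (\<lambda>x. a) x 0"
  unfolding has_pd_def by simp

lemma has_pd_add: "has_pd i f x D \<Longrightarrow> has_pd i g x E \<Longrightarrow> has_pd i (\<lambda>x. f x + g x) x (D + E)"
  unfolding has_pd_def by (rule has_vector_derivative_add)

lemma has_pd_bounded_linear:
  "bounded_linear L \<Longrightarrow> has_pd i f x D \<Longrightarrow> has_pd i (\<lambda>x. L (f x)) x (L D)"
  unfolding has_pd_def by (rule bounded_linear.has_vector_derivative)

lemma has_pd_bounded_bilinear:
  assumes "bounded_bilinear B" "has_pd i f x D" "has_pd i g x E"
  shows "has_pd i (\<lambda>x. B (f x) (g x)) x (B (f x) E + B D (g x))"
  using bounded_bilinear.has_vector_derivative[OF assms(1), of "\<lambda>t. f (x + t *\<^sub>R axis i 1)" D 0 UNIV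
     "\<lambda>t. g (x + t *\<^sub>R axis i 1)" E] assms(2,3)
  unfolding has_pd_def by simp

lemma has_pd_mult:
  fixes f g :: "real^'n::finite \<Rightarrow> real"
  shows "has_pd i f x D \<Longrightarrow> has_pd i g x E \<Longrightarrow> has_pd i (\<lambda>x. f x * g x) x (f x * E + D * g x)"
  by (rule has_pd_bounded_bilinear[OF bounded_bilinear_mult])

lemma has_pd_inner:
  "has_pd i f x D \<Longrightarrow> has_pd i g x E \<Longrightarrow> has_pd i (\<lambda>x. f x \<bullet> g x) x (f x \<bullet> E + D \<bullet> g x)"
  by (rule has_pd_bounded_bilinear[OF bounded_bilinear_inner])

lemma has_pd_DERIV:
  fixes f :: "real^'n::finite \<Rightarrow> real"
  assumes "has_pd i f x D" "(h has_real_derivative E) (at (f x))"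
  shows "has_pd i (\<lambda>x. h (f x)) x (E * D)"
proof -
  have "((\<lambda>t. f (x + t *\<^sub>R axis i 1)) has_real_derivative D) (at 0)"
    using assms(1) unfolding has_pd_def has_real_derivative_iff_has_vector_derivative .
  then show ?thesis
    using DERIV_chain2[of h E "\<lambda>t. f (x + t *\<^sub>R axis i 1)" 0 D UNIV] assms(2)
    unfolding has_pd_def has_real_derivative_iff_has_vector_derivative[symmetric] by simp
qed

lemma has_pd_vec_nth: "has_pd i f x D \<Longrightarrow> has_pd i (\<lambda>x. f x $ j) x (D $ j)"
  by (rule has_pd_bounded_linear[OF bounded_linear_vec_nth])

lemma has_pd_vec_nth_iff:
  fixes f :: "real^'n::finite \<Rightarrow> real^'m::finite"
  shows "has_pd i f x D \<longleftrightarrow> (\<forall>j. has_pd i (\<lambda>x. f x $ j) x (D $ j))"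
proof
  assume *: "\<forall>j. has_pd i (\<lambda>x. f x $ j) x (D $ j)"
  show "has_pd i f x D"
    unfolding has_pd_def has_vector_derivative_def
  proof (subst has_derivative_componentwise_within, rule ballI)
    fix b :: "real^'m" assume "b \<in> Basis"
    then obtain j where b: "b = axis j 1" by (auto simp: Basis_vec_def)
    show "((\<lambda>t. f (x + t *\<^sub>R axis i 1) \<bullet> b) has_derivative (\<lambda>t. t *\<^sub>R D \<bullet> b)) (at 0)"
      using *[rule_format, of j] unfolding has_pd_def has_vector_derivative_def b
      by (simp add: inner_axis)
  qed
qed (auto intro: has_pd_vec_nth)

text \<open>This coinductive criterion avoids explicit formulas for higher derivatives of products, inverses
  and square roots.\<close>

lemma
  assumes "open S" "\<And>f. f \<in> C \<Longrightarrow> continuous_on S f"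
    "\<And>f i. f \<in> C \<Longrightarrow> \<exists>f'\<in>C. \<forall>x\<in>S. has_pd i f x (f' x)" "f \<in> C"
  shows pd_closed_family_pds: "\<exists>f'\<in>C. \<forall>x\<in>S. pds is f x = f' x"
    and pd_closed_family_smooth: "smooth_on S f"
proof -
  show *: "\<exists>f'\<in>C. \<forall>x\<in>S. pds is f x = f' x" for "is"
  proof (induction "is")
    case (Cons i "is")
    then obtain f' where f': "f' \<in> C" "\<forall>x\<in>S. pds is f x = f' x" by auto
    from assms(3)[OF this(1), of i] obtain g where g: "g \<in> C" "\<forall>x\<in>S. has_pd i f' x (g x)" by auto
    have "pds (i # is) f x = g x" if "x \<in> S" for x
      using pd_cong_open[OF assms(1) that, of "pds is f" f' i] f' g has_pd_imp_pd that by fastforce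
    with g show ?case by auto
  qed (use assms in auto)
  show "smooth_on S f"
    unfolding smooth_on_def
  proof (intro allI conjI ballI)
    fix "is" i
    obtain f' where f': "f' \<in> C" "\<forall>x\<in>S. pds is f x = f' x" using * by auto
    then show "continuous_on S (pds is f)"
      using assms(2)[OF f'(1)] continuous_on_cong[OF refl] by (metis (no_types, lifting))
    fix x assume x: "x \<in> S"
    from assms(3)[OF f'(1), of i] obtain g where g: "g \<in> C" "\<forall>x\<in>S. has_pd i f' x (g x)" by auto
    have "has_pd i (pds is f) x (g x)"
      by (rule has_pd_cong_open[OF _ assms(1) x, of i f']) (use f' g x in auto)
    then show "(\<lambda>t. pds is f (x + t *\<^sub>R axis i 1)) differentiable at 0"
      by (rule has_pd_imp_differentiable)
  qed
qed

text \<open>Polynomials in the generators \<open>B\<close>. By the Leibniz rule such an algebra is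
  closed under partial derivatives as soon as the derivatives of the generators lie in it, so it can
  serve as the family \<open>C\<close> of the criterion above; continuity and boundedness too need
  checking on generators only.\<close>

inductive_set fun_alg :: "('a \<Rightarrow> real) set \<Rightarrow> ('a \<Rightarrow> real) set" for B where
  gen: "f \<in> B \<Longrightarrow> f \<in> fun_alg B"
| const: "(\<lambda>x. a) \<in> fun_alg B"
| add: "f \<in> fun_alg B \<Longrightarrow> g \<in> fun_alg B \<Longrightarrow> (\<lambda>x. f x + g x) \<in> fun_alg B"
| mult: "f \<in> fun_alg B \<Longrightarrow> g \<in> fun_alg B \<Longrightarrow> (\<lambda>x. f x * g x) \<in> fun_alg B"

lemma fun_alg_continuous:
  assumes "f \<in> fun_alg B" "\<And>f. f \<in> B \<Longrightarrow> continuous_on S f"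
  shows "continuous_on S f"
  using assms(1)
proof induction
  case (add f g)
  then show ?case by (intro continuous_on_add)
next
  case (mult f g)
  then show ?case by (intro continuous_on_mult)
qed (use assms(2) in auto)

lemma fun_alg_bounded:
  assumes "f \<in> fun_alg B" "\<And>f. f \<in> B \<Longrightarrow> bounded (f ` S)"
  shows "bounded (f ` S)"
  using assms(1)
proof induction
  case (add f g)
  then show ?case by (intro bounded_plus_comp)
next
  case (mult f g)
  then obtain a b where "\<forall>x\<in>S. norm (f x) \<le> a" "\<forall>x\<in>S. norm (g x) \<le> b"
    unfolding bounded_iff by blast
  then have "norm (f x * g x) \<le> a * b" if "x \<in> S" for x
    using that unfolding norm_mult by (intro mult_mono) (auto intro: order_trans[OF norm_ge_zero])
  then show ?case unfolding bounded_iff by auto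
next
  case (const a)
  then show ?case by (auto intro: finite_imp_bounded finite_subset[of _ "{a}"])
qed (rule assms(2))

lemma fun_alg_has_pd:
  assumes "f \<in> fun_alg B" "\<And>f i. f \<in> B \<Longrightarrow> \<exists>f'\<in>fun_alg B. \<forall>x\<in>S. has_pd i f x (f' x)"
  shows "\<exists>f'\<in>fun_alg B. \<forall>x\<in>S. has_pd i f x (f' x)"
  using assms(1)
proof induction
  case (const a)
  then show ?case using has_pd_const fun_alg.const[of 0] by fastforce
next
  case (add f g)
  then obtain f' g' where "f' \<in> fun_alg B" "\<forall>x\<in>S. has_pd i f x (f' x)"
     "g' \<in> fun_alg B" "\<forall>x\<in>S. has_pd i g x (g' x)" by auto
  then show ?case
    by (intro bexI[of _ "\<lambda>x. f' x + g' x"]) (auto intro: has_pd_add fun_alg.add)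
next
  case (mult f g)
  then obtain f' g' where "f' \<in> fun_alg B" "\<forall>x\<in>S. has_pd i f x (f' x)"
     "g' \<in> fun_alg B" "\<forall>x\<in>S. has_pd i g x (g' x)" by auto
  then show ?case using mult.hyps
    by (intro bexI[of _ "\<lambda>x. f x * g' x + f' x * g x"]) (auto intro!: has_pd_mult fun_alg.add fun_alg.mult)
qed (use assms(2) in auto)

text \<open>A substitute, inside the open set, for smoothness up to the boundary: bounded
  coefficients keep square-integrable functions square integrable, and bounded derivatives do the
  same for the terms produced by the product rule.\<close>

definition smooth_bdd :: "(real^'n::finite) set \<Rightarrow> (real^'n \<Rightarrow> real) \<Rightarrow> bool" where
  "smooth_bdd S f \<longleftrightarrow> smooth_on S f \<and> (\<forall>is. bounded (pds is f ` S))"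

lemma smooth_on_fun_alg:
  assumes "open S" "\<And>f. f \<in> B \<Longrightarrow> continuous_on S f"
    "\<And>f i. f \<in> B \<Longrightarrow> \<exists>f'\<in>fun_alg B. \<forall>x\<in>S. has_pd i f x (f' x)" "f \<in> fun_alg B"
  shows "smooth_on S f"
proof (rule pd_closed_family_smooth[OF assms(1) _ _ assms(4)])
  show "continuous_on S g" if "g \<in> fun_alg B" for g
    using fun_alg_continuous[OF that assms(2)] .
  show "\<exists>f'\<in>fun_alg B. \<forall>x\<in>S. has_pd i g x (f' x)" if "g \<in> fun_alg B" for g i
    using fun_alg_has_pd[OF that assms(3)] .
qed

lemma smooth_bdd_fun_alg:
  assumes "open S" "\<And>f. f \<in> B \<Longrightarrow> continuous_on S f" "\<And>f. f \<in> B \<Longrightarrow> bounded (f ` S)"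
    "\<And>f i. f \<in> B \<Longrightarrow> \<exists>f'\<in>fun_alg B. \<forall>x\<in>S. has_pd i f x (f' x)" "f \<in> fun_alg B"
  shows "smooth_bdd S f"
  unfolding smooth_bdd_def
proof (intro conjI allI)
  show "smooth_on S f" by (rule smooth_on_fun_alg[OF assms(1,2,4,5)])
  fix "is"
  have "\<exists>f'\<in>fun_alg B. \<forall>x\<in>S. pds is f x = f' x"
  proof (rule pd_closed_family_pds[OF assms(1) _ _ assms(5)])
    show "continuous_on S g" if "g \<in> fun_alg B" for g
      using fun_alg_continuous[OF that assms(2)] .
    show "\<exists>f'\<in>fun_alg B. \<forall>x\<in>S. has_pd i g x (f' x)" if "g \<in> fun_alg B" for g i
      using fun_alg_has_pd[OF that assms(4)] .
  qed
  then obtain f' where "f' \<in> fun_alg B" "\<forall>x\<in>S. pds is f x = f' x" by auto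
  then show "bounded (pds is f ` S)"
    using fun_alg_bounded[of f' B S] assms(3) by (metis (no_types, lifting) image_cong)
qed

lemma smooth_on_continuous: "smooth_on S f \<Longrightarrow> continuous_on S (pds is f)"
  unfolding smooth_on_def by auto

lemma smooth_on_has_pd: "smooth_on S f \<Longrightarrow> x \<in> S \<Longrightarrow> has_pd i (pds is f) x (pds (i # is) f x)"
  unfolding smooth_on_def using differentiable_imp_has_pd by fastforce

lemma smooth_on_has_pd1: "smooth_on S f \<Longrightarrow> x \<in> S \<Longrightarrow> has_pd i f x (pd i f x)"
  using smooth_on_has_pd[of S f x i "[]"] by simp

lemma smooth_on_pds: "smooth_on S f \<Longrightarrow> smooth_on S (pds js f)"
  unfolding smooth_on_def by (metis pds_append)

lemma smooth_bdd_pds: "smooth_bdd S f \<Longrightarrow> smooth_bdd S (pds js f)"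
  unfolding smooth_bdd_def using smooth_on_pds by (metis pds_append)

lemma smooth_bdd_pd: "smooth_bdd S f \<Longrightarrow> smooth_bdd S (pd i f)"
  using smooth_bdd_pds[of S f "[i]"] by simp

lemma smooth_bdd_continuous: "smooth_bdd S f \<Longrightarrow> continuous_on S f"
  using smooth_on_continuous[of S f "[]"] unfolding smooth_bdd_def by simp

lemma smooth_bdd_bounded: "smooth_bdd S f \<Longrightarrow> bounded (f ` S)"
  unfolding smooth_bdd_def by (metis pds.simps(1))

lemma smooth_bdd_has_pd: "smooth_bdd S f \<Longrightarrow> x \<in> S \<Longrightarrow> has_pd i f x (pd i f x)"
  unfolding smooth_bdd_def using smooth_on_has_pd1 by blast

lemma smooth_on_cong_open:
  assumes "open S" "\<And>x. x \<in> S \<Longrightarrow> f x = g x" "smooth_on S f"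
  shows "smooth_on S g"
  unfolding smooth_on_def
proof (intro allI conjI ballI)
  fix "is" i
  have eq: "pds is f x = pds is g x" if "x \<in> S" for x
    by (rule pds_cong_open[OF assms(1) _ that]) (use assms in auto)
  show "continuous_on S (pds is g)"
    by (rule continuous_on_eq[OF smooth_on_continuous[OF assms(3)] eq])
  fix x assume x: "x \<in> S"
  have "has_pd i (pds is g) x (pds (i # is) f x)"
    by (rule has_pd_cong_open[OF smooth_on_has_pd[OF assms(3) x] assms(1) x eq])
  then show "(\<lambda>t. pds is g (x + t *\<^sub>R axis i 1)) differentiable at 0"
    by (rule has_pd_imp_differentiable)
qed

lemma smooth_bdd_cong_open:
  assumes "open S" "\<And>x. x \<in> S \<Longrightarrow> f x = g x" "smooth_bdd S f"
  shows "smooth_bdd S g"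
  unfolding smooth_bdd_def
proof (intro conjI allI)
  show "smooth_on S g"
    by (rule smooth_on_cong_open[OF assms(1,2)]) (use assms(3) in \<open>auto simp: smooth_bdd_def\<close>)
  fix "is"
  have "pds is f ` S = pds is g ` S"
    by (intro image_cong refl pds_cong_open[OF assms(1)]) (use assms in auto)
  then show "bounded (pds is g ` S)" using assms(3) unfolding smooth_bdd_def by metis
qed

lemma smooth_bdd_const: "open S \<Longrightarrow> smooth_bdd S (\<lambda>x. a)"
  by (rule smooth_bdd_fun_alg[where B="{}"]) (auto intro: fun_alg.const)

lemma in_range_pds: "f \<in> range (\<lambda>is. pds is f)"
  by (rule range_eqI[of _ _ "[]"]) simp

lemma smooth_on_range_pds:
  assumes "smooth_on S f" "g \<in> range (\<lambda>is. pds is f)"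
  shows "continuous_on S g" "\<exists>g'\<in>range (\<lambda>is. pds is f). \<forall>x\<in>S. has_pd i g x (g' x)"
proof -
  from assms(2) obtain "is" where "is": "g = pds is f" by auto
  show "continuous_on S g" using smooth_on_continuous[OF assms(1)] "is" by auto
  have "\<forall>x\<in>S. has_pd i g x (pds (i # is) f x)" using smooth_on_has_pd[OF assms(1)] "is" by blast
  then show "\<exists>g'\<in>range (\<lambda>is. pds is f). \<forall>x\<in>S. has_pd i g x (g' x)"
    by blast
qed

lemma smooth_on_range_pds_fun_alg:
  fixes f :: "real^'n::finite \<Rightarrow> real"
  assumes "smooth_on S f" "h \<in> range (\<lambda>is. pds is f)" "range (\<lambda>is. pds is f) \<subseteq> B"
  shows "\<exists>h'\<in>fun_alg B. \<forall>x\<in>S. has_pd i h x (h' x)"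
proof -
  obtain h' where "h' \<in> range (\<lambda>is. pds is f)" "\<forall>x\<in>S. has_pd i h x (h' x)"
    using smooth_on_range_pds(2)[OF assms(1,2), of i] by auto
  with assms(3) show ?thesis by (intro bexI[of _ h']) (auto intro: fun_alg.gen)
qed

text \<open>The generating set consists of all iterated partial derivatives of \<open>f\<close> and
  \<open>g\<close>, which is closed under \<open>pd\<close> by construction.\<close>

lemma
  fixes f g :: "real^'n::finite \<Rightarrow> real"
  assumes "open S"
  shows smooth_on_mult: "smooth_on S f \<Longrightarrow> smooth_on S g \<Longrightarrow> smooth_on S (\<lambda>x. f x * g x)"
    and smooth_bdd_add: "smooth_bdd S f \<Longrightarrow> smooth_bdd S g \<Longrightarrow> smooth_bdd S (\<lambda>x. f x + g x)"
    and smooth_bdd_mult: "smooth_bdd S f \<Longrightarrow> smooth_bdd S g \<Longrightarrow> smooth_bdd S (\<lambda>x. f x * g x)"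
proof -
  let ?B = "range (\<lambda>is. pds is f) \<union> range (\<lambda>is. pds is g)"
  have fg: "f \<in> fun_alg ?B" "g \<in> fun_alg ?B"
    by (rule fun_alg.gen, rule UnI1, rule in_range_pds) (rule fun_alg.gen, rule UnI2, rule in_range_pds)
  have 1: "continuous_on S h" if "smooth_on S f" "smooth_on S g" "h \<in> ?B" for h
    using that(3) by (rule UnE) (rule smooth_on_range_pds(1)[OF that(1)] smooth_on_range_pds(1)[OF that(2)]; assumption)+
  have 2: "\<exists>h'\<in>fun_alg ?B. \<forall>x\<in>S. has_pd i h x (h' x)" if "smooth_on S f" "smooth_on S g" "h \<in> ?B" for h i
    using that(3)
  proof (rule UnE)
    assume "h \<in> range (\<lambda>is. pds is f)"
    then show ?thesis by (rule smooth_on_range_pds_fun_alg[OF that(1)]) (rule Un_upper1)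
  next
    assume "h \<in> range (\<lambda>is. pds is g)"
    then show ?thesis by (rule smooth_on_range_pds_fun_alg[OF that(2)]) (rule Un_upper2)
  qed
  have 3: "bounded (h ` S)" if "smooth_bdd S f" "smooth_bdd S g" "h \<in> ?B" for h
    using that(3) that(1,2)[unfolded smooth_bdd_def] by auto
  have alg: "(\<lambda>x. f x + g x) \<in> fun_alg ?B" "(\<lambda>x. f x * g x) \<in> fun_alg ?B"
    by (rule fun_alg.add[OF fg], rule fun_alg.mult[OF fg])
  have s: "smooth_on S h" if "smooth_on S f" "smooth_on S g" "h \<in> fun_alg ?B" for h
    by (rule smooth_on_fun_alg[OF assms 1[OF that(1,2)] 2[OF that(1,2)] that(3)])
  have b: "smooth_bdd S h" if "smooth_bdd S f" "smooth_bdd S g" "h \<in> fun_alg ?B" for h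
  proof -
    have fg: "smooth_on S f" "smooth_on S g" using that unfolding smooth_bdd_def by auto
    show ?thesis
      by (rule smooth_bdd_fun_alg[OF assms 1[OF fg] 3[OF that(1,2)] 2[OF fg] that(3)])
  qed
  show "smooth_on S f \<Longrightarrow> smooth_on S g \<Longrightarrow> smooth_on S (\<lambda>x. f x * g x)"
    by (rule s[OF _ _ alg(2)])
  show "smooth_bdd S f \<Longrightarrow> smooth_bdd S g \<Longrightarrow> smooth_bdd S (\<lambda>x. f x + g x)"
    by (rule b[OF _ _ alg(1)])
  show "smooth_bdd S f \<Longrightarrow> smooth_bdd S g \<Longrightarrow> smooth_bdd S (\<lambda>x. f x * g x)"
    by (rule b[OF _ _ alg(2)])
qed

lemma smooth_bdd_minus: "open S \<Longrightarrow> smooth_bdd S f \<Longrightarrow> smooth_bdd S (\<lambda>x. - f x)"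
  using smooth_bdd_mult[of S "\<lambda>x. -1" f] smooth_bdd_const[of S "-1"] by simp

lemma smooth_bdd_diff:
  "open S \<Longrightarrow> smooth_bdd S f \<Longrightarrow> smooth_bdd S g \<Longrightarrow> smooth_bdd S (\<lambda>x. f x - g x)"
  using smooth_bdd_add[of S f "\<lambda>x. - g x"] smooth_bdd_minus[of S g] by simp

lemma smooth_bdd_sum:
  "open S \<Longrightarrow> (\<And>a. a \<in> A \<Longrightarrow> smooth_bdd S (f a)) \<Longrightarrow> smooth_bdd S (\<lambda>x. \<Sum>a\<in>A. f a x)"
  by (induction A rule: infinite_finite_induct) (auto intro: smooth_bdd_const smooth_bdd_add)

lemma smooth_bdd_prod:
  "open S \<Longrightarrow> (\<And>a. a \<in> A \<Longrightarrow> smooth_bdd S (f a)) \<Longrightarrow> smooth_bdd S (\<lambda>x. \<Prod>a\<in>A. f a x)"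
  by (induction A rule: infinite_finite_induct) (auto intro: smooth_bdd_const smooth_bdd_mult)

text \<open>Adjoining \<open>1/f\<close> to the derivatives of \<open>f\<close> suffices, because
  its derivative \<open>- (1/f)^2 * pd i f\<close> is again a polynomial in the generators. The
  bound \<open>d\<close> makes the new generator bounded.\<close>

lemma smooth_bdd_inverse:
  assumes "open S" "smooth_bdd S f" "d > 0" "\<And>x. x \<in> S \<Longrightarrow> d \<le> \<bar>f x\<bar>"
  shows "smooth_bdd S (\<lambda>x. inverse (f x))"
proof -
  let ?B = "insert (\<lambda>x. inverse (f x)) (range (\<lambda>is. pds is f))"
  have f0: "f x \<noteq> 0" if "x \<in> S" for x using assms(3) assms(4)[OF that] by auto
  have s: "smooth_on S f" using assms(2) unfolding smooth_bdd_def by auto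
  have inv: "(\<lambda>x. inverse (f x)) \<in> fun_alg ?B" by (rule fun_alg.gen) simp
  show ?thesis
  proof (rule smooth_bdd_fun_alg[OF assms(1) _ _ _ inv])
    fix h assume h: "h \<in> ?B"
    show "continuous_on S h"
      using h smooth_on_range_pds(1)[OF s] smooth_bdd_continuous[OF assms(2)] f0
      by (auto intro!: continuous_intros)
    show "bounded (h ` S)"
    proof -
      have "\<bar>inverse (f x)\<bar> \<le> inverse d" if "x \<in> S" for x
        using assms(3) assms(4)[OF that] by (simp add: le_imp_inverse_le)
      then have "bounded ((\<lambda>x. inverse (f x)) ` S)" unfolding bounded_iff by auto
      then show ?thesis using h assms(2) unfolding smooth_bdd_def by auto
    qed
    fix i
    show "\<exists>h'\<in>fun_alg ?B. \<forall>x\<in>S. has_pd i h x (h' x)"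
    proof (cases "h = (\<lambda>x. inverse (f x))")
      case True
      have d: "has_pd i h x (- 1 * (inverse (f x) * inverse (f x)) * pds [i] f x)" if "x \<in> S" for x
        using has_pd_DERIV[OF smooth_on_has_pd1[OF s that] DERIV_inverse[OF f0[OF that]]] True
        by (simp add: power2_eq_square)
      have m: "(\<lambda>x. - 1 * (inverse (f x) * inverse (f x)) * pds [i] f x) \<in> fun_alg ?B"
        by (intro fun_alg.mult fun_alg.const inv) (rule fun_alg.gen, rule insertI2, rule rangeI)
      show ?thesis by (rule bexI[OF _ m], rule ballI, rule d)
    next
      case False
      then show ?thesis
        using smooth_on_range_pds_fun_alg[OF s, of h ?B i] h False by (metis insertE subset_insertI)
    qed
  qed
qed

text \<open>The derivative of the root is written as \<open>1/2 * sqrt f * (1/f) * pd i f\<close>,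
  without the reciprocal of the root, so that the root together with the derivatives of
  \<open>f\<close> and of \<open>1/f\<close> generates a closed algebra.\<close>

lemma smooth_bdd_sqrt:
  assumes "open S" "smooth_bdd S f" "d > 0" "\<And>x. x \<in> S \<Longrightarrow> d \<le> f x"
  shows "smooth_bdd S (\<lambda>x. sqrt (f x))"
proof -
  let ?r = "\<lambda>x. inverse (f x)"
  let ?B = "insert (\<lambda>x. sqrt (f x)) (range (\<lambda>is. pds is f) \<union> range (\<lambda>is. pds is ?r))"
  have f0: "f x > 0" if "x \<in> S" for x using assms(3) assms(4)[OF that] by auto
  have s: "smooth_on S f" using assms(2) unfolding smooth_bdd_def by auto
  have r: "smooth_bdd S ?r"
    by (rule smooth_bdd_inverse[OF assms(1-3)]) (use assms(4) in force)
  then have sr: "smooth_on S ?r" unfolding smooth_bdd_def by auto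
  have sq: "(\<lambda>x. sqrt (f x)) \<in> fun_alg ?B" by (rule fun_alg.gen) simp
  have rr: "?r \<in> fun_alg ?B"
    by (rule fun_alg.gen, rule insertI2, rule UnI2, rule in_range_pds)
  show ?thesis
  proof (rule smooth_bdd_fun_alg[OF assms(1) _ _ _ sq])
    fix h assume h: "h \<in> ?B"
    show "continuous_on S h"
      using h smooth_on_range_pds(1)[OF s] smooth_on_range_pds(1)[OF sr]
        smooth_bdd_continuous[OF assms(2)] 
      by (auto intro!: continuous_intros)
    show "bounded (h ` S)"
    proof -
      obtain M where M: "\<And>x. x \<in> S \<Longrightarrow> norm (f x) \<le> M"
        using smooth_bdd_bounded[OF assms(2)] unfolding bounded_iff by auto
      have "norm (sqrt (f x)) \<le> sqrt M" if "x \<in> S" for x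
        using M[OF that] f0[OF that] by simp
      then have "bounded ((\<lambda>x. sqrt (f x)) ` S)" unfolding bounded_iff by auto
      then show ?thesis using h assms(2) r unfolding smooth_bdd_def by auto
    qed
    fix i
    show "\<exists>h'\<in>fun_alg ?B. \<forall>x\<in>S. has_pd i h x (h' x)"
    proof (cases "h = (\<lambda>x. sqrt (f x))")
      case True
      have d: "has_pd i h x (1/2 * (sqrt (f x) * ?r x) * pds [i] f x)" if "x \<in> S" for x
      proof -
        have "inverse (sqrt (f x)) / 2 = 1/2 * (sqrt (f x) * ?r x)"
          using f0[OF that] by (simp add: field_simps flip: power2_eq_square)
        then show ?thesis
          using has_pd_DERIV[OF smooth_on_has_pd1[OF s that] DERIV_real_sqrt[OF f0[OF that]], of i] True
          by simp
      qed
      have m: "(\<lambda>x. 1/2 * (sqrt (f x) * ?r x) * pds [i] f x) \<in> fun_alg ?B"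
        by (intro fun_alg.mult fun_alg.const sq rr) (rule fun_alg.gen, rule insertI2, rule UnI1, rule rangeI)
      show ?thesis by (rule bexI[OF _ m], rule ballI, rule d)
    next
      case False
      then have "h \<in> range (\<lambda>is. pds is f) \<or> h \<in> range (\<lambda>is. pds is ?r)" using h by simp
      then show ?thesis
      proof
        assume "h \<in> range (\<lambda>is. pds is f)"
        then show ?thesis by (rule smooth_on_range_pds_fun_alg[OF s]) auto
      next
        assume "h \<in> range (\<lambda>is. pds is ?r)"
        then show ?thesis by (rule smooth_on_range_pds_fun_alg[OF sr]) auto
      qed
    qed
  qed
qed

lemma smooth_on_Un:
  assumes "open S" "open T" "smooth_on S f" "smooth_on T f"
  shows "smooth_on (S \<union> T) f"
  using assms unfolding smooth_on_def by (auto intro: continuous_on_open_Un)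

lemma pds_bounded_linear:
  assumes "open S" "smooth_on S f" "bounded_linear L" "x \<in> S"
  shows "pds is (\<lambda>x. L (f x)) x = L (pds is f x)"
  using assms(4)
proof (induction "is" arbitrary: x)
  case (Cons i "is")
  have "pds (i # is) (\<lambda>x. L (f x)) x = pd i (\<lambda>x. L (pds is f x)) x"
    using pd_cong_open[OF assms(1) Cons.prems, of "pds is (\<lambda>x. L (f x))" "\<lambda>x. L (pds is f x)" i] Cons.IH
    by simp
  also have "\<dots> = L (pds (i # is) f x)"
    using has_pd_bounded_linear[OF assms(3) smooth_on_has_pd[OF assms(2) Cons.prems], THEN has_pd_imp_pd] .
  finally show ?case .
qed simp

lemma smooth_on_bounded_linear:
  assumes "open S" "smooth_on S f" "bounded_linear L"
  shows "smooth_on S (\<lambda>x. L (f x))"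
proof (rule pd_closed_family_smooth[OF assms(1), of "range (\<lambda>is x. L (pds is f x))"])
  show "(\<lambda>x. L (f x)) \<in> range (\<lambda>is x. L (pds is f x))"
    by (rule image_eqI[of _ _ "[]"]) auto
  fix h assume "h \<in> range (\<lambda>is x. L (pds is f x))"
  then obtain "is" where h: "h = (\<lambda>x. L (pds is f x))" by auto
  show "continuous_on S h"
    unfolding h by (intro bounded_linear.continuous_on[OF assms(3)] smooth_on_continuous assms)
  fix i
  show "\<exists>h'\<in>range (\<lambda>is x. L (pds is f x)). \<forall>x\<in>S. has_pd i h x (h' x)"
    unfolding h
    by (rule bexI[of _ "\<lambda>x. L (pds (i # is) f x)"])
      (use has_pd_bounded_linear[OF assms(3) smooth_on_has_pd[OF assms(2)]] in \<open>auto simp del: pds.simps\<close>)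
qed

text \<open>Every derivative extends continuously to the closure, which is compact, so its values
  are bounded. The map \<open>L\<close> is meant for coordinate projections of vector and matrix
  fields.\<close>

lemma smooth_closure_imp_smooth_bdd:
  assumes "open S" "bounded S" "smooth_closure S f" "bounded_linear L"
  shows "smooth_bdd S (\<lambda>x. L (f x))"
  unfolding smooth_bdd_def
proof (intro conjI allI)
  show "smooth_on S (\<lambda>x. L (f x))"
    using smooth_on_bounded_linear assms unfolding smooth_closure_def by blast
  fix "is"
  obtain g where g: "continuous_on (closure S) g" "\<forall>x\<in>S. g x = pds is f x"
    using assms(3) unfolding smooth_closure_def by blast
  have "compact (g ` closure S)"
    using compact_continuous_image[OF g(1)] assms(2) by (simp add: compact_closure)
  then have "bounded (L ` g ` closure S)"
    by (intro bounded_linear_image[OF compact_imp_bounded assms(4)])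
  moreover have "pds is (\<lambda>x. L (f x)) ` S = L ` g ` S"
    using pds_bounded_linear[OF assms(1) _ assms(4), of f] assms(3) g(2)
    unfolding smooth_closure_def image_image by (intro image_cong) auto
  ultimately show "bounded (pds is (\<lambda>x. L (f x)) ` S)"
    using bounded_subset[of "L ` g ` closure S" "L ` g ` S"] image_mono[OF image_mono[OF closure_subset[of S]]]
    by metis
qed

lemma smooth_on_subset: "smooth_on S f \<Longrightarrow> T \<subseteq> S \<Longrightarrow> smooth_on T f"
  unfolding smooth_on_def using continuous_on_subset by blast

section \<open>Mean values and symmetry of second partial derivatives\<close>

lemma has_pd_line:
  assumes "has_pd i f (x + s *\<^sub>R axis i 1) D"
  shows "((\<lambda>t. f (x + t *\<^sub>R axis i 1)) has_vector_derivative D) (at s)"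
proof -
  have "((\<lambda>t. f ((x + s *\<^sub>R axis i 1) + (t - s) *\<^sub>R axis i 1)) has_vector_derivative (1 *\<^sub>R D)) (at s)"
    using assms unfolding has_pd_def
    by (intro vector_diff_chain_at[unfolded o_def, where f = "\<lambda>t. t - s" and f' = 1])
      (auto intro!: derivative_eq_intros)
  then show ?thesis by (simp add: algebra_simps)
qed

lemma has_pd_mvt:
  fixes f :: "real^'n::finite \<Rightarrow> real"
  assumes "0 < h" "\<And>t. 0 \<le> t \<Longrightarrow> t \<le> h \<Longrightarrow> has_pd i f (x + t *\<^sub>R axis i 1) (D (x + t *\<^sub>R axis i 1))"
  shows "\<exists>t. 0 < t \<and> t < h \<and> f (x + h *\<^sub>R axis i 1) - f x = h * D (x + t *\<^sub>R axis i 1)"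
proof -
  have "((\<lambda>t. f (x + t *\<^sub>R axis i 1)) has_real_derivative D (x + t *\<^sub>R axis i 1)) (at t)"
    if "0 \<le> t" "t \<le> h" for t
    using has_pd_line[OF assms(2)[OF that]] by (simp add: has_real_derivative_iff_has_vector_derivative)
  from MVT2[OF assms(1) this] show ?thesis by auto
qed

text \<open>Two mean value steps: first in direction \<open>i\<close> for the increment
  \<open>g\<close> of \<open>f\<close> in direction \<open>j\<close>, whose derivative is an
  increment of \<open>pd i f\<close>, then in direction \<open>j\<close> for that increment.\<close>

lemma second_difference:
  fixes f :: "real^'n::finite \<Rightarrow> real"
  assumes "smooth_on S f" "0 < h"
    and cube: "\<And>s t. 0 \<le> s \<Longrightarrow> s \<le> h \<Longrightarrow> 0 \<le> t \<Longrightarrow> t \<le> h \<Longrightarrow> x + s *\<^sub>R axis i 1 + t *\<^sub>R axis j 1 \<in> S"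
  shows "\<exists>s t. 0 < s \<and> s < h \<and> 0 < t \<and> t < h \<and>
    f (x + h *\<^sub>R axis i 1 + h *\<^sub>R axis j 1) - f (x + h *\<^sub>R axis i 1) - f (x + h *\<^sub>R axis j 1) + f x
      = h * h * pds [j, i] f (x + s *\<^sub>R axis i 1 + t *\<^sub>R axis j 1)"
proof -
  define g where "g y = f (y + h *\<^sub>R axis j 1) - f y" for y
  define Dg where "Dg y = pd i f (y + h *\<^sub>R axis j 1) - pd i f y" for y
  have "has_pd i g (x + s *\<^sub>R axis i 1) (Dg (x + s *\<^sub>R axis i 1))" if s: "0 \<le> s" "s \<le> h" for s
  proof -
    have "has_pd i f (x + s *\<^sub>R axis i 1 + h *\<^sub>R axis j 1) (pd i f (x + s *\<^sub>R axis i 1 + h *\<^sub>R axis j 1))"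
      by (rule smooth_on_has_pd1[OF assms(1)]) (use cube[OF s, of h] \<open>0 < h\<close> in auto)
    moreover have "has_pd i f (x + s *\<^sub>R axis i 1) (pd i f (x + s *\<^sub>R axis i 1))"
      by (rule smooth_on_has_pd1[OF assms(1)]) (use cube[OF s, of 0] \<open>0 < h\<close> in auto)
    ultimately show ?thesis unfolding g_def Dg_def has_pd_def
      by (intro has_vector_derivative_diff) (simp_all add: algebra_simps)
  qed
  from has_pd_mvt[OF \<open>0 < h\<close> this] obtain s where s: "0 < s" "s < h"
    "g (x + h *\<^sub>R axis i 1) - g x = h * Dg (x + s *\<^sub>R axis i 1)" by auto
  have "has_pd j (pd i f) (x + s *\<^sub>R axis i 1 + t *\<^sub>R axis j 1)
      (pds [j,i] f (x + s *\<^sub>R axis i 1 + t *\<^sub>R axis j 1))" if t: "0 \<le> t" "t \<le> h" for t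
    using smooth_on_has_pd[OF assms(1) cube[OF _ _ t], of s j "[i]"] s by simp
  from has_pd_mvt[OF \<open>0 < h\<close> this] obtain t where t: "0 < t" "t < h"
    "Dg (x + s *\<^sub>R axis i 1) = h * pds [j,i] f (x + s *\<^sub>R axis i 1 + t *\<^sub>R axis j 1)"
    unfolding Dg_def by auto
  have "g (x + h *\<^sub>R axis i 1) - g x = h * h * pds [j,i] f (x + s *\<^sub>R axis i 1 + t *\<^sub>R axis j 1)"
    using s(3) t(3) by simp
  then show ?thesis using s t unfolding g_def by (intro exI[of _ s] exI[of _ t]) simp
qed

text \<open>Schwarz's theorem. The second difference is symmetric in the two directions, so its
  quotient by the square of the step tends to both mixed derivatives.\<close>

lemma pds_swap:
  fixes f :: "real^'n::finite \<Rightarrow> real"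
  assumes "open S" "smooth_on S f" "x \<in> S"
  shows "pds [i, j] f x = pds [j, i] f x"
proof -
  obtain e where e: "e > 0" "ball x e \<subseteq> S" using assms by (meson openE)
  \<comment> \<open>The points of a rectangle with sides up to \<open>h n\<close> lie within
    \<open>2 * h n\<close>, at most \<open>e / 2\<close>, of the corner \<open>x\<close>, so the
    rectangle stays in the ball.\<close>
  define h where "h n = e / (4 * real (Suc n))" for n
  have hpos: "h n > 0" for n using e by (simp add: h_def)
  have hle: "2 * h n < e" for n
  proof -
    have "0 < e * 2 + e * (real n * 4)" using e by (intro add_pos_nonneg) auto
    then show ?thesis by (simp add: h_def field_simps)
  qed
  have near: "dist x (x + s *\<^sub>R axis a 1 + t *\<^sub>R axis b 1) \<le> 2 * h n"
    if "0 \<le> s" "s \<le> h n" "0 \<le> t" "t \<le> h n" for s t n and a b :: 'n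
  proof -
    have "dist x (x + s *\<^sub>R axis a 1 + t *\<^sub>R axis b 1) = norm (s *\<^sub>R axis a 1 + t *\<^sub>R axis b (1::real))"
      by (metis add.assoc add_diff_cancel_left' dist_commute dist_norm)
    also have "\<dots> \<le> s + t" using norm_triangle_ineq[of "s *\<^sub>R axis a 1" "t *\<^sub>R axis b (1::real)"] that
      by (simp add: norm_axis_1)
    finally show ?thesis using that by simp
  qed
  have cube: "x + s *\<^sub>R axis a 1 + t *\<^sub>R axis b 1 \<in> S"
    if "0 \<le> s" "s \<le> h n" "0 \<le> t" "t \<le> h n" for s t n and a b :: 'n
  proof -
    have "dist x (x + s *\<^sub>R axis a 1 + t *\<^sub>R axis b 1) < e"
      using near[OF that, of a b] hle[of n] by linarith
    then show ?thesis using e(2) by auto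
  qed
  let ?d = "\<lambda>n. f (x + h n *\<^sub>R axis i 1 + h n *\<^sub>R axis j 1) - f (x + h n *\<^sub>R axis i 1) - f (x + h n *\<^sub>R axis j 1) + f x"
  have h0: "(\<lambda>n. 2 * h n) \<longlonglongrightarrow> 0"
  proof -
    have "(\<lambda>n. (e / 2) * (1 / real (Suc n))) \<longlonglongrightarrow> (e / 2) * 0"
      by (intro tendsto_mult tendsto_const lim_1_over_n[THEN LIMSEQ_Suc, of ])
    moreover have "(e / 2) * (1 / real (Suc n)) = 2 * h n" for n by (simp add: h_def del: of_nat_Suc)
    ultimately show ?thesis by simp
  qed
  have lim: "(\<lambda>n. ?d n / (h n * h n)) \<longlonglongrightarrow> pds [b, a] f x" if ab: "{a, b} = {i, j}" for a b
  proof -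
    have "\<exists>y. dist x y \<le> 2 * h n \<and> ?d n = h n * h n * pds [b, a] f y" for n
    proof -
      obtain s t where st: "0 < s" "s < h n" "0 < t" "t < h n"
        "f (x + h n *\<^sub>R axis a 1 + h n *\<^sub>R axis b 1) - f (x + h n *\<^sub>R axis a 1) - f (x + h n *\<^sub>R axis b 1) + f x
          = h n * h n * pds [b, a] f (x + s *\<^sub>R axis a 1 + t *\<^sub>R axis b 1)"
        using second_difference[OF assms(2) hpos[of n], of x a b] cube[where n=n and a=a and b=b] by blast
      have "?d n = f (x + h n *\<^sub>R axis a 1 + h n *\<^sub>R axis b 1) - f (x + h n *\<^sub>R axis a 1) - f (x + h n *\<^sub>R axis b 1) + f x"
        using ab by (auto simp: doubleton_eq_iff add_ac)
      then show ?thesis using st near[of s n t a b] by (metis less_imp_le)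
    qed
    then obtain y where y: "\<And>n. dist x (y n) \<le> 2 * h n" "\<And>n. ?d n = h n * h n * pds [b, a] f (y n)"
      by metis
    have "y \<longlonglongrightarrow> x"
      by (rule metric_tendsto_imp_tendsto[OF h0]) (use y(1) hpos in \<open>auto simp: dist_commute abs_of_pos\<close>)
    moreover have "isCont (pds [b, a] f) x"
      using smooth_on_continuous[OF assms(2)] assms(1,3) continuous_on_eq_continuous_at by blast
    ultimately have "(\<lambda>n. pds [b, a] f (y n)) \<longlonglongrightarrow> pds [b, a] f x"
      by (rule isCont_tendsto_compose[rotated])
    moreover have "?d n / (h n * h n) = pds [b, a] f (y n)" for n
      using hpos[of n] by (subst y(2)) simp
    ultimately show ?thesis by simp
  qed
  show ?thesis by (rule LIMSEQ_unique[OF lim lim]) auto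
qed

subsection \<open>Bump functions\<close>

text \<open>The flat function behind bump functions, with the power of \<open>1/t\<close> as a
  parameter: differentiation raises \<open>k\<close>, so the family over all \<open>k\<close> is
  closed up to linear combinations.\<close>

definition flat_exp :: "nat \<Rightarrow> real \<Rightarrow> real" where
  "flat_exp k t = (if t \<le> 0 then 0 else exp (- (1 / t)) / t ^ k)"

lemma flat_exp_tendsto_0: "(flat_exp k \<longlongrightarrow> 0) (at 0)"
proof -
  have "((\<lambda>u::real. u ^ k / exp u) \<longlongrightarrow> 0) at_top" by (rule tendsto_power_div_exp_0)
  then have "((\<lambda>t::real. (inverse t) ^ k / exp (inverse t)) \<longlongrightarrow> 0) (at_right 0)"
    by (rule filterlim_compose[OF _ filterlim_inverse_at_top_right])
  then have "(flat_exp k \<longlongrightarrow> 0) (at_right 0)"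
    by (rule Lim_transform_eventually)
      (auto simp: flat_exp_def eventually_at_filter exp_minus field_simps power_inverse)
  moreover have "(flat_exp k \<longlongrightarrow> 0) (at_left 0)"
    by (rule Lim_transform_eventually[OF tendsto_const])
      (auto simp: flat_exp_def eventually_at_filter)
  ultimately show ?thesis using filterlim_split_at by blast
qed

lemma flat_exp_has_derivative:
  "(flat_exp k has_real_derivative (flat_exp (k + 2) t - real k * flat_exp (k + 1) t)) (at t)"
proof (cases t "0::real" rule: linorder_cases)
  case less
  have "((\<lambda>_. 0) has_real_derivative 0) (at t)" by simp
  then have "(flat_exp k has_real_derivative 0) (at t)"
    by (rule has_field_derivative_transform_within_open[of _ _ _ "{..<0}"])
      (use less in \<open>auto simp: flat_exp_def\<close>)
  then show ?thesis using less by (simp add: flat_exp_def)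
next
  case equal
  \<comment> \<open>The difference quotient at the origin is \<open>flat_exp (k + 1)\<close>, and
    exponential decay beats every power.\<close>
  have "((\<lambda>h. flat_exp k h / h) \<longlongrightarrow> 0) (at 0)"
    by (rule Lim_transform_eventually[OF flat_exp_tendsto_0[of "k+1"]])
      (auto simp: flat_exp_def eventually_at_filter)
  then have "(flat_exp k has_real_derivative 0) (at 0)"
    unfolding DERIV_def by (simp add: flat_exp_def)
  then show ?thesis using equal by (simp add: flat_exp_def)
next
  case greater
  have "((\<lambda>t. exp (- (1 / t)) / t ^ k) has_real_derivative (flat_exp (k + 2) t - real k * flat_exp (k + 1) t)) (at t)"
  proof (cases k)
    case 0
    then show ?thesis using greater
      by (auto intro!: derivative_eq_intros simp: flat_exp_def field_simps power2_eq_square)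
  next
    case (Suc m)
    then show ?thesis using greater
      by (auto intro!: derivative_eq_intros simp: flat_exp_def divide_simps power2_eq_square)
         (auto simp: algebra_simps; metis Suc_pred not_gr0 power_Suc)
  qed
  then show ?thesis
    by (rule has_field_derivative_transform_within_open[of _ _ _ "{0<..}"])
      (use greater in \<open>auto simp: flat_exp_def\<close>)
qed

lemma flat_exp_continuous: "continuous_on A (flat_exp k)"
  using flat_exp_has_derivative DERIV_isCont continuous_at_imp_continuous_on by blast

lemma has_pd_affine: "has_pd j (\<lambda>x::real^'n::finite. a * x $ i + b) x (if j = i then a else 0)"
  unfolding has_pd_def has_real_derivative_iff_has_vector_derivative[symmetric]
  by (auto intro!: derivative_eq_intros simp: axis_def)

lemma smooth_on_flat_exp: "smooth_on UNIV (\<lambda>x::real^'n::finite. flat_exp 0 (a * x $ i + b))"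
proof -
  let ?f = "\<lambda>k (x::real^'n). flat_exp k (a * x $ i + b)"
  have in_alg: "?f k \<in> fun_alg (range ?f)" for k by (rule fun_alg.gen) (rule rangeI)
  show ?thesis
  proof (rule smooth_on_fun_alg[OF _ _ _ in_alg])
    fix h assume "h \<in> range ?f"
    then obtain k where h: "h = ?f k" by auto
    show "continuous_on UNIV h"
      unfolding h by (rule continuous_on_compose2[OF flat_exp_continuous[of UNIV]]) (auto intro!: continuous_intros)
    fix j
    let ?g = "\<lambda>x. (if j = i then a else 0) * ((- real k) * ?f (k + 1) x + ?f (k + 2) x)"
    have g: "?g \<in> fun_alg (range ?f)"
      by (rule fun_alg.mult[OF fun_alg.const fun_alg.add[OF fun_alg.mult[OF fun_alg.const in_alg] in_alg]])
    have "has_pd j h x (?g x)" for x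
      using has_pd_DERIV[OF has_pd_affine[of j a i b x] flat_exp_has_derivative[of k]] unfolding h
      by (simp add: mult.commute)
    then show "\<exists>h'\<in>fun_alg (range ?f). \<forall>x\<in>UNIV. has_pd j h x (h' x)"
      by (intro bexI[OF _ g]) simp
  qed simp
qed

section \<open>Weak derivatives\<close>

lemma pd_zero: "pd i (\<lambda>x. 0) = (\<lambda>x. 0)"
  by (rule ext) (rule has_pd_imp_pd[OF has_pd_const])

lemma pds_zero: "pds is (\<lambda>x. 0) = (\<lambda>x. 0)"
  by (induction "is") (simp_all add: pd_zero)

lemma pds_outside_support:
  assumes "x \<notin> closure {x. f x \<noteq> 0}"
  shows "pds is f x = 0"
proof -
  have "pds is f x = pds is (\<lambda>x. 0) x"
  proof (rule pds_cong_open[of "- closure {x. f x \<noteq> 0}"])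
    show "f y = 0" if "y \<in> - closure {x. f x \<noteq> 0}" for y
      using that closure_subset[of "{x. f x \<noteq> 0}"] by auto
  qed (use assms in auto)
  then show ?thesis by (simp add: pds_zero)
qed

lemma test_fun_smooth: "test_fun U \<phi> \<Longrightarrow> smooth_on UNIV \<phi>"
  unfolding test_fun_def by simp

lemma test_fun_zero: "test_fun U \<phi> \<Longrightarrow> x \<notin> U \<Longrightarrow> pds is \<phi> x = 0"
  unfolding test_fun_def using pds_outside_support by blast

lemma test_fun_pds:
  assumes "test_fun U \<phi>" shows "test_fun U (pds is \<phi>)"
proof -
  have "{x. pds is \<phi> x \<noteq> 0} \<subseteq> closure {x. \<phi> x \<noteq> 0}" using pds_outside_support[of _ \<phi> "is"] by auto
  then have *: "closure {x. pds is \<phi> x \<noteq> 0} \<subseteq> closure {x. \<phi> x \<noteq> 0}"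
    by (simp add: closure_minimal)
  then have "compact (closure {x. pds is \<phi> x \<noteq> 0})"
    using assms compact_closure unfolding test_fun_def by (meson bounded_subset closure_subset compact_imp_bounded subset_trans)
  then show ?thesis using assms smooth_on_pds * unfolding test_fun_def by blast
qed

lemma test_fun_continuous: "test_fun U \<phi> \<Longrightarrow> continuous_on A \<phi>"
  using smooth_on_continuous[OF test_fun_smooth, of U \<phi> "[]"] continuous_on_subset by fastforce

lemma test_fun_bounded:
  assumes "test_fun U \<phi>" obtains C where "\<And>x. \<bar>\<phi> x\<bar> \<le> C" "C \<ge> 0"
proof -
  let ?K = "closure {x. \<phi> x \<noteq> 0}"
  have "compact (\<phi> ` ?K)"
    using assms test_fun_continuous[OF assms] unfolding test_fun_def by (intro compact_continuous_image) auto
  then obtain C where C: "\<forall>x\<in>?K. \<bar>\<phi> x\<bar> \<le> C"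
    using compact_imp_bounded bounded_iff by (metis (no_types, lifting) imageI real_norm_def)
  have "\<bar>\<phi> x\<bar> \<le> max C 0" for x
  proof (cases "x \<in> ?K")
    case False
    then show ?thesis using pds_outside_support[of x \<phi> "[]"] by simp
  qed (use C in force)
  then show ?thesis using that[of "max C 0"] by auto
qed

text \<open>The factor \<open>a\<close> is smooth only inside \<open>U\<close>. On \<open>U\<close>
  the product is smooth, off the support of \<open>\<phi>\<close> it is zero, and these two open
  sets cover the space because the support lies in \<open>U\<close>.\<close>

lemma test_fun_mult:
  assumes "open U" "smooth_on U a" "test_fun U \<phi>"
  shows "test_fun U (\<lambda>x. a x * \<phi> x)"
proof -
  let ?K = "closure {x. \<phi> x \<noteq> 0}" and ?f = "\<lambda>x. a x * \<phi> x"
  have K: "?K \<subseteq> U" "compact ?K" using assms(3) unfolding test_fun_def by auto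
  have 1: "smooth_on U ?f"
    by (rule smooth_on_mult[OF assms(1,2)]) (rule smooth_on_subset[OF test_fun_smooth[OF assms(3)]], simp)
  have zero: "smooth_on (- ?K) (\<lambda>x. 0::real)"
    using smooth_bdd_const[OF open_Compl[OF closed_closure], of "{x. \<phi> x \<noteq> 0}" 0]
    unfolding smooth_bdd_def by simp
  have 2: "smooth_on (- ?K) ?f"
    by (rule smooth_on_cong_open[OF open_Compl[OF closed_closure] _ zero])
      (use closure_subset[of "{x. \<phi> x \<noteq> 0}"] in auto)
  have "smooth_on (U \<union> - ?K) ?f" by (rule smooth_on_Un[OF assms(1) open_Compl[OF closed_closure] 1 2])
  moreover have "U \<union> - ?K = UNIV" using K by auto
  ultimately have s: "smooth_on UNIV ?f" by simp
  have *: "closure {x. ?f x \<noteq> 0} \<subseteq> ?K"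
    by (rule closure_mono) auto
  then have "compact (closure {x. ?f x \<noteq> 0})"
    using K compact_closure by (meson bounded_subset closure_subset compact_imp_bounded subset_trans)
  then show ?thesis using s * K unfolding test_fun_def by blast
qed

section \<open>Translations and differentiation under the integral sign\<close>

lemma pds_translate: "pds is (\<lambda>x. f (x - v)) x = pds is f (x - v)"
proof (induction "is" arbitrary: x)
  case (Cons i "is")
  have "pds is (\<lambda>x. f (x - v)) = (\<lambda>x. pds is f (x - v))" using Cons.IH by auto
  then show ?case by (simp add: pd_def add_diff_eq algebra_simps)
qed simp

lemma smooth_on_translate:
  assumes "smooth_on UNIV f" shows "smooth_on UNIV (\<lambda>x. f (x - v))"
  unfolding smooth_on_def
proof (intro allI conjI ballI)
  fix "is" x i
  have eq: "pds is (\<lambda>x. f (x - v)) = (\<lambda>x. pds is f (x - v))" using pds_translate[of "is" f v] by auto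
  show "continuous_on UNIV (pds is (\<lambda>x. f (x - v)))" unfolding eq
    by (rule continuous_on_compose2[OF smooth_on_continuous[OF assms]]) (auto intro!: continuous_intros)
  have "(\<lambda>t. pds is f (x - v + t *\<^sub>R axis i 1)) differentiable at 0"
    using assms unfolding smooth_on_def by blast
  then show "(\<lambda>t. pds is (\<lambda>x. f (x - v)) (x + t *\<^sub>R axis i 1)) differentiable at 0"
    unfolding eq by (simp add: algebra_simps)
qed

lemma test_fun_translate:
  assumes "test_fun U \<phi>" "\<And>x. x \<in> U \<Longrightarrow> x + v \<in> U'"
  shows "test_fun U' (\<lambda>x. \<phi> (x - v))"
proof -
  let ?K = "closure {x. \<phi> x \<noteq> 0}"
  have "{x. \<phi> (x - v) \<noteq> 0} = (+) v ` {x. \<phi> x \<noteq> 0}"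
    by (force simp: image_iff intro: exI[of _ "_ - v"])
  then have eq: "closure {x. \<phi> (x - v) \<noteq> 0} = (+) v ` ?K"
    by (simp add: closure_translation)
  have "compact ((+) v ` ?K)"
    using assms(1) unfolding test_fun_def by (intro compact_translation) auto
  moreover have "(+) v ` ?K \<subseteq> U'"
    using assms unfolding test_fun_def by (auto simp: add.commute)
  ultimately show ?thesis
    using smooth_on_translate[OF test_fun_smooth[OF assms(1)]] unfolding test_fun_def eq by blast
qed

lemma smooth_on_imp_lipschitz:
  fixes \<phi> :: "real^'n::finite \<Rightarrow> real"
  assumes "smooth_on UNIV \<phi>" "\<And>x. \<bar>pd k \<phi> x\<bar> \<le> C"
  shows "\<bar>\<phi> (x + s *\<^sub>R axis k 1) - \<phi> x\<bar> \<le> C * \<bar>s\<bar>"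
proof -
  have "norm (\<phi> (x + s *\<^sub>R axis k 1) - \<phi> (x + 0 *\<^sub>R axis k 1)) \<le> C * norm (s - 0)"
  proof (rule field_differentiable_bound[of UNIV "\<lambda>t. \<phi> (x + t *\<^sub>R axis k 1)" "\<lambda>t. pd k \<phi> (x + t *\<^sub>R axis k 1)"])
    fix t
    show "((\<lambda>t. \<phi> (x + t *\<^sub>R axis k 1)) has_real_derivative pd k \<phi> (x + t *\<^sub>R axis k 1)) (at t within UNIV)"
      using has_pd_line[OF smooth_on_has_pd1[OF assms(1)]]
      by (simp add: has_real_derivative_iff_has_vector_derivative)
  qed (use assms(2) in auto)
  then show ?thesis by simp
qed

lemma borel_measurable_lebesgue_on_continuous:
  "continuous_on UNIV f \<Longrightarrow> f \<in> borel_measurable (lebesgue_on U)"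
  for f :: "real^'n::finite \<Rightarrow> real"
  by (metis borel_measurable_continuous_onI measurable_completion measurable_lborel2 measurable_restrict_space1)

text \<open>Moving the test function rather than \<open>f\<close> allows \<open>f\<close> to be
  merely integrable: the difference quotients of \<open>\<phi>\<close> are bounded by its Lipschitz
  constant \<open>C\<close>, so \<open>C\<close> times the modulus of \<open>f\<close>
  dominates.\<close>

lemma has_derivative_integral_translate:
  fixes \<phi> :: "real^'n::finite \<Rightarrow> real"
  assumes f: "integrable (lebesgue_on U) f" and \<phi>: "test_fun UNIV \<phi>"
  shows "((\<lambda>t. \<integral>x. f x * \<phi> (x - t *\<^sub>R axis k 1) \<partial>lebesgue_on U) has_real_derivative
     - (\<integral>x. f x * pd k \<phi> (x - t *\<^sub>R axis k 1) \<partial>lebesgue_on U)) (at t)"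
proof -
  let ?M = "lebesgue_on U"
  let ?F = "\<lambda>t. \<integral>x. f x * \<phi> (x - t *\<^sub>R axis k 1) \<partial>?M"
  have s: "smooth_on UNIV \<phi>" using test_fun_smooth[OF \<phi>] .
  have [measurable]: "f \<in> borel_measurable ?M" using f by auto
  have cont: "continuous_on UNIV (\<lambda>x. \<phi> (x - v))" "continuous_on UNIV (\<lambda>x. pd k \<phi> (x - v))" for v
    using smooth_on_continuous[OF smooth_on_translate[OF s], of "[]" v]
      smooth_on_continuous[OF smooth_on_translate[OF smooth_on_pds[OF s]], of "[]" "[k]" v] by simp_all
  have meas[measurable]: "(\<lambda>x. \<phi> (x - v)) \<in> borel_measurable ?M" "(\<lambda>x. pd k \<phi> (x - v)) \<in> borel_measurable ?M" for v
    by (rule borel_measurable_lebesgue_on_continuous, rule cont)+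
  obtain C0 where C0: "\<And>x. \<bar>\<phi> x\<bar> \<le> C0" "C0 \<ge> 0" using test_fun_bounded[OF \<phi>] by blast
  obtain C where C: "\<And>x. \<bar>pd k \<phi> x\<bar> \<le> C" "C \<ge> 0" using test_fun_bounded[OF test_fun_pds[OF \<phi>, of "[k]"]] by auto
  have int: "integrable ?M (\<lambda>x. f x * \<phi> (x - v))" for v
  proof (rule Bochner_Integration.integrable_bound[of _ "\<lambda>x. C0 * f x"])
    show "AE x in ?M. norm (f x * \<phi> (x - v)) \<le> norm (C0 * f x)"
    proof (rule AE_I2)
      fix x
      have "\<bar>f x\<bar> * \<bar>\<phi> (x - v)\<bar> \<le> \<bar>f x\<bar> * C0" by (rule mult_left_mono[OF C0(1)]) simp
      then show "norm (f x * \<phi> (x - v)) \<le> norm (C0 * f x)" using C0(2) by (simp add: abs_mult mult.commute)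
    qed
  qed (use f in auto)
  have "((\<lambda>h. (?F (t + h) - ?F t) / h) \<longlongrightarrow> - (\<integral>x. f x * pd k \<phi> (x - t *\<^sub>R axis k 1) \<partial>?M)) (at 0)"
    unfolding tendsto_at_iff_sequentially
  proof (intro allI impI)
    fix X :: "nat \<Rightarrow> real" assume X: "\<forall>i. X i \<in> UNIV - {0}" "X \<longlonglongrightarrow> 0"
    have shift: "x - (t + X n) *\<^sub>R axis k 1 = x - t *\<^sub>R axis k 1 - X n *\<^sub>R axis k 1" for x n
      by (simp add: scaleR_add_left)
    let ?q = "\<lambda>n x. f x * ((\<phi> (x - (t + X n) *\<^sub>R axis k 1) - \<phi> (x - t *\<^sub>R axis k 1)) / X n)"
    have "(\<lambda>n. integral\<^sup>L ?M (?q n)) \<longlonglongrightarrow> integral\<^sup>L ?M (\<lambda>x. f x * (- pd k \<phi> (x - t *\<^sub>R axis k 1)))"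
    proof (rule integral_dominated_convergence[of _ _ _ "\<lambda>x. \<bar>f x\<bar> * C"])
      show "integrable ?M (\<lambda>x. \<bar>f x\<bar> * C)" using f by auto
      show "AE x in ?M. (\<lambda>n. ?q n x) \<longlonglongrightarrow> f x * (- pd k \<phi> (x - t *\<^sub>R axis k 1))"
      proof (intro AE_I2 tendsto_mult tendsto_const)
        fix x :: "real^'n"
        let ?y = "x - t *\<^sub>R axis k 1"
        have "((\<lambda>s. \<phi> (?y + s *\<^sub>R axis k 1)) has_real_derivative pd k \<phi> ?y) (at 0)"
          using smooth_on_has_pd1[OF s, of ?y k] unfolding has_pd_def
          by (simp add: has_real_derivative_iff_has_vector_derivative)
        then have lim: "((\<lambda>h. (\<phi> (?y + h *\<^sub>R axis k 1) - \<phi> ?y) / h) \<longlongrightarrow> pd k \<phi> ?y) (at 0)"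
          unfolding DERIV_def by simp
        \<comment> \<open>Translating by a further \<open>X n\<close> moves the argument by
          \<open>- X n\<close>, so the quotient is taken along the negated sequence; this is the
          origin of the minus sign.\<close>
        have X': "\<forall>i. - X i \<in> UNIV - {0}" "(\<lambda>n. - X n) \<longlonglongrightarrow> 0"
          using X tendsto_minus[OF X(2)] by auto
        from tendsto_minus[OF tendsto_at_iff_sequentially[THEN iffD1, rule_format, OF lim X'[rule_format]]]
        show "(\<lambda>n. (\<phi> (x - (t + X n) *\<^sub>R axis k 1) - \<phi> ?y) / X n) \<longlonglongrightarrow> - pd k \<phi> ?y"
          by (simp add: comp_def shift)
      qed
      fix n
      show "AE x in ?M. norm (?q n x) \<le> \<bar>f x\<bar> * C"
      proof (rule AE_I2)
        fix x
        have "\<bar>\<phi> (x - t *\<^sub>R axis k 1 + (- X n) *\<^sub>R axis k 1) - \<phi> (x - t *\<^sub>R axis k 1)\<bar> \<le> C * \<bar>- X n\<bar>"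
          by (rule smooth_on_imp_lipschitz[OF s C(1)])
        then have "\<bar>(\<phi> (x - (t + X n) *\<^sub>R axis k 1) - \<phi> (x - t *\<^sub>R axis k 1)) / X n\<bar> \<le> C"
          using X(1)[rule_format, of n] by (simp add: shift divide_le_eq)
        then show "norm (?q n x) \<le> \<bar>f x\<bar> * C"
          unfolding real_norm_def abs_mult by (rule mult_left_mono) simp
      qed
      show "?q n \<in> borel_measurable ?M" by measurable
    qed measurable
    moreover have eq: "integral\<^sup>L ?M (?q n) = (?F (t + X n) - ?F t) / X n" for n
    proof -
      have "integral\<^sup>L ?M (?q n) = (\<integral>x. (f x * \<phi> (x - (t + X n) *\<^sub>R axis k 1) - f x * \<phi> (x - t *\<^sub>R axis k 1)) / X n \<partial>?M)"
        by (rule Bochner_Integration.integral_cong) (simp_all add: right_diff_distrib)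
      also have "\<dots> = (?F (t + X n) - ?F t) / X n"
        using Bochner_Integration.integral_diff[OF int int, of "(t + X n) *\<^sub>R axis k 1" "t *\<^sub>R axis k 1"] by simp
      finally show ?thesis .
    qed
    moreover have "integral\<^sup>L ?M (\<lambda>x. f x * (- pd k \<phi> (x - t *\<^sub>R axis k 1))) = - (\<integral>x. f x * pd k \<phi> (x - t *\<^sub>R axis k 1) \<partial>?M)"
      by simp
    ultimately show "((\<lambda>h. (?F (t + h) - ?F t) / h) \<circ> X) \<longlonglongrightarrow> - (\<integral>x. f x * pd k \<phi> (x - t *\<^sub>R axis k 1) \<partial>?M)"
      unfolding comp_def by (simp only:)
  qed
  then show ?thesis unfolding DERIV_def .
qed

lemma lborel_integral_translate:
  fixes f :: "'a::euclidean_space \<Rightarrow> real"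
  assumes "f \<in> borel_measurable borel"
  shows "(\<integral>x. f (x + v) \<partial>lborel) = (\<integral>x. f x \<partial>lborel)"
proof -
  have "(\<integral>x. f x \<partial>lborel) = (\<integral>x. f x \<partial>distr lborel borel ((+) v))" by (simp add: lborel_distr_plus)
  also have "\<dots> = (\<integral>x. f (v + x) \<partial>lborel)" using assms by (intro integral_distr) auto
  finally show ?thesis by (simp add: add.commute)
qed

text \<open>Over a large ball the integral of the translated \<open>\<phi>\<close> does not depend
  on small shifts, while its derivative in the shift is minus the integral of
  \<open>pd k \<phi>\<close>.\<close>

lemma integral_pd_test_fun:
  fixes \<phi> :: "real^'n::finite \<Rightarrow> real"
  assumes \<phi>: "test_fun U \<phi>" and U: "U \<in> sets lebesgue"
  shows "(\<integral>x. pd k \<phi> x \<partial>lebesgue_on U) = 0"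
proof -
  let ?K = "closure {x. \<phi> x \<noteq> 0}"
  have \<phi>': "test_fun UNIV \<phi>" using \<phi> unfolding test_fun_def by auto
  have "bounded ?K" using \<phi> compact_imp_bounded unfolding test_fun_def by blast
  then obtain r where r: "\<And>x. x \<in> ?K \<Longrightarrow> norm x < r" unfolding bounded_pos_less by blast
  \<comment> \<open>A ball instead of the whole space makes the constant 1 integrable; the margin 1
    in the radius keeps the support inside for shifts smaller than 1.\<close>
  let ?B = "ball (0::real^'n) (r + 1)"
  have B: "?B \<in> lmeasurable" by (rule lmeasurable_ball)
  then have BL: "?B \<in> sets lebesgue" by auto
  have one: "integrable (lebesgue_on ?B) (\<lambda>x. 1::real)"
    using finite_measure_lebesgue_on[OF B] by (simp add: finite_measure.integrable_const)
  let ?F = "\<lambda>t. \<integral>x. 1 * \<phi> (x - t *\<^sub>R axis k 1) \<partial>lebesgue_on ?B"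
  have deriv: "(?F has_real_derivative - (\<integral>x. 1 * pd k \<phi> (x - 0 *\<^sub>R axis k 1) \<partial>lebesgue_on ?B)) (at 0)"
    by (rule has_derivative_integral_translate[OF one \<phi>'])
  have bor: "\<phi> \<in> borel_measurable borel"
    using test_fun_continuous[OF \<phi>'] by (rule borel_measurable_continuous_onI)
  have const: "?F t = (\<integral>x. \<phi> x \<partial>lborel)" if t: "\<bar>t\<bar> < 1" for t
  proof -
    have "?F t = (\<integral>x. indicator ?B x *\<^sub>R \<phi> (x - t *\<^sub>R axis k 1) \<partial>lebesgue)"
      using integral_restrict_space[of ?B lebesgue "\<lambda>x. \<phi> (x - t *\<^sub>R axis k 1)"] BL by simp
    also have "(\<lambda>x. indicator ?B x *\<^sub>R \<phi> (x - t *\<^sub>R axis k 1)) = (\<lambda>x. \<phi> (x + (- t) *\<^sub>R axis k 1))"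
    proof
      fix x
      show "indicator ?B x *\<^sub>R \<phi> (x - t *\<^sub>R axis k 1) = \<phi> (x + (- t) *\<^sub>R axis k 1)"
      proof (cases "\<phi> (x - t *\<^sub>R axis k 1) = 0")
        case False
        then have "norm (x - t *\<^sub>R axis k 1) < r" using closure_subset[of "{x. \<phi> x \<noteq> 0}"] by (intro r) auto
        then have "norm x < r + 1"
          using norm_triangle_ineq[of "x - t *\<^sub>R axis k 1" "t *\<^sub>R axis k 1"] t by (simp add: norm_axis_1)
        then show ?thesis by simp
      qed simp
    qed
    also have "(\<integral>x. \<phi> (x + (- t) *\<^sub>R axis k 1) \<partial>lebesgue) = (\<integral>x. \<phi> (x + (- t) *\<^sub>R axis k 1) \<partial>lborel)"
    proof (rule integral_completion)
      have "(\<lambda>x. x + (- t) *\<^sub>R axis k 1) \<in> borel_measurable (borel :: (real^'n) measure)" by measurable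
      from measurable_compose[OF this bor]
      show "(\<lambda>x. \<phi> (x + (- t) *\<^sub>R axis k 1)) \<in> borel_measurable lborel" by simp
    qed
    also have "\<dots> = (\<integral>x. \<phi> x \<partial>lborel)" by (rule lborel_integral_translate[OF bor])
    finally show ?thesis .
  qed
  have "((\<lambda>t. \<integral>x. \<phi> x \<partial>lborel) has_real_derivative - (\<integral>x. 1 * pd k \<phi> (x - 0 *\<^sub>R axis k 1) \<partial>lebesgue_on ?B)) (at 0)"
    by (rule has_field_derivative_transform_within_open[OF deriv, of "{-1<..<1}"]) (use const in auto)
  then have "(\<integral>x. pd k \<phi> x \<partial>lebesgue_on ?B) = 0"
    using DERIV_unique[OF _ DERIV_const] by fastforce
  moreover have "(\<integral>x. pd k \<phi> x \<partial>lebesgue_on ?B) = (\<integral>x. pd k \<phi> x \<partial>lebesgue_on U)"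
  proof -
    have "(\<lambda>x. indicator ?B x *\<^sub>R pd k \<phi> x) = (\<lambda>x. indicator U x *\<^sub>R pd k \<phi> x)"
    proof
      fix x
      show "indicator ?B x *\<^sub>R pd k \<phi> x = indicator U x *\<^sub>R pd k \<phi> x"
      proof (cases "x \<in> ?K")
        case True
        then show ?thesis using r[OF True] \<phi> unfolding test_fun_def by auto
      next
        case False
        then show ?thesis using pds_outside_support[of x \<phi> "[k]"] by simp
      qed
    qed
    then show ?thesis
      using integral_restrict_space[of ?B lebesgue "pd k \<phi>"] integral_restrict_space[of U lebesgue "pd k \<phi>"]
        BL U by (simp only: Int_UNIV_right space_completion space_lborel space_borel)
  qed
  ultimately show ?thesis by simp
qed

section \<open>Fundamental lemma of the calculus of variations\<close>

lemma AE_lebesgue_on_iff: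
  "open U \<Longrightarrow> (AE x in lebesgue_on U. P x) \<longleftrightarrow> (AE x in lborel. x \<in> U \<longrightarrow> P x)"
  for U :: "'a::euclidean_space set"
  by (subst AE_restrict_space_iff) (auto simp: AE_completion_iff)

text \<open>By the Lindelof property countably many of the local neighbourhoods cover
  \<open>U\<close>, so their exceptional sets together still form a null set.\<close>

lemma AE_open_locally:
  fixes U :: "'a::euclidean_space set"
  assumes "\<And>x. x \<in> U \<Longrightarrow> \<exists>T. open T \<and> x \<in> T \<and> (AE y in lborel. y \<in> T \<longrightarrow> P y)"
  shows "AE y in lborel. y \<in> U \<longrightarrow> P y"
proof -
  let ?F = "{T. open T \<and> (AE y in lborel. y \<in> T \<longrightarrow> P y)}"
  obtain F' where F': "F' \<subseteq> ?F" "countable F'" "\<Union>F' = \<Union>?F"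
  proof (rule Lindelof[of ?F])
    show "open S" if "S \<in> ?F" for S using that by blast
  qed
  have "AE y in lborel. \<forall>T\<in>F'. y \<in> T \<longrightarrow> P y"
    unfolding AE_ball_countable[OF F'(2)]
  proof
    fix T assume "T \<in> F'"
    then have "T \<in> ?F" using F'(1) by (rule subsetD[rotated])
    then show "AE y in lborel. y \<in> T \<longrightarrow> P y" by (rule CollectE) (erule conjunct2)
  qed
  moreover have U: "\<exists>T\<in>F'. x \<in> T" if "x \<in> U" for x
  proof -
    obtain T where T: "open T" "x \<in> T" "AE y in lborel. y \<in> T \<longrightarrow> P y" 
      using assms[OF \<open>x \<in> U\<close>] by (elim exE conjE)
    then have "x \<in> \<Union>?F" by (intro UnionI[of T] CollectI conjI)
    then show ?thesis unfolding F'(3)[symmetric] by (elim UnionE) (rule bexI)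
  qed
  ultimately show ?thesis
  proof eventually_elim
    case (elim y)
    then show ?case using U[of y] by metis
  qed
qed

text \<open>The positive and the negative part of \<open>g\<close> are densities of two measures
  that agree on boxes. Boxes are stable under intersection and generate the Borel sets, so the
  measures and hence the densities coincide.\<close>

lemma AE_zero_if_box_integrals_zero:
  fixes g :: "real^'n::finite \<Rightarrow> real"
  assumes g: "integrable lborel g" and zero: "\<And>a b. (\<integral>x. indicator (box a b) x * g x \<partial>lborel) = 0"
  shows "AE x in lborel. g x = 0"
proof -
  have [measurable]: "g \<in> borel_measurable borel" using g by auto
  let ?p = "\<lambda>x. ennreal (g x)" and ?m = "\<lambda>x. ennreal (- g x)"
  have fin: "integral\<^sup>N lborel ?p \<noteq> \<infinity>" "integral\<^sup>N lborel ?m \<noteq> \<infinity>"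
    using g unfolding real_integrable_def by auto
  have "density lborel ?p = density lborel ?m"
  proof (rule measure_eqI_generator_eq[where E="range (\<lambda>(a, b). box a b)" and \<Omega>=UNIV and A="\<lambda>n::nat. box (- real n *\<^sub>R One) (real n *\<^sub>R One)"])
    show "Int_stable (range (\<lambda>(a, b). box a (b::real^'n)))"
      by (auto simp: Int_stable_def box_Int_box)
    show "sets (density lborel ?p) = sigma_sets UNIV (range (\<lambda>(a, b). box a b))"
      "sets (density lborel ?m) = sigma_sets UNIV (range (\<lambda>(a, b). box a b))"
      by (simp_all add: borel_eq_box)
    show "\<Union> (range (\<lambda>n::nat. box (- real n *\<^sub>R One) (real n *\<^sub>R One))) = (UNIV::(real^'n) set)"
      by (simp add: UN_box_eq_UNIV)
    show "emeasure (density lborel ?p) (box (- real n *\<^sub>R One) (real n *\<^sub>R One)) \<noteq> \<infinity>" for n :: nat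
    proof -
      have "emeasure (density lborel ?p) (box (- real n *\<^sub>R One) (real n *\<^sub>R One)) \<le> emeasure (density lborel ?p) (space (density lborel ?p))"
        by (rule emeasure_mono) auto
      also have "\<dots> = integral\<^sup>N lborel ?p" by (subst emeasure_density) auto
      finally show ?thesis using fin(1) by (auto simp: top_unique)
    qed
    fix X assume "X \<in> range (\<lambda>(a, b). box a (b::real^'n))"
    then obtain a b where X: "X = box a b" by auto
    let ?h = "\<lambda>x. indicator (box a b) x * g x"
    have h: "integrable lborel ?h" using integrable_mult_indicator[OF _ g, of "box a b"] by simp
    have hpm: "ennreal (?h x) = ?p x * indicator (box a b) x" "ennreal (- ?h x) = ?m x * indicator (box a b) x" for x
      by (auto split: split_indicator)
    have fh: "(\<integral>\<^sup>+ x. ennreal (?h x) \<partial>lborel) < top" "(\<integral>\<^sup>+ x. ennreal (- ?h x) \<partial>lborel) < top"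
      using h unfolding real_integrable_def by (auto simp: less_top)
    have "(\<integral>\<^sup>+ x. ennreal (?h x) \<partial>lborel) = (\<integral>\<^sup>+ x. ennreal (- ?h x) \<partial>lborel)"
    proof -
      have "enn2real (\<integral>\<^sup>+ x. ennreal (?h x) \<partial>lborel) = enn2real (\<integral>\<^sup>+ x. ennreal (- ?h x) \<partial>lborel)"
        using real_lebesgue_integral_def[OF h] zero[of a b] by simp
      then show ?thesis using ennreal_enn2real[OF fh(1)] ennreal_enn2real[OF fh(2)] by metis
    qed
    then have "(\<integral>\<^sup>+ x. ?p x * indicator (box a b) x \<partial>lborel) = (\<integral>\<^sup>+ x. ?m x * indicator (box a b) x \<partial>lborel)"
      unfolding hpm .
    then show "emeasure (density lborel ?p) X = emeasure (density lborel ?m) X"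
      unfolding X by (simp add: emeasure_density)
  qed auto
  then have "AE x in lborel. ?p x = ?m x"
    using finite_density_unique[of ?p lborel ?m] fin by auto
  then show ?thesis
  proof eventually_elim
    case (elim x)
    then show ?case by (cases "g x" "0::real" rule: linorder_cases) (auto simp: ennreal_neg ennreal_eq_0_iff dest: sym)
  qed
qed

lemma smooth_on_prod:
  assumes "open S" "\<And>a. a \<in> A \<Longrightarrow> smooth_on S (f a)"
  shows "smooth_on S (\<lambda>x. \<Prod>a\<in>A. f a x :: real)"
  using assms(2)
proof (induction A rule: infinite_finite_induct)
  case (insert a A)
  then show ?case by (simp add: smooth_on_mult[OF assms(1)])
qed (use smooth_bdd_const[OF assms(1)] in \<open>auto simp: smooth_bdd_def\<close>)

text \<open>Smooth functions with values between 0 and 1, zero outside the open box, whose limit as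
  \<open>n\<close> grows is the indicator of the box.\<close>

definition box_bump :: "real^'n::finite \<Rightarrow> real^'n \<Rightarrow> nat \<Rightarrow> real^'n \<Rightarrow> real" where
  "box_bump a b n x = (\<Prod>i\<in>UNIV. flat_exp 0 (real n * x $ i + (- real n * a $ i)) * flat_exp 0 (- real n * x $ i + real n * b $ i))"

lemma flat_exp_bounds: "0 \<le> flat_exp 0 t" "flat_exp 0 t \<le> 1"
  by (auto simp: flat_exp_def)

lemma box_bump_bounds: "0 \<le> box_bump a b n x" "box_bump a b n x \<le> 1"
  unfolding box_bump_def using flat_exp_bounds
  by (auto intro!: prod_nonneg prod_le_1 mult_le_one)

lemma box_bump_nonzero:
  assumes "box_bump a b n x \<noteq> 0" shows "x \<in> box a b"
proof -
  have "a $ i < x $ i \<and> x $ i < b $ i" for i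
  proof -
    have "flat_exp 0 (real n * x $ i + (- real n * a $ i)) \<noteq> 0" "flat_exp 0 (- real n * x $ i + real n * b $ i) \<noteq> 0"
      using assms unfolding box_bump_def by auto
    then have "0 < real n * (x $ i - a $ i)" "0 < real n * (b $ i - x $ i)"
      unfolding flat_exp_def by (auto simp: algebra_simps split: if_splits)
    then show ?thesis by (auto simp: zero_less_mult_iff)
  qed
  then show ?thesis by (simp add: mem_box_cart)
qed

lemma test_fun_box_bump:
  assumes "cbox a b \<subseteq> U" shows "test_fun U (box_bump a b n)"
proof -
  have "smooth_on UNIV (box_bump a b n)"
    unfolding box_bump_def by (intro smooth_on_prod smooth_on_mult smooth_on_flat_exp) auto
  moreover have "closure {x. box_bump a b n x \<noteq> 0} \<subseteq> cbox a b"
    using box_bump_nonzero box_subset_cbox by (intro closure_minimal) blast+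
  moreover have "compact (closure {x. box_bump a b n x \<noteq> 0})"
    using calculation(2) by (metis bounded_cbox bounded_subset closed_closure compact_eq_bounded_closed)
  ultimately show ?thesis using assms unfolding test_fun_def by blast
qed

lemma flat_exp_scale_tendsto:
  assumes "t > 0" shows "(\<lambda>n. flat_exp 0 (real n * t)) \<longlonglongrightarrow> 1"
proof -
  have "(\<lambda>n. exp (- (inverse (real n) * inverse t))) \<longlonglongrightarrow> exp (- (0 * inverse t))"
    by (intro tendsto_intros lim_inverse_n)
  then have "(\<lambda>n. exp (- (inverse (real n) * inverse t))) \<longlonglongrightarrow> 1" by simp
  moreover have "\<forall>\<^sub>F n in sequentially. exp (- (inverse (real n) * inverse t)) = flat_exp 0 (real n * t)"
    using eventually_gt_at_top[of 0]
    by eventually_elim (use assms in \<open>auto simp: flat_exp_def mult_le_0_iff divide_inverse\<close>)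
  ultimately show ?thesis by (rule Lim_transform_eventually)
qed

lemma box_bump_tendsto: "(\<lambda>n. box_bump a b n x) \<longlonglongrightarrow> indicator (box a b) x"
proof (cases "x \<in> box a b")
  case True
  then have x: "a $ i < x $ i" "x $ i < b $ i" for i by (auto simp: mem_box_cart)
  have "(\<lambda>n. \<Prod>i\<in>UNIV. flat_exp 0 (real n * (x $ i - a $ i)) * flat_exp 0 (real n * (b $ i - x $ i))) \<longlonglongrightarrow> (\<Prod>i\<in>(UNIV::'a set). 1 * 1)"
    by (intro tendsto_prod tendsto_mult flat_exp_scale_tendsto) (use x in auto)
  moreover have "box_bump a b n x = (\<Prod>i\<in>UNIV. flat_exp 0 (real n * (x $ i - a $ i)) * flat_exp 0 (real n * (b $ i - x $ i)))" for n
    unfolding box_bump_def by (intro prod.cong refl arg_cong2[where f="(*)"] arg_cong[where f="flat_exp 0"])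
      (simp_all add: right_diff_distrib)
  ultimately show ?thesis using True by simp
next
  case False
  then have "box_bump a b n x = 0" for n using box_bump_nonzero by blast
  then show ?thesis using False by simp
qed

text \<open>The bumps \<open>box_bump\<close> tend boundedly to indicators of boxes, so the
  integrals over all boxes with \<open>cbox a b\<close> inside \<open>U\<close> vanish. Near each
  point of \<open>U\<close> this forces the function to vanish, and the local statements are
  glued.\<close>

lemma test_fun_integral_zero_imp_AE_zero:
  fixes f :: "real^'n::finite \<Rightarrow> real"
  assumes U: "open U" and f: "integrable (lebesgue_on U) f"
    and zero: "\<And>\<phi>. test_fun U \<phi> \<Longrightarrow> (\<integral>x. f x * \<phi> x \<partial>lebesgue_on U) = 0"
  shows "AE x in lebesgue_on U. f x = 0"
proof -
  have UL: "U \<in> sets lebesgue" using U by auto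
  have int: "integrable lebesgue (\<lambda>x. indicator U x * f x)"
    using f integrable_restrict_space[of U lebesgue f] UL by simp
  \<comment> \<open>A Borel representative on the whole space: the box criterion lives on
    \<open>lborel\<close>, whereas \<open>f\<close> is only Lebesgue measurable on
    \<open>U\<close>.\<close>
  then obtain F where F: "F \<in> borel_measurable lborel" "AE x in lborel. indicator U x * f x = F x"
    using completion_ex_borel_measurable_real[of "\<lambda>x. indicator U x * f x" lborel] by auto
  have F' : "AE x in lebesgue. indicator U x * f x = F x" using AE_completion[OF F(2)] .
  have FL: "F \<in> borel_measurable lebesgue" using F(1) by (rule measurable_completion)
  have intF: "integrable lborel F"
    using Bochner_Integration.integrable_cong_AE[THEN iffD1, OF borel_measurable_integrable[OF int] FL F' int]
      integrable_completion[OF F(1)] by blast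
  have box0: "(\<integral>x. indicator (box a b) x * F x \<partial>lborel) = 0" if ab: "cbox a b \<subseteq> U" for a b
  proof -
    have "(\<lambda>n. \<integral>x. box_bump a b n x * F x \<partial>lborel) \<longlonglongrightarrow> (\<integral>x. indicator (box a b) x * F x \<partial>lborel)"
    proof (rule integral_dominated_convergence[of _ _ _ "\<lambda>x. \<bar>F x\<bar>"])
      show "integrable lborel (\<lambda>x. \<bar>F x\<bar>)" using intF by auto
      show "(\<lambda>x. indicator (box a b) x * F x) \<in> borel_measurable lborel" using F(1) by measurable
      fix n
      have "box_bump a b n \<in> borel_measurable borel"
        using test_fun_continuous[OF test_fun_box_bump[OF ab]] by (rule borel_measurable_continuous_onI)
      then show "(\<lambda>x. box_bump a b n x * F x) \<in> borel_measurable lborel" using F(1) by simp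
      show "AE x in lborel. norm (box_bump a b n x * F x) \<le> \<bar>F x\<bar>"
        using box_bump_bounds[of a b n] by (intro AE_I2) (auto simp: abs_mult mult_left_le_one_le)
    qed (intro AE_I2 tendsto_mult box_bump_tendsto tendsto_const)
    moreover have "(\<integral>x. box_bump a b n x * F x \<partial>lborel) = 0" for n
    proof -
      have t: "test_fun U (box_bump a b n)" by (rule test_fun_box_bump[OF ab])
      have bm: "box_bump a b n \<in> borel_measurable borel"
        using test_fun_continuous[OF t] by (rule borel_measurable_continuous_onI)
      have "(\<integral>x. box_bump a b n x * F x \<partial>lborel) = (\<integral>x. box_bump a b n x * F x \<partial>lebesgue)"
        using bm F(1) by (intro integral_completion[symmetric]) simp
      also have "\<dots> = (\<integral>x. indicator U x *\<^sub>R (f x * box_bump a b n x) \<partial>lebesgue)"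
      proof (rule integral_cong_AE)
        have bmL: "box_bump a b n \<in> borel_measurable lebesgue" using bm measurable_completion measurable_lborel2 by blast
        show "(\<lambda>x. box_bump a b n x * F x) \<in> borel_measurable lebesgue" using bmL FL by simp
        have "(\<lambda>x. (indicator U x * f x) * box_bump a b n x) \<in> borel_measurable lebesgue"
          by (rule borel_measurable_times[OF borel_measurable_integrable[OF int] bmL])
        then show "(\<lambda>x. indicator U x *\<^sub>R (f x * box_bump a b n x)) \<in> borel_measurable lebesgue"
          by (simp add: mult.assoc)
        show "AE x in lebesgue. box_bump a b n x * F x = indicator U x *\<^sub>R (f x * box_bump a b n x)"
          using F'
        proof eventually_elim
          case (elim x)
          show ?case unfolding elim[symmetric] by (simp add: mult_ac)
        qed
      qed
      also have "\<dots> = (\<integral>x. f x * box_bump a b n x \<partial>lebesgue_on U)"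
        using integral_restrict_space[of U lebesgue "\<lambda>x. f x * box_bump a b n x"] UL by simp
      finally show ?thesis using zero[OF t] by simp
    qed
    ultimately show ?thesis using LIMSEQ_unique[OF _ tendsto_const] by auto
  qed
  have "AE x in lborel. x \<in> U \<longrightarrow> F x = 0"
  proof (rule AE_open_locally)
    fix x assume "x \<in> U"
    then obtain p q where pq: "cbox p q \<subseteq> U" "x \<in> box p q" using open_contains_cbox[OF U] by metis
    let ?g = "\<lambda>x. indicator (box p q) x * F x"
    have "AE x in lborel. ?g x = 0"
    proof (rule AE_zero_if_box_integrals_zero)
      show "integrable lborel ?g" using integrable_mult_indicator[OF _ intF, of "box p q"] by simp
      fix a b
      \<comment> \<open>Intersecting an arbitrary box with \<open>box p q\<close> gives the box with
        these corners, whose closed version remains inside \<open>U\<close>.\<close>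
      let ?l = "\<Sum>i\<in>Basis. max (a \<bullet> i) (p \<bullet> i) *\<^sub>R i" and ?u = "\<Sum>i\<in>Basis. min (b \<bullet> i) (q \<bullet> i) *\<^sub>R i"
      have "cbox ?l ?u \<subseteq> cbox p q" by (auto simp: mem_box)
      then have "(\<integral>x. indicator (box ?l ?u) x * F x \<partial>lborel) = 0" using pq by (intro box0) auto
      moreover have "indicator (box ?l ?u) x * F x = indicator (box a b) x * ?g x" for x
        unfolding box_Int_box[symmetric] by (auto split: split_indicator)
      ultimately show "(\<integral>x. indicator (box a b) x * ?g x \<partial>lborel) = 0" by simp
    qed
    then have "AE y in lborel. y \<in> box p q \<longrightarrow> F y = 0" by eventually_elim auto
    then show "\<exists>T. open T \<and> x \<in> T \<and> (AE y in lborel. y \<in> T \<longrightarrow> F y = 0)" using pq open_box by blast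
  qed
  then have "AE x in lborel. x \<in> U \<longrightarrow> f x = 0" using F(2) by eventually_elim auto
  then show ?thesis using AE_lebesgue_on_iff[OF U] by blast
qed

section \<open>Weak derivatives of square-integrable functions on a bounded domain\<close>

locale bdd_domain =
  fixes U :: "(real^'n::finite) set"
  assumes U_open: "open U" and U_bdd: "bounded U"
begin

lemma U_sets: "U \<in> sets lebesgue" using U_open by auto

lemma finite_U: "finite_measure (lebesgue_on U)"
  by (rule finite_measure_lebesgue_on[OF lmeasurable_open[OF U_bdd U_open]])

lemma L2_measurable: "L2 U f \<Longrightarrow> f \<in> borel_measurable (lebesgue_on U)"
  unfolding L2_def by simp

lemma L2_const: "L2 U (\<lambda>x. a)"
  unfolding L2_def using finite_measure.integrable_const[OF finite_U] by simp

lemma L2_integrable: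
  assumes "L2 U f" shows "integrable (lebesgue_on U) f"
proof (rule Bochner_Integration.integrable_bound[of _ "\<lambda>x. 1 + (f x)\<^sup>2"])
  show "integrable (lebesgue_on U) (\<lambda>x. 1 + (f x)\<^sup>2)"
    using assms finite_measure.integrable_const[OF finite_U] unfolding L2_def
    by (intro Bochner_Integration.integrable_add) auto
  have "\<bar>t\<bar> \<le> 1 + t\<^sup>2" for t :: real
  proof -
    have "0 \<le> (\<bar>t\<bar> - 1)\<^sup>2" by simp
    then have "2 * \<bar>t\<bar> \<le> 1 + t\<^sup>2" by (simp add: power2_diff)
    then show ?thesis by linarith
  qed
  then show "AE x in lebesgue_on U. norm (f x) \<le> norm (1 + (f x)\<^sup>2)"
    by (intro AE_I2) (simp add: abs_of_nonneg)
qed (use assms in \<open>simp add: L2_def\<close>)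

lemma L2_add:
  assumes "L2 U f" "L2 U g" shows "L2 U (\<lambda>x. f x + g x)"
  unfolding L2_def
proof
  have [measurable]: "f \<in> borel_measurable (lebesgue_on U)" "g \<in> borel_measurable (lebesgue_on U)"
    using assms L2_measurable by auto
  show "(\<lambda>x. f x + g x) \<in> borel_measurable (lebesgue_on U)" by measurable
  show "integrable (lebesgue_on U) (\<lambda>x. (f x + g x)\<^sup>2)"
  proof (rule Bochner_Integration.integrable_bound[of _ "\<lambda>x. 2 * (f x)\<^sup>2 + 2 * (g x)\<^sup>2"])
    show "integrable (lebesgue_on U) (\<lambda>x. 2 * (f x)\<^sup>2 + 2 * (g x)\<^sup>2)"
      using assms unfolding L2_def by auto
    have "(a + b)\<^sup>2 \<le> 2 * a\<^sup>2 + 2 * b\<^sup>2" for a b :: real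
      using sum_squares_bound[of a b] by (simp add: power2_sum)
    then show "AE x in lebesgue_on U. norm ((f x + g x)\<^sup>2) \<le> norm (2 * (f x)\<^sup>2 + 2 * (g x)\<^sup>2)"
      by (intro AE_I2) (simp add: abs_of_nonneg)
  qed measurable
qed

lemma L2_mult_bounded:
  assumes "L2 U f" "a \<in> borel_measurable (lebesgue_on U)" "\<And>x. x \<in> U \<Longrightarrow> \<bar>a x\<bar> \<le> C"
  shows "L2 U (\<lambda>x. a x * f x)"
  unfolding L2_def
proof
  have [measurable]: "f \<in> borel_measurable (lebesgue_on U)" "a \<in> borel_measurable (lebesgue_on U)"
    using assms L2_measurable by auto
  show "(\<lambda>x. a x * f x) \<in> borel_measurable (lebesgue_on U)" by measurable
  show "integrable (lebesgue_on U) (\<lambda>x. (a x * f x)\<^sup>2)"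
  proof (rule Bochner_Integration.integrable_bound[of _ "\<lambda>x. C\<^sup>2 * (f x)\<^sup>2"])
    show "integrable (lebesgue_on U) (\<lambda>x. C\<^sup>2 * (f x)\<^sup>2)"
      using assms unfolding L2_def by auto
    show "AE x in lebesgue_on U. norm ((a x * f x)\<^sup>2) \<le> norm (C\<^sup>2 * (f x)\<^sup>2)"
    proof (rule AE_I2)
      fix x assume "x \<in> space (lebesgue_on U)"
      then have "x \<in> U" by simp
      then have "(a x)\<^sup>2 \<le> C\<^sup>2" using power_mono[OF assms(3)[of x], of 2] by simp
      then show "norm ((a x * f x)\<^sup>2) \<le> norm (C\<^sup>2 * (f x)\<^sup>2)"
        by (simp add: power_mult_distrib mult_right_mono)
    qed
  qed measurable
qed

lemma smooth_bdd_measurable: "smooth_bdd U a \<Longrightarrow> a \<in> borel_measurable (lebesgue_on U)"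
  by (rule continuous_imp_measurable_on_sets_lebesgue[OF smooth_bdd_continuous U_sets])

lemma L2_mult_smooth_bdd:
  assumes "smooth_bdd U a" "L2 U f" shows "L2 U (\<lambda>x. a x * f x)"
proof -
  obtain C where "\<forall>x\<in>U. norm (a x) \<le> C"
    using smooth_bdd_bounded[OF assms(1)] unfolding bounded_iff by auto
  then show ?thesis by (intro L2_mult_bounded[OF assms(2) smooth_bdd_measurable[OF assms(1)]]) auto
qed

lemma L2_mult_test_fun:
  assumes "test_fun V \<phi>" "L2 U f" shows "L2 U (\<lambda>x. f x * \<phi> x)"
proof -
  obtain C where C: "\<And>x. \<bar>\<phi> x\<bar> \<le> C" using test_fun_bounded[OF assms(1)] by blast
  have "\<phi> \<in> borel_measurable (lebesgue_on U)"
    by (rule borel_measurable_lebesgue_on_continuous[OF test_fun_continuous[OF assms(1)]])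
  from L2_mult_bounded[OF assms(2) this C] show ?thesis by (simp add: mult.commute)
qed

lemma integrable_mult_test_fun:
  "test_fun V \<phi> \<Longrightarrow> L2 U f \<Longrightarrow> integrable (lebesgue_on U) (\<lambda>x. f x * \<phi> x)"
  by (rule L2_integrable[OF L2_mult_test_fun])

text \<open>A relational form: \<open>wgrad\<close> selects a representative by choice, whereas
  rules for sums, products and almost everywhere equality have to name the derivative. Square
  integrability of both functions is included so that every integral in these rules exists.\<close>

definition has_wd :: "'n \<Rightarrow> (real^'n \<Rightarrow> real) \<Rightarrow> (real^'n \<Rightarrow> real) \<Rightarrow> bool" where
  "has_wd k f g \<longleftrightarrow> L2 U f \<and> L2 U g \<and> weak_deriv U [k] f g"

lemma has_wdI:
  assumes "L2 U f" "L2 U g"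
    "\<And>\<phi>. test_fun U \<phi> \<Longrightarrow> (\<integral>x. f x * pd k \<phi> x \<partial>lebesgue_on U) = - (\<integral>x. g x * \<phi> x \<partial>lebesgue_on U)"
  shows "has_wd k f g"
  using assms unfolding has_wd_def weak_deriv_def by simp

lemma has_wdD:
  "has_wd k f g \<Longrightarrow> test_fun U \<phi> \<Longrightarrow> (\<integral>x. f x * pd k \<phi> x \<partial>lebesgue_on U) = - (\<integral>x. g x * \<phi> x \<partial>lebesgue_on U)"
  unfolding has_wd_def weak_deriv_def by simp

lemma has_wd_L2: "has_wd k f g \<Longrightarrow> L2 U f" "has_wd k f g \<Longrightarrow> L2 U g"
  unfolding has_wd_def by auto

lemma L2_cong: "(\<And>x. x \<in> U \<Longrightarrow> f x = g x) \<Longrightarrow> L2 U f \<Longrightarrow> L2 U g"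
proof -
  assume eq: "\<And>x. x \<in> U \<Longrightarrow> f x = g x" and "L2 U f"
  then have "f \<in> borel_measurable (lebesgue_on U)" "integrable (lebesgue_on U) (\<lambda>x. (f x)\<^sup>2)" unfolding L2_def by auto
  moreover have "f \<in> borel_measurable (lebesgue_on U) \<longleftrightarrow> g \<in> borel_measurable (lebesgue_on U)"
    by (rule measurable_cong) (use eq in simp)
  moreover have "integrable (lebesgue_on U) (\<lambda>x. (f x)\<^sup>2) \<longleftrightarrow> integrable (lebesgue_on U) (\<lambda>x. (g x)\<^sup>2)"
    by (rule Bochner_Integration.integrable_cong) (use eq in simp_all)
  ultimately show "L2 U g" unfolding L2_def by blast
qed

lemma has_wd_cong:
  assumes "\<And>x. x \<in> U \<Longrightarrow> f x = f' x" "\<And>x. x \<in> U \<Longrightarrow> g x = g' x" "has_wd k f g"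
  shows "has_wd k f' g'"
proof (rule has_wdI)
  show "L2 U f'" by (rule L2_cong[OF assms(1) has_wd_L2(1)[OF assms(3)]])
  show "L2 U g'" by (rule L2_cong[OF assms(2) has_wd_L2(2)[OF assms(3)]])
  fix \<phi> assume t: "test_fun U \<phi>"
  have "(\<integral>x. f' x * pd k \<phi> x \<partial>lebesgue_on U) = (\<integral>x. f x * pd k \<phi> x \<partial>lebesgue_on U)"
    by (rule Bochner_Integration.integral_cong) (use assms(1) in simp_all)
  moreover have "(\<integral>x. g' x * \<phi> x \<partial>lebesgue_on U) = (\<integral>x. g x * \<phi> x \<partial>lebesgue_on U)"
    by (rule Bochner_Integration.integral_cong) (use assms(2) in simp_all)
  ultimately show "(\<integral>x. f' x * pd k \<phi> x \<partial>lebesgue_on U) = - (\<integral>x. g' x * \<phi> x \<partial>lebesgue_on U)"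
    using has_wdD[OF assms(3) t] by simp
qed

lemma has_wd_cong_AE:
  assumes "AE x in lebesgue_on U. f x = f' x" "L2 U f'" "has_wd k f g"
  shows "has_wd k f' g"
proof (rule has_wdI)
  show "L2 U f'" "L2 U g" using assms has_wd_L2 by auto
  fix \<phi> assume t: "test_fun U \<phi>"
  have m: "pd k \<phi> \<in> borel_measurable (lebesgue_on U)"
    using borel_measurable_lebesgue_on_continuous[OF test_fun_continuous[OF test_fun_pds[OF t, of "[k]"]]] by simp
  have "(\<integral>x. f' x * pd k \<phi> x \<partial>lebesgue_on U) = (\<integral>x. f x * pd k \<phi> x \<partial>lebesgue_on U)"
  proof (rule integral_cong_AE)
    show "(\<lambda>x. f' x * pd k \<phi> x) \<in> borel_measurable (lebesgue_on U)"
      by (rule borel_measurable_times[OF L2_measurable[OF assms(2)] m])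
    show "(\<lambda>x. f x * pd k \<phi> x) \<in> borel_measurable (lebesgue_on U)"
      by (rule borel_measurable_times[OF L2_measurable[OF has_wd_L2(1)[OF assms(3)]] m])
    show "AE x in lebesgue_on U. f' x * pd k \<phi> x = f x * pd k \<phi> x"
      using assms(1) by eventually_elim simp
  qed
  then show "(\<integral>x. f' x * pd k \<phi> x \<partial>lebesgue_on U) = - (\<integral>x. g x * \<phi> x \<partial>lebesgue_on U)"
    using has_wdD[OF assms(3) t] by simp
qed

lemma has_wd_add:
  assumes "has_wd k f g" "has_wd k f' g'"
  shows "has_wd k (\<lambda>x. f x + f' x) (\<lambda>x. g x + g' x)"
proof (rule has_wdI)
  fix \<phi> assume t: "test_fun U \<phi>"
  have t': "test_fun U (pd k \<phi>)" using test_fun_pds[OF t, of "[k]"] by simp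
  show "(\<integral>x. (f x + f' x) * pd k \<phi> x \<partial>lebesgue_on U) = - (\<integral>x. (g x + g' x) * \<phi> x \<partial>lebesgue_on U)"
    using has_wdD[OF assms(1) t] has_wdD[OF assms(2) t] assms t t'
    by (simp add: distrib_right Bochner_Integration.integral_add integrable_mult_test_fun has_wd_L2)
qed (use assms L2_add has_wd_L2 in auto)

text \<open>The product of \<open>a\<close> and \<open>\<phi>\<close> is itself a test function, and
  the defining identity of \<open>g\<close> tested with it already contains the Leibniz term with
  \<open>pd k a\<close>.\<close>

lemma has_wd_mult:
  assumes a: "smooth_bdd U a" and w: "has_wd k f g"
  shows "has_wd k (\<lambda>x. a x * f x) (\<lambda>x. a x * g x + pd k a x * f x)"
proof (rule has_wdI)
  have L: "L2 U (\<lambda>x. a x * f x)" "L2 U (\<lambda>x. a x * g x)" "L2 U (\<lambda>x. pd k a x * f x)"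
    using L2_mult_smooth_bdd a smooth_bdd_pd[OF a] has_wd_L2[OF w] by auto
  show "L2 U (\<lambda>x. a x * f x)" "L2 U (\<lambda>x. a x * g x + pd k a x * f x)" using L L2_add by auto
  fix \<phi> assume t: "test_fun U \<phi>"
  have t': "test_fun U (pd k \<phi>)" using test_fun_pds[OF t, of "[k]"] by simp
  have ta: "test_fun U (\<lambda>x. a x * \<phi> x)"
    using test_fun_mult[OF U_open _ t] a unfolding smooth_bdd_def by auto
  note int = integrable_mult_test_fun[OF t' L(1)] integrable_mult_test_fun[OF t L(3)] integrable_mult_test_fun[OF t L(2)]
  have "- (\<integral>x. (a x * g x) * \<phi> x \<partial>lebesgue_on U) = - (\<integral>x. g x * (a x * \<phi> x) \<partial>lebesgue_on U)"
    by (simp add: mult_ac)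
  also have "\<dots> = (\<integral>x. f x * pd k (\<lambda>x. a x * \<phi> x) x \<partial>lebesgue_on U)"
    using has_wdD[OF w ta] by simp
  also have "\<dots> = (\<integral>x. (a x * f x) * pd k \<phi> x + (pd k a x * f x) * \<phi> x \<partial>lebesgue_on U)"
  proof (rule Bochner_Integration.integral_cong)
    fix x assume "x \<in> space (lebesgue_on U)"
    then have x: "x \<in> U" by simp
    have "pd k (\<lambda>x. a x * \<phi> x) x = a x * pd k \<phi> x + pd k a x * \<phi> x"
      by (rule has_pd_imp_pd[OF has_pd_mult[OF smooth_bdd_has_pd[OF a x] smooth_on_has_pd1[OF test_fun_smooth[OF t]]]]) simp
    then show "f x * pd k (\<lambda>x. a x * \<phi> x) x = (a x * f x) * pd k \<phi> x + (pd k a x * f x) * \<phi> x"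
      by (simp add: algebra_simps)
  qed simp
  also have "\<dots> = (\<integral>x. (a x * f x) * pd k \<phi> x \<partial>lebesgue_on U) + (\<integral>x. (pd k a x * f x) * \<phi> x \<partial>lebesgue_on U)"
    by (rule Bochner_Integration.integral_add[OF int(1,2)])
  finally have "(\<integral>x. (a x * f x) * pd k \<phi> x \<partial>lebesgue_on U)
      = - ((\<integral>x. (a x * g x) * \<phi> x \<partial>lebesgue_on U) + (\<integral>x. (pd k a x * f x) * \<phi> x \<partial>lebesgue_on U))"
    by simp
  also have "\<dots> = - (\<integral>x. (a x * g x) * \<phi> x + (pd k a x * f x) * \<phi> x \<partial>lebesgue_on U)"
    by (simp only: Bochner_Integration.integral_add[OF int(3,2)])
  also have "\<dots> = - (\<integral>x. (a x * g x + pd k a x * f x) * \<phi> x \<partial>lebesgue_on U)"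
    by (simp only: distrib_right)
  finally show "(\<integral>x. (a x * f x) * pd k \<phi> x \<partial>lebesgue_on U) = - (\<integral>x. (a x * g x + pd k a x * f x) * \<phi> x \<partial>lebesgue_on U)" .
qed

text \<open>The seed for smooth functions: the product rule with the constant 1 turns it into
  integration by parts for every \<open>smooth_bdd\<close> function.\<close>

lemma has_wd_one: "has_wd k (\<lambda>x. 1) (\<lambda>x. 0)"
  by (rule has_wdI[OF L2_const L2_const]) (simp add: integral_pd_test_fun[OF _ U_sets])

lemma has_wd_smooth: "smooth_bdd U a \<Longrightarrow> has_wd k a (pd k a)"
  using has_wd_mult[OF _ has_wd_one, of a k] by simp

lemma has_wd_zero: "has_wd k (\<lambda>x. 0) (\<lambda>x. 0)"
  using has_wd_smooth[OF smooth_bdd_const[OF U_open], of k 0] by (simp add: pd_zero)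

lemma has_wd_cmult: "has_wd k f g \<Longrightarrow> has_wd k (\<lambda>x. c * f x) (\<lambda>x. c * g x)"
  using has_wd_mult[OF smooth_bdd_const[OF U_open], of k f g c] has_pd_imp_pd[OF has_pd_const, of k c] by simp

lemma has_wd_minus: "has_wd k f g \<Longrightarrow> has_wd k (\<lambda>x. - f x) (\<lambda>x. - g x)"
  using has_wd_cmult[of k f g "-1"] by simp

lemma has_wd_sum:
  "(\<And>a. a \<in> A \<Longrightarrow> has_wd k (f a) (g a)) \<Longrightarrow> has_wd k (\<lambda>x. \<Sum>a\<in>A. f a x) (\<lambda>x. \<Sum>a\<in>A. g a x)"
  by (induction A rule: infinite_finite_induct) (auto intro: has_wd_zero has_wd_add)

lemma weak_deriv_unique:
  assumes "L2 U g" "L2 U g'" "weak_deriv U is f g" "weak_deriv U is f g'"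
  shows "AE x in lebesgue_on U. g x = g' x"
proof -
  have d: "L2 U (\<lambda>x. g x + (-1) * g' x)"
    by (intro L2_add L2_mult_smooth_bdd smooth_bdd_const U_open assms)
  have "AE x in lebesgue_on U. g x + (-1) * g' x = 0"
  proof (rule test_fun_integral_zero_imp_AE_zero[OF U_open L2_integrable[OF d]])
    fix \<phi> assume t: "test_fun U \<phi>"
    have "(\<integral>x. g x * \<phi> x \<partial>lebesgue_on U) = (\<integral>x. g' x * \<phi> x \<partial>lebesgue_on U)"
    proof -
      have "(-1) ^ length is * (\<integral>x. g x * \<phi> x \<partial>lebesgue_on U) = (-1) ^ length is * (\<integral>x. g' x * \<phi> x \<partial>lebesgue_on U)"
        using assms(3,4)[unfolded weak_deriv_def, rule_format, OF t] by simp
      then show ?thesis by simp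
    qed
    moreover have "(\<integral>x. (g x + (-1) * g' x) * \<phi> x \<partial>lebesgue_on U) = (\<integral>x. g x * \<phi> x - g' x * \<phi> x \<partial>lebesgue_on U)"
      by (simp add: left_diff_distrib)
    ultimately show "(\<integral>x. (g x + (-1) * g' x) * \<phi> x \<partial>lebesgue_on U) = 0"
      by (simp add: Bochner_Integration.integral_diff[OF integrable_mult_test_fun[OF t assms(1)] integrable_mult_test_fun[OF t assms(2)]])
  qed
  then show ?thesis by eventually_elim simp
qed

lemma has_wd_unique: "has_wd k f g \<Longrightarrow> has_wd k f g' \<Longrightarrow> AE x in lebesgue_on U. g x = g' x"
  unfolding has_wd_def using weak_deriv_unique by blast

lemma has_wd_unique_AE:
  assumes "has_wd k f g" "has_wd k f' g'" "AE x in lebesgue_on U. f x = f' x"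
  shows "AE x in lebesgue_on U. g x = g' x"
  by (rule has_wd_unique[OF has_wd_cong_AE[OF assms(3) has_wd_L2(1)[OF assms(2)] assms(1)] assms(2)])

text \<open>Existence of some weak derivative makes the choice in \<open>wpartial\<close> a genuine
  one; otherwise its value is arbitrary.\<close>

lemma wgrad_has_wd:
  assumes "has_wd k (\<lambda>x. f x $ j) g"
  shows "has_wd k (\<lambda>x. f x $ j) (\<lambda>x. wgrad U f x $ j $ k)"
proof -
  have "\<exists>g. L2 U g \<and> weak_deriv U [k] (\<lambda>y. f y $ j) g" using assms unfolding has_wd_def by blast
  from someI_ex[OF this] show ?thesis
    using assms unfolding has_wd_def by (simp add: wgrad_def wpartial_def)
qed

lemma sobolev_wgrad:
  assumes "sobolev m U f" "m \<ge> 1"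
  shows "has_wd k (\<lambda>x. f x $ j) (\<lambda>x. wgrad U f x $ j $ k)"
proof -
  have "sobolev_r m U (\<lambda>x. f x $ j)" using assms(1) unfolding sobolev_def by blast
  moreover have "length [k] \<le> m" using assms(2) by simp
  ultimately obtain g where "L2 U (\<lambda>x. f x $ j)" "L2 U g" "weak_deriv U [k] (\<lambda>x. f x $ j) g"
    unfolding sobolev_r_def by blast
  then show ?thesis by (intro wgrad_has_wd[of k f j g]) (simp add: has_wd_def)
qed

text \<open>The Sobolev condition speaks of second derivatives of \<open>f\<close> itself. Testing
  with \<open>pd l \<phi>\<close> exhibits them as first derivatives of \<open>wgrad\<close>; their
  symmetry is inherited from the test functions by uniqueness.\<close>

lemma sobolev2_second_wd:
  assumes "sobolev 2 U f"
  obtains h where "\<And>j k l. has_wd l (\<lambda>x. wgrad U f x $ j $ k) (h j k l)"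
    "\<And>j k l. AE x in lebesgue_on U. h j k l x = h j l k x"
proof -
  define h where "h j k l = (SOME g. L2 U g \<and> weak_deriv U [k, l] (\<lambda>x. f x $ j) g)" for j k l
  have "\<exists>g. L2 U g \<and> weak_deriv U [k, l] (\<lambda>x. f x $ j) g" for j k l
    using assms unfolding sobolev_def sobolev_r_def by simp
  from someI_ex[OF this]
  have h: "L2 U (h j k l)" "weak_deriv U [k, l] (\<lambda>x. f x $ j) (h j k l)" for j k l
    unfolding h_def by auto
  have 1: "has_wd l (\<lambda>x. wgrad U f x $ j $ k) (h j k l)" for j k l
  proof (rule has_wdI)
    have w: "has_wd k (\<lambda>x. f x $ j) (\<lambda>x. wgrad U f x $ j $ k)" by (rule sobolev_wgrad[OF assms]) simp
    show "L2 U (\<lambda>x. wgrad U f x $ j $ k)" by (rule has_wd_L2(2)[OF w])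
    fix \<phi> assume t: "test_fun U \<phi>"
    have t': "test_fun U (pd l \<phi>)" using test_fun_pds[OF t, of "[l]"] by simp
    have "(\<integral>x. f x $ j * pd k (pd l \<phi>) x \<partial>lebesgue_on U) = (\<integral>x. h j k l x * \<phi> x \<partial>lebesgue_on U)"
      using h(2)[of k l j] t unfolding weak_deriv_def by simp
    then show "(\<integral>x. wgrad U f x $ j $ k * pd l \<phi> x \<partial>lebesgue_on U) = - (\<integral>x. h j k l x * \<phi> x \<partial>lebesgue_on U)"
      using has_wdD[OF w t'] by simp
  qed (rule h)
  have 2: "AE x in lebesgue_on U. h j k l x = h j l k x" for j k l
  proof (rule weak_deriv_unique[OF h(1) h(1) h(2)])
    show "weak_deriv U [k, l] (\<lambda>x. f x $ j) (h j l k)"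
      unfolding weak_deriv_def
    proof (intro allI impI)
      fix \<phi> assume t: "test_fun U \<phi>"
      have "pds [k, l] \<phi> = pds [l, k] \<phi>"
        by (rule ext) (rule pds_swap[OF open_UNIV test_fun_smooth[OF t] UNIV_I])
      moreover have "(\<integral>x. f x $ j * pds [l, k] \<phi> x \<partial>lebesgue_on U) = (- 1) ^ length [l, k] * (\<integral>x. h j l k x * \<phi> x \<partial>lebesgue_on U)"
        using h(2)[of l k j] t unfolding weak_deriv_def by blast
      ultimately show "(\<integral>x. f x $ j * pds [k, l] \<phi> x \<partial>lebesgue_on U) = (- 1) ^ length [k, l] * (\<integral>x. h j l k x * \<phi> x \<partial>lebesgue_on U)"
        by simp
    qed
  qed
  show ?thesis by (rule that[of h, OF 1 2])
qed

lemma has_wd_cong_AE_right: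
  assumes "AE x in lebesgue_on U. g x = g' x" "L2 U g'" "has_wd k f g"
  shows "has_wd k f g'"
proof (rule has_wdI)
  show "L2 U f" "L2 U g'" using assms has_wd_L2 by auto
  fix \<phi> assume t: "test_fun U \<phi>"
  have m: "\<phi> \<in> borel_measurable (lebesgue_on U)"
    using borel_measurable_lebesgue_on_continuous[OF test_fun_continuous[OF t]] .
  have "(\<integral>x. g' x * \<phi> x \<partial>lebesgue_on U) = (\<integral>x. g x * \<phi> x \<partial>lebesgue_on U)"
  proof (rule integral_cong_AE)
    show "(\<lambda>x. g' x * \<phi> x) \<in> borel_measurable (lebesgue_on U)"
      by (rule borel_measurable_times[OF L2_measurable[OF assms(2)] m])
    show "(\<lambda>x. g x * \<phi> x) \<in> borel_measurable (lebesgue_on U)"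
      by (rule borel_measurable_times[OF L2_measurable[OF has_wd_L2(2)[OF assms(3)]] m])
    show "AE x in lebesgue_on U. g' x * \<phi> x = g x * \<phi> x"
      using assms(1) by eventually_elim simp
  qed
  then show "(\<integral>x. f x * pd k \<phi> x \<partial>lebesgue_on U) = - (\<integral>x. g' x * \<phi> x \<partial>lebesgue_on U)"
    using has_wdD[OF assms(3) t] by simp
qed

end

section \<open>Functions with vanishing weak gradient\<close>

lemma AE_lborel_translate:
  fixes v :: "'a::euclidean_space"
  assumes "AE t in lborel. P (v + t)" "{x. P x} \<in> sets borel"
  shows "AE y in lborel. P y"
proof -
  have "AE y in distr lborel borel ((+) v). P y"
    using assms by (subst AE_distr_iff) auto
  then show ?thesis unfolding lborel_distr_plus .
qed

text \<open>Balls are not null sets, so an almost everywhere statement yields a single good point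
  near any given one.\<close>

lemma AE_ball_exists:
  fixes x :: "'a::euclidean_space"
  assumes "AE y in lborel. P y" "r > 0"
  obtains y where "y \<in> ball x r" "P y"
proof -
  have "\<exists>y\<in>ball x r. P y"
  proof (rule ccontr)
    assume "\<not> (\<exists>y\<in>ball x r. P y)"
    then have n: "y \<notin> ball x r" if "P y" for y using that by blast
    have "AE y in lborel. y \<notin> ball x r" by (rule AE_mp[OF assms(1)], rule AE_I2, rule impI, rule n)
    then have "ball x r \<in> null_sets lborel" by (subst (asm) AE_iff_null_sets[symmetric]) simp_all
    then have "negligible (ball x r)"
      by (simp add: negligible_iff_null_sets null_sets_completionI)
    moreover have "ball x r \<noteq> {}" using assms(2) by simp
    ultimately show False using open_not_negligible[of "ball x r"] by blast
  qed
  then show ?thesis using that by blast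
qed

text \<open>As long as the shifted support remains in \<open>U\<close>, the derivative of the
  pairing with respect to the shift is, up to sign, the pairing with a derivative of a test
  function, hence zero. Shifts are made along the two axes in turn.\<close>

lemma weak_grad_zero_translate:
  fixes U :: "(real^2) set"
  assumes f: "integrable (lebesgue_on U) f"
    and z: "\<And>k. weak_deriv U [k] f (\<lambda>x. 0)"
    and sub: "ball x0 (2 * R) \<subseteq> U" and t: "norm v < R"
    and \<phi>: "test_fun (ball x0 R) \<phi>"
  shows "(\<integral>x. f x * \<phi> (x - v) \<partial>lebesgue_on U) = (\<integral>x. f x * \<phi> x \<partial>lebesgue_on U)"
proof -
  have dx: "dist x (x + u) = norm u" for x u :: "real^2"
    by (simp add: dist_norm)
  have step: "(\<integral>x. f x * \<phi> (x - (w + s *\<^sub>R axis k 1)) \<partial>lebesgue_on U) = (\<integral>x. f x * \<phi> (x - w) \<partial>lebesgue_on U)"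
    if w: "\<And>\<tau>. \<bar>\<tau>\<bar> \<le> \<bar>s\<bar> \<Longrightarrow> norm (w + \<tau> *\<^sub>R axis k 1) < R" for w k s
  proof -
    define \<psi> where "\<psi> x = \<phi> (x - w)" for x
    define F where "F \<tau> = (\<integral>x. f x * \<psi> (x - \<tau> *\<^sub>R axis k 1) \<partial>lebesgue_on U)" for \<tau>
    have \<psi>: "test_fun UNIV \<psi>" unfolding \<psi>_def by (rule test_fun_translate[OF \<phi>]) simp
    have "(F has_real_derivative 0) (at \<tau> within {-\<bar>s\<bar>..\<bar>s\<bar>})" if "\<tau> \<in> {-\<bar>s\<bar>..\<bar>s\<bar>}" for \<tau>
    proof -
      let ?\<chi> = "\<lambda>x. \<psi> (x - \<tau> *\<^sub>R axis k 1)"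
      have "test_fun U ?\<chi>"
      proof -
        have "x + (w + \<tau> *\<^sub>R axis k 1) \<in> U" if "x \<in> ball x0 R" for x
        proof -
          have "dist x0 (x + (w + \<tau> *\<^sub>R axis k 1)) \<le> dist x0 x + norm (w + \<tau> *\<^sub>R axis k 1)"
            using dist_triangle[of x0 "x + (w + \<tau> *\<^sub>R axis k 1)" x] unfolding dx .
          also have "\<bar>\<tau>\<bar> \<le> \<bar>s\<bar>" using \<open>\<tau> \<in> _\<close> by auto
          then have "dist x0 x + norm (w + \<tau> *\<^sub>R axis k 1) < 2 * R" using that w[of \<tau>] by simp
          finally show ?thesis using sub by auto
        qed
        from test_fun_translate[OF \<phi> this] show ?thesis
          unfolding \<psi>_def by (simp add: diff_diff_eq add.commute)
      qed
      then have "(\<integral>x. f x * pd k ?\<chi> x \<partial>lebesgue_on U) = 0"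
        using z[of k] unfolding weak_deriv_def by simp
      moreover have "pd k ?\<chi> x = pd k \<psi> (x - \<tau> *\<^sub>R axis k 1)" for x
        using pds_translate[of "[k]" \<psi> "\<tau> *\<^sub>R axis k 1" x] by simp
      ultimately have "(F has_real_derivative 0) (at \<tau>)"
        using has_derivative_integral_translate[OF f \<psi>, of k \<tau>] unfolding F_def by simp
      then show ?thesis by (rule has_field_derivative_at_within)
    qed
    then have "\<exists>c. \<forall>\<tau>\<in>{-\<bar>s\<bar>..\<bar>s\<bar>}. F \<tau> = c"
      by (intro has_field_derivative_zero_constant convex_real_interval(5))
    then obtain c where c: "\<forall>\<tau>\<in>{-\<bar>s\<bar>..\<bar>s\<bar>}. F \<tau> = c" by (elim exE)
    have "F s = c" "F 0 = c" by (rule c[rule_format], auto)+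
    then show ?thesis unfolding F_def \<psi>_def by (simp add: diff_diff_eq add.commute)
  qed
  \<comment> \<open>Shrinking coordinates does not lengthen a vector, so the two-step path from the
    origin to \<open>v\<close> keeps within norm \<open>R\<close>.\<close>
  have nrm: "norm u \<le> norm v" if "\<bar>u $ 1\<bar> \<le> \<bar>v $ 1\<bar>" "\<bar>u $ 2\<bar> \<le> \<bar>v $ 2\<bar>" for u :: "real^2"
  proof -
    have "(u $ 1)\<^sup>2 \<le> (v $ 1)\<^sup>2" "(u $ 2)\<^sup>2 \<le> (v $ 2)\<^sup>2" using that by (simp_all add: abs_le_square_iff)
    then show ?thesis unfolding norm_vec_def L2_set_def by (simp add: sum_2)
  qed
  have v: "v = v $ 1 *\<^sub>R axis 1 1 + v $ 2 *\<^sub>R axis 2 1"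
    by (simp add: vec_eq_iff forall_2 axis_def)
  have "(\<integral>x. f x * \<phi> (x - (0 + v $ 1 *\<^sub>R axis 1 1)) \<partial>lebesgue_on U) = (\<integral>x. f x * \<phi> (x - 0) \<partial>lebesgue_on U)"
    by (rule step) (rule le_less_trans[OF nrm t], auto simp: axis_def)
  moreover have "(\<integral>x. f x * \<phi> (x - (v $ 1 *\<^sub>R axis 1 1 + v $ 2 *\<^sub>R axis 2 1)) \<partial>lebesgue_on U)
     = (\<integral>x. f x * \<phi> (x - v $ 1 *\<^sub>R axis 1 1) \<partial>lebesgue_on U)"
    by (rule step) (rule le_less_trans[OF nrm t], auto simp: axis_def)
  ultimately show ?thesis using v by simp
qed

text \<open>Invariance of the pairings gives, for each small \<open>v\<close>, that
  \<open>F (x + v) = F x\<close> for almost every \<open>x\<close>. Fubini exchanges the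
  quantifiers, and one good \<open>x\<close> then provides the constant for almost all nearby
  points.\<close>

lemma weak_grad_zero_imp_locally_const:
  fixes U :: "(real^2) set"
  assumes U: "open U" and f: "integrable (lebesgue_on U) f"
    and z: "\<And>k. weak_deriv U [k] f (\<lambda>x. 0)"
    and F[measurable]: "F \<in> borel_measurable borel" and FU: "AE x in lborel. indicator U x * f x = F x"
    and x0: "x0 \<in> U"
  shows "\<exists>c r. r > 0 \<and> (AE y in lborel. y \<in> ball x0 r \<longrightarrow> F y = c)"
proof -
  have UL: "U \<in> sets lebesgue" using U by auto
  have F': "AE x in lebesgue. indicator U x * f x = F x" using AE_completion[OF FU] .
  have FL: "F \<in> borel_measurable lebesgue" using F by (simp add: measurable_completion)
  have int: "integrable lebesgue (\<lambda>x. indicator U x * f x)"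
    using f integrable_restrict_space[of U lebesgue f] UL by simp
  have intF: "integrable lborel F"
    using Bochner_Integration.integrable_cong_AE[THEN iffD1, OF borel_measurable_integrable[OF int] FL F' int]
      integrable_completion[of F lborel] F by simp
  have transfer: "(\<integral>x. f x * \<psi> x \<partial>lebesgue_on U) = (\<integral>x. F x * \<psi> x \<partial>lborel)"
    if \<psi>: "\<psi> \<in> borel_measurable borel" for \<psi> :: "real^2 \<Rightarrow> real"
  proof -
    have \<psi>L: "\<psi> \<in> borel_measurable lebesgue" using \<psi> by (simp add: measurable_completion)
    have "(\<integral>x. f x * \<psi> x \<partial>lebesgue_on U) = (\<integral>x. indicator U x *\<^sub>R (f x * \<psi> x) \<partial>lebesgue)"
      using integral_restrict_space[of U lebesgue "\<lambda>x. f x * \<psi> x"] UL by simp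
    also have "\<dots> = (\<integral>x. F x * \<psi> x \<partial>lebesgue)"
    proof (rule integral_cong_AE)
      have "(\<lambda>x. (indicator U x * f x) * \<psi> x) \<in> borel_measurable lebesgue"
        by (rule borel_measurable_times[OF borel_measurable_integrable[OF int] \<psi>L])
      then show "(\<lambda>x. indicator U x *\<^sub>R (f x * \<psi> x)) \<in> borel_measurable lebesgue"
        by (simp add: mult.assoc)
      show "(\<lambda>x. F x * \<psi> x) \<in> borel_measurable lebesgue" by (rule borel_measurable_times[OF FL \<psi>L])
      show "AE x in lebesgue. indicator U x *\<^sub>R (f x * \<psi> x) = F x * \<psi> x"
        using F'
      proof eventually_elim
        case (elim x)
        show ?case unfolding elim[symmetric] by simp
      qed
    qed
    also have "\<dots> = (\<integral>x. F x * \<psi> x \<partial>lborel)"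
      using \<psi> by (intro integral_completion) simp
    finally show ?thesis .
  qed
  obtain e where e: "e > 0" "ball x0 e \<subseteq> U" using U x0 by (meson openE)
  \<comment> \<open>Half of the radius is for the support of the test function, half for the
    shift.\<close>
  define R where "R = e / 2"
  have R: "R > 0" "ball x0 (2 * R) \<subseteq> U" using e by (auto simp: R_def)
  have inv: "AE x in lborel. x \<in> ball x0 R \<longrightarrow> F (x + v) - F x = 0" if v: "norm v < R" for v
  proof -
    have intFv: "integrable lborel (\<lambda>x. F (x + v))"
    proof -
      have "integrable (distr lborel borel ((+) v)) F" using intF by (simp add: lborel_distr_plus)
      then have "integrable lborel (\<lambda>x. F (v + x))" by (subst (asm) integrable_distr_eq) auto
      then show ?thesis by (simp add: add.commute)
    qed
    have bL: "ball x0 R \<in> sets lebesgue" by auto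
    have d: "integrable lborel (\<lambda>x. F (x + v) - F x)" using intFv intF by auto
    have dL: "integrable lebesgue (\<lambda>x. F (x + v) - F x)"
      using integrable_completion[OF borel_measurable_integrable[OF d]] d by (rule iffD2)
    have id: "integrable (lebesgue_on (ball x0 R)) (\<lambda>x. F (x + v) - F x)"
      by (rule integrable_restrict_space[THEN iffD2, OF _ integrable_mult_indicator[OF bL dL]]) (use bL in simp)
    have "AE x in lebesgue_on (ball x0 R). F (x + v) - F x = 0"
    proof (rule test_fun_integral_zero_imp_AE_zero[OF open_ball id])
      fix \<phi> assume \<phi>: "test_fun (ball x0 R) \<phi>"
      obtain C where C: "\<And>x. \<bar>\<phi> x\<bar> \<le> C" using test_fun_bounded[OF \<phi>] by blast
      have \<phi>b[measurable]: "\<phi> \<in> borel_measurable borel"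
        using test_fun_continuous[OF \<phi>] by (rule borel_measurable_continuous_onI)
      have \<phi>v: "(\<lambda>x. \<phi> (x - v)) \<in> borel_measurable borel" by measurable
      have bd: "integrable lborel (\<lambda>x. g x * \<phi> x)" if g: "integrable lborel g" for g :: "real^2 \<Rightarrow> real"
      proof (rule Bochner_Integration.integrable_bound[of _ "\<lambda>x. C * \<bar>g x\<bar>"])
        show "integrable lborel (\<lambda>x. C * \<bar>g x\<bar>)" using g by auto
        show "(\<lambda>x. g x * \<phi> x) \<in> borel_measurable lborel" using g by measurable
        show "AE x in lborel. norm (g x * \<phi> x) \<le> norm (C * \<bar>g x\<bar>)"
        proof (rule AE_I2)
          fix x
          have "\<bar>g x\<bar> * \<bar>\<phi> x\<bar> \<le> \<bar>g x\<bar> * \<bar>C\<bar>" using C[of x] by (intro mult_left_mono) auto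
          then show "norm (g x * \<phi> x) \<le> norm (C * \<bar>g x\<bar>)" by (simp add: abs_mult mult.commute)
        qed
      qed
      have "(\<integral>x. F (x + v) * \<phi> x \<partial>lborel) = (\<integral>x. F (x + v) * \<phi> ((x + v) - v) \<partial>lborel)" by simp
      also have "\<dots> = (\<integral>x. F x * \<phi> (x - v) \<partial>lborel)"
        by (rule lborel_integral_translate[of "\<lambda>x. F x * \<phi> (x - v)"]) measurable
      also have "\<dots> = (\<integral>x. F x * \<phi> x \<partial>lborel)"
        using weak_grad_zero_translate[OF f z R(2) v \<phi>] transfer[OF \<phi>b] transfer[OF \<phi>v] by simp
      finally have eq: "(\<integral>x. (F (x + v) - F x) * \<phi> x \<partial>lborel) = 0"
        by (simp add: left_diff_distrib Bochner_Integration.integral_diff[OF bd[OF intFv] bd[OF intF]])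
      have ind: "indicator (ball x0 R) x *\<^sub>R ((F (x + v) - F x) * \<phi> x) = (F (x + v) - F x) * \<phi> x" for x
        using test_fun_zero[OF \<phi>, of x "[]"] by (cases "x \<in> ball x0 R") auto
      have "(\<integral>x. (F (x + v) - F x) * \<phi> x \<partial>lebesgue_on (ball x0 R)) = (\<integral>x. (F (x + v) - F x) * \<phi> x \<partial>lebesgue)"
        using integral_restrict_space[of "ball x0 R" lebesgue "\<lambda>x. (F (x + v) - F x) * \<phi> x"] bL
        unfolding ind by simp
      also have "\<dots> = (\<integral>x. (F (x + v) - F x) * \<phi> x \<partial>lborel)"
        by (rule integral_completion) measurable
      finally show "(\<integral>x. (F (x + v) - F x) * \<phi> x \<partial>lebesgue_on (ball x0 R)) = 0" using eq by simp
    qed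
    then show ?thesis unfolding AE_lebesgue_on_iff[OF open_ball] .
  qed
  let ?P = "\<lambda>x v. dist x0 x < R \<longrightarrow> norm v < R \<longrightarrow> F (x + v) = F x"
  have "AE v in lborel. AE x in lborel. ?P x v"
  proof (rule AE_I2)
    fix v
    show "AE x in lborel. ?P x v"
    proof (cases "norm v < R")
      case True
      from inv[OF this] show ?thesis by eventually_elim auto
    qed simp
  qed
  moreover have "{x \<in> space (lborel \<Otimes>\<^sub>M lborel). ?P (fst x) (snd x)} \<in> sets (lborel \<Otimes>\<^sub>M lborel)"
  proof -
    have "Measurable.pred (borel \<Otimes>\<^sub>M borel) (\<lambda>z. ?P (fst z) (snd z))" by measurable
    then have "{x \<in> space (borel \<Otimes>\<^sub>M borel). ?P (fst x) (snd x)} \<in> sets (borel \<Otimes>\<^sub>M borel)"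
      by (rule predE)
    moreover have "sets (lborel \<Otimes>\<^sub>M lborel) = sets (borel \<Otimes>\<^sub>M (borel :: (real^2) measure))"
      by (intro sets_pair_measure_cong sets_lborel)
    ultimately show ?thesis by (simp add: space_pair_measure)
  qed
  ultimately have "AE x in lborel. AE v in lborel. ?P x v"
    using lborel_pair.AE_commute[of ?P] by blast
  \<comment> \<open>A good point within \<open>R / 2\<close> of \<open>x0\<close> has the whole ball
    of radius \<open>R / 2\<close> about \<open>x0\<close> at distance less than
    \<open>R\<close>.\<close>
  then obtain x where x: "x \<in> ball x0 (R / 2)" "AE v in lborel. ?P x v"
    using AE_ball_exists[of "\<lambda>x. AE v in lborel. ?P x v" "R / 2" x0] R(1) by auto
  have "AE v in lborel. norm (x + v - x) < R \<longrightarrow> F (x + v) = F x"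
    using x(2) by eventually_elim (use x(1) R(1) in auto)
  then have *: "AE y in lborel. norm (y - x) < R \<longrightarrow> F y = F x"
    by (rule AE_lborel_translate) measurable
  have near: "norm (y - x) < R" if "y \<in> ball x0 (R / 2)" for y
  proof -
    have "dist x0 x < R / 2" "dist x0 y < R / 2" using x(1) that by auto
    then show ?thesis using dist_triangle[of y x x0] dist_commute[of y x0] by (simp add: dist_norm)
  qed
  have "AE y in lborel. y \<in> ball x0 (R / 2) \<longrightarrow> F y = F x"
    using *
  proof eventually_elim
    case (elim y)
    then show ?case using near[of y] by blast
  qed
  then show ?thesis using R(1) by (intro exI[of _ "F x"] exI[of _ "R / 2"]) simp
qed

text \<open>The local constants are unique because balls have positive measure, so the function
  assigning them is locally constant, and connectedness makes it constant.\<close>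

lemma weak_grad_zero_imp_const:
  fixes U :: "(real^2) set"
  assumes U: "open U" "connected U" and f: "integrable (lebesgue_on U) f"
    and z: "\<And>k. weak_deriv U [k] f (\<lambda>x. 0)"
  shows "\<exists>c. AE x in lebesgue_on U. f x = c"
proof (cases "U = {}")
  case True
  then show ?thesis using AE_lebesgue_on_iff[OF U(1)] by auto
next
  case False
  have UL: "U \<in> sets lebesgue" using U by auto
  have int: "integrable lebesgue (\<lambda>x. indicator U x * f x)"
    using f integrable_restrict_space[of U lebesgue f] UL by simp
  then obtain F where F: "F \<in> borel_measurable borel" "AE x in lborel. indicator U x * f x = F x"
    using completion_ex_borel_measurable_real[of "\<lambda>x. indicator U x * f x" lborel] by auto
  define Q where "Q c x \<longleftrightarrow> (\<exists>r>0. AE y in lborel. y \<in> ball x r \<longrightarrow> F y = c)" for c x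
  have ex: "\<exists>c. Q c x" if "x \<in> U" for x
    using weak_grad_zero_imp_locally_const[OF U(1) f z F that] unfolding Q_def by metis
  have uniq: "c = d" if "Q c x" "Q d x" for c d x
  proof -
    obtain r s where rs: "r > 0" "s > 0" "AE y in lborel. y \<in> ball x r \<longrightarrow> F y = c" "AE y in lborel. y \<in> ball x s \<longrightarrow> F y = d"
      using \<open>Q c x\<close> \<open>Q d x\<close> unfolding Q_def by (elim exE conjE)
    have "AE y in lborel. y \<in> ball x (min r s) \<longrightarrow> c = d" using rs(3,4) by eventually_elim auto
    then obtain y where "y \<in> ball x (min r s)" "y \<in> ball x (min r s) \<longrightarrow> c = d"
      by (rule AE_ball_exists[where r="min r s" and x=x]) (use rs(1,2) in auto)
    then show ?thesis by blast
  qed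
  have Qop: "open {x. Q c x}" for c
    unfolding open_contains_ball
  proof
    fix x assume "x \<in> {x. Q c x}"
    then obtain r where r: "r > 0" "AE y in lborel. y \<in> ball x r \<longrightarrow> F y = c" 
      unfolding Q_def by auto
    have "Q c z" if zb: "z \<in> ball x r" for z
    proof -
      obtain s where s: "s > 0" "ball z s \<subseteq> ball x r" using openE[OF open_ball zb] by metis
      have "AE y in lborel. y \<in> ball z s \<longrightarrow> F y = c" 
        using r(2) by eventually_elim (use s(2) in \<open>simp add: subset_iff\<close>)
      then show ?thesis using s(1) unfolding Q_def by (intro exI[of _ s] conjI)
    qed
    then have "ball x r \<subseteq> {x. Q c x}" by (intro subsetI CollectI)
    then show "\<exists>e>0. ball x e \<subseteq> {x. Q c x}" using r(1) by (intro exI[of _ r] conjI)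
  qed
  obtain x0 where x0: "x0 \<in> U" using False by blast
  obtain c0 where c0: "Q c0 x0" using ex[OF x0] by blast
  define g where "g x = (SOME c. Q c x)" for x
  have g: "Q (g x) x" if "x \<in> U" for x unfolding g_def by (rule someI_ex[OF ex[OF that]])
  have all: "Q c0 x" if x: "x \<in> U" for x
  proof -
    have "g x = g x0"
    proof (rule connected_local_const[OF U(2) x x0], rule ballI)
      fix a assume a: "a \<in> U"
      have "\<forall>\<^sub>F b in nhds a. b \<in> {b. Q (g a) b}"
        by (rule eventually_nhds_in_open[OF Qop]) (simp add: g[OF a])
      then show "\<forall>\<^sub>F b in at a within U. g a = g b"
        unfolding eventually_at_filter
      proof eventually_elim
        case (elim b)
        show ?case using uniq[OF _ g[of b], of "g a"] elim by simp
      qed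
    qed
    moreover have "g x0 = c0" by (rule uniq[OF g[OF x0] c0])
    ultimately show ?thesis using g[OF x] by simp
  qed
  have "AE y in lborel. y \<in> U \<longrightarrow> F y = c0"
  proof (rule AE_open_locally)
    fix x assume "x \<in> U"
    from all[OF this] obtain r where r: "r > 0" "AE y in lborel. y \<in> ball x r \<longrightarrow> F y = c0"
      unfolding Q_def by (elim exE conjE)
    then show "\<exists>T. open T \<and> x \<in> T \<and> (AE y in lborel. y \<in> T \<longrightarrow> F y = c0)"
      by (intro exI[of _ "ball x r"] conjI) simp_all
  qed
  then have "AE y in lborel. y \<in> U \<longrightarrow> f y = c0" using F(2) by eventually_elim auto
  then have "AE x in lebesgue_on U. f x = c0" unfolding AE_lebesgue_on_iff[OF U(1)] .
  then show ?thesis by (rule exI)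
qed

section \<open>Matrices\<close>

lemma norm_matrix_sq: "(norm (A::real^'n::finite^'m::finite))\<^sup>2 = (\<Sum>i\<in>UNIV. \<Sum>j\<in>UNIV. (A $ i $ j)\<^sup>2)"
  unfolding power2_norm_eq_inner inner_vec_def inner_real_def by (simp only: power2_eq_square)

lemma norm_matrix_sq_columns: "(norm (A::real^'n::finite^'m::finite))\<^sup>2 = (\<Sum>j\<in>UNIV. (norm (column j A))\<^sup>2)"
proof -
  have "(norm (column j A))\<^sup>2 = (\<Sum>i\<in>UNIV. (A $ i $ j)\<^sup>2)" for j
    unfolding power2_norm_eq_inner inner_vec_def inner_real_def by (simp add: column_def power2_eq_square)
  then show ?thesis unfolding norm_matrix_sq by (subst sum.swap) simp
qed

text \<open>\<open>norm\<close> is the Frobenius norm here, under which a matrix of operator norm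
  below 1 may have norm above 1. This mixed estimate, obtained column by column, is what makes the
  square-root iteration a contraction.\<close>

lemma norm_matrix_mult_le_op:
  fixes A :: "real^'n::finite^'m::finite" and B :: "real^'p::finite^'n"
  assumes "\<And>v. norm (A *v v) \<le> q * norm v" "q \<ge> 0"
  shows "norm (A ** B) \<le> q * norm B"
proof (rule power2_le_imp_le)
  have "(norm (A ** B))\<^sup>2 = (\<Sum>j\<in>UNIV. (norm (A *v column j B))\<^sup>2)"
    unfolding norm_matrix_sq_columns by (simp flip: matrix_vector_mul_assoc matrix_vector_mult_basis)
  also have "\<dots> \<le> (\<Sum>j\<in>UNIV. (q * norm (column j B))\<^sup>2)"
    by (intro sum_mono power_mono assms(1)) simp
  also have "\<dots> = (q * norm B)\<^sup>2"
    by (simp add: power_mult_distrib norm_matrix_sq_columns[of B] sum_distrib_left)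
  finally show "(norm (A ** B))\<^sup>2 \<le> (q * norm B)\<^sup>2" .
qed (use assms in simp)

lemma norm_matrix_vector_le: "norm (A *v v) \<le> norm A * norm v"
  for A :: "real^'n::finite^'m::finite"
proof (rule power2_le_imp_le)
  have "(norm (A *v v))\<^sup>2 = (\<Sum>i\<in>UNIV. ((A $ i) \<bullet> v)\<^sup>2)"
    unfolding power2_norm_eq_inner inner_vec_def[of "A *v v"] inner_real_def matrix_vector_mul_component
    by (simp only: power2_eq_square)
  also have "\<dots> \<le> (\<Sum>i\<in>UNIV. (norm (A $ i))\<^sup>2 * (norm v)\<^sup>2)"
    by (intro sum_mono) (metis Cauchy_Schwarz_ineq power2_norm_eq_inner)
  also have "\<dots> = (norm A * norm v)\<^sup>2"
    by (simp add: power_mult_distrib sum_distrib_right norm_vec_def[of A] L2_set_def sum_nonneg)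
  finally show "(norm (A *v v))\<^sup>2 \<le> (norm A * norm v)\<^sup>2" .
qed simp

lemma norm_matrix_mult_le: "norm (A ** B) \<le> norm A * norm B"
  for A :: "real^'n::finite^'m::finite" and B :: "real^'p::finite^'n"
  by (rule norm_matrix_mult_le_op[OF norm_matrix_vector_le]) simp

lemma norm_transpose: "norm (transpose A) = norm A" for A :: "real^'n::finite^'m::finite"
proof -
  have "(norm (transpose A))\<^sup>2 = (norm A)\<^sup>2"
    unfolding norm_matrix_sq by (subst sum.swap) (simp add: transpose_def)
  then show ?thesis by simp
qed

lemma transpose_simps:
  "transpose (A + B) = transpose A + transpose B" "transpose (A - B) = transpose A - transpose B"
  "transpose (c *\<^sub>R A) = c *\<^sub>R transpose A" "transpose (- A) = - transpose A" "transpose 0 = 0"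
  for A B :: "real^'n::finite^'m::finite"
  by (simp_all add: transpose_def vec_eq_iff)

lemma matrix_scaleR_mult:
  "(c *\<^sub>R A) ** B = c *\<^sub>R (A ** B)" "A ** (c *\<^sub>R B) = c *\<^sub>R (A ** B)"
  for A :: "real^'n::finite^'m::finite" and B :: "real^'p::finite^'n"
  by (simp_all add: matrix_matrix_mult_def vec_eq_iff sum_distrib_left mult_ac)

lemma matrix_mult_distrib:
  "(A + A') ** B = A ** B + A' ** B" "(A - A') ** B = A ** B - A' ** B"
  "A ** (B + B') = A ** B + A ** B'" "A ** (B - B') = A ** B - A ** B'"
  "(- A) ** B = - (A ** B)" "A ** (- B) = - (A ** B)"
  for A A' :: "real^'n::finite^'m::finite" and B B' :: "real^'p::finite^'n"
  by (simp_all add: matrix_matrix_mult_def vec_eq_iff algebra_simps sum.distrib sum_subtractf sum_negf)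

text \<open>After rescaling, \<open>A = I - B\<close> with \<open>B\<close> of operator norm \<open>q < 1\<close>, and \<open>I - Y\<close> is a
  square root of \<open>A\<close> for the fixed point \<open>Y\<close> of the contraction \<open>Y \<mapsto> (B + Y\<^sup>2) / 2\<close>.\<close>

lemma sqrt_near_identity:
  fixes B :: "real^'n::finite^'n"
  assumes q: "0 \<le> q" "q < 1" and B: "\<And>v. norm (B *v v) \<le> q * norm v" "transpose B = B"
  shows "\<exists>C. sym_posdef C \<and> C ** C = mat 1 - B"
proof -
  define s where "s = {Y::real^'n^'n. transpose Y = Y \<and> (\<forall>v. norm (Y *v v) \<le> q * norm v)}"
  define f where "f Y = (1/2) *\<^sub>R (B + Y ** Y)" for Y
  have "closed s"
  proof -
    have "s = {Y. transpose Y = Y} \<inter> (\<Inter>v. {Y. norm (Y *v v) \<le> q * norm v})" unfolding s_def by auto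
    moreover have "closed {Y::real^'n^'n. transpose Y = Y}"
      by (intro closed_Collect_eq continuous_on_id linear_continuous_on)
        (auto intro!: linearI simp: transpose_simps linear_conv_bounded_linear[symmetric])
    moreover have "closed {Y::real^'n^'n. norm (Y *v v) \<le> q * norm v}" for v
      by (intro closed_Collect_le continuous_intros linear_continuous_on)
        (auto intro!: linearI simp: matrix_vector_mult_add_rdistrib scaleR_matrix_vector_assoc linear_conv_bounded_linear[symmetric])
    ultimately show ?thesis by auto
  qed
  then have "complete s" by (simp add: complete_eq_closed)
  moreover have "0 \<in> s" unfolding s_def using q by (simp add: transpose_simps)
  moreover have "f ` s \<subseteq> s"
  proof
    fix Z assume "Z \<in> f ` s"
    then obtain Y where Y: "Z = f Y" "transpose Y = Y" "\<And>v. norm (Y *v v) \<le> q * norm v" unfolding s_def by auto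
    have "transpose Z = Z" unfolding Y(1) f_def by (simp add: transpose_simps matrix_transpose_mul B Y(2))
    moreover have "norm (Z *v v) \<le> q * norm v" for v
    proof -
      have "norm (Y *v (Y *v v)) \<le> q * (q * norm v)"
        using Y(3)[of "Y *v v"] mult_left_mono[OF Y(3)[of v] q(1)] by linarith
      also have "\<dots> \<le> 1 * (q * norm v)" using q by (intro mult_right_mono) auto
      finally have "norm (B *v v + Y *v (Y *v v)) \<le> 2 * (q * norm v)"
        using norm_triangle_ineq[of "B *v v" "Y *v (Y *v v)"] B(1)[of v] by linarith
      moreover have "Z *v v = (1/2) *\<^sub>R (B *v v + Y *v (Y *v v))"
        unfolding Y(1) f_def by (simp add: scaleR_matrix_vector_assoc[symmetric] matrix_vector_mult_add_rdistrib matrix_vector_mul_assoc)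
      ultimately show ?thesis by simp
    qed
    ultimately show "Z \<in> s" unfolding s_def by simp
  qed
  moreover have "\<forall>Y\<in>s. \<forall>Z\<in>s. dist (f Y) (f Z) \<le> q * dist Y Z"
  proof (intro ballI)
    fix Y Z assume "Y \<in> s" "Z \<in> s"
    then have Y: "\<And>v. norm (Y *v v) \<le> q * norm v" and Z: "transpose Z = Z" "\<And>v. norm (Z *v v) \<le> q * norm v"
      unfolding s_def by auto
    have "norm (Y ** (Y - Z)) \<le> q * norm (Y - Z)" by (rule norm_matrix_mult_le_op[OF Y q(1)])
    moreover have "norm ((Y - Z) ** Z) \<le> q * norm (Y - Z)"
    proof -
      \<comment> \<open>The operator bound applies to a left factor only; transposition moves the
        symmetric \<open>Z\<close> to that side.\<close>
      have "norm ((Y - Z) ** Z) = norm (Z ** transpose (Y - Z))"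
        using norm_transpose[of "(Y - Z) ** Z"] by (simp add: matrix_transpose_mul Z(1))
      also have "\<dots> \<le> q * norm (transpose (Y - Z))" by (rule norm_matrix_mult_le_op[OF Z(2) q(1)])
      finally show ?thesis by (simp add: norm_transpose)
    qed
    moreover have "f Y - f Z = (1/2) *\<^sub>R (Y ** (Y - Z) + (Y - Z) ** Z)"
      unfolding f_def by (simp add: matrix_mult_distrib scaleR_right_diff_distrib[symmetric] scaleR_right_distrib[symmetric])
    ultimately show "dist (f Y) (f Z) \<le> q * dist Y Z"
      using norm_triangle_ineq[of "Y ** (Y - Z)" "(Y - Z) ** Z"] by (simp add: dist_norm)
  qed
  ultimately obtain Y where Y: "Y \<in> s" "f Y = Y"
    using Banach_fix[of s q f] q by blast
  let ?C = "mat 1 - Y"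
  have "?C ** ?C = mat 1 - 2 *\<^sub>R Y + Y ** Y"
    by (simp add: matrix_mult_distrib scaleR_2)
  also have "2 *\<^sub>R Y = B + Y ** Y"
  proof -
    have "2 *\<^sub>R f Y = B + Y ** Y" unfolding f_def by simp
    then show ?thesis by (simp only: Y(2))
  qed
  finally have "?C ** ?C = mat 1 - B" by simp
  moreover have "transpose ?C = ?C" using Y(1) unfolding s_def by (simp add: transpose_simps)
  moreover have "posdef ?C"
    unfolding posdef_def
  proof (intro allI impI)
    fix v :: "real^'n" assume v: "v \<noteq> 0"
    have "v \<bullet> (Y *v v) \<le> norm v * norm (Y *v v)" by (rule norm_cauchy_schwarz)
    also have "\<dots> \<le> norm v * (q * norm v)" using Y(1) unfolding s_def by (intro mult_left_mono) auto
    also have "\<dots> < norm v * norm v" using v q by simp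
    finally show "0 < v \<bullet> (?C *v v)"
      by (simp add: matrix_vector_mult_diff_rdistrib inner_diff_right dot_square_norm power2_eq_square)
  qed
  ultimately show ?thesis unfolding sym_posdef_def by blast
qed

text \<open>Compactness of the sphere gives \<open>l > 0\<close> with
  \<open>l * |v|^2 <= v . A v\<close>, and \<open>|A v| <= K * |v|\<close>. Hence
  \<open>|v - e A v|^2 <= (1 - 2 e l + e^2 K^2) * |v|^2\<close>, so a suitable multiple of
  \<open>A\<close> is close enough to the identity for the iteration.\<close>

lemma sqrt_spd_exists:
  fixes A :: "real^'n::finite^'n"
  assumes A: "sym_posdef A"
  shows "\<exists>C. sym_posdef C \<and> C ** C = A"
proof -
  have cont: "continuous_on (sphere 0 1) (\<lambda>v::real^'n. v \<bullet> (A *v v))"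
    by (intro continuous_intros linear_continuous_on) (simp add: matrix_vector_mul_bounded_linear)
  have "sphere (0::real^'n) 1 \<noteq> {}" by simp
  then obtain u where u: "u \<in> sphere 0 1" "\<And>v. v \<in> sphere 0 1 \<Longrightarrow> u \<bullet> (A *v u) \<le> v \<bullet> (A *v v)"
    using continuous_attains_inf[OF compact_sphere _ cont] by metis
  define l where "l = u \<bullet> (A *v u)"
  have l: "l > 0" using A u(1) unfolding l_def sym_posdef_def posdef_def by (metis mem_sphere_0 norm_zero zero_neq_one)
  have lb: "l * (norm v)\<^sup>2 \<le> v \<bullet> (A *v v)" for v
  proof (cases "v = 0")
    case False
    let ?w = "(1 / norm v) *\<^sub>R v"
    have "l \<le> ?w \<bullet> (A *v ?w)" unfolding l_def using False by (intro u(2)) simp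
    also have "\<dots> = (v \<bullet> (A *v v)) / (norm v)\<^sup>2"
      by (simp add: matrix_vector_mult_scaleR power2_eq_square)
    finally show ?thesis using False by (simp add: field_simps)
  qed simp
  define K where "K = norm A + 1"
  have K: "K > 0" unfolding K_def by (simp add: add_nonneg_pos)
  have Kv: "norm (A *v v) \<le> K * norm v" for v
    using norm_matrix_vector_le[of A v] unfolding K_def by (simp add: distrib_right add_increasing2)
  \<comment> \<open>This \<open>e\<close> minimises \<open>1 - 2 e l + e^2 K^2\<close>; the minimum
    \<open>1 - l^2 / K^2\<close> is the square of the contraction factor, and the
    \<open>max 0\<close> in \<open>q\<close> spares a proof that it is nonnegative.\<close>
  define e where "e = l / K\<^sup>2"
  have e: "e > 0" using l K by (simp add: e_def)
  define q where "q = sqrt (max 0 (1 - l\<^sup>2 / K\<^sup>2))"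
  have q: "0 \<le> q" "q < 1" using l K by (auto simp: q_def real_sqrt_lt_1_iff max_def)
  let ?B = "mat 1 - e *\<^sub>R A"
  have "norm (?B *v v) \<le> q * norm v" for v
  proof (rule power2_le_imp_le)
    have "(norm (?B *v v))\<^sup>2 = (norm v)\<^sup>2 - 2 * e * (v \<bullet> (A *v v)) + e\<^sup>2 * (norm (A *v v))\<^sup>2"
      unfolding power2_norm_eq_inner
      by (simp add: matrix_vector_mult_diff_rdistrib scaleR_matrix_vector_assoc[symmetric] inner_diff_left inner_diff_right inner_commute power2_eq_square algebra_simps)
    also have "\<dots> \<le> (norm v)\<^sup>2 - 2 * e * (l * (norm v)\<^sup>2) + e\<^sup>2 * (K * norm v)\<^sup>2"
      using lb[of v] e Kv[of v] by (intro add_mono diff_mono mult_left_mono power_mono) auto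
    also have "\<dots> = (1 - l\<^sup>2 / K\<^sup>2) * (norm v)\<^sup>2"
      using K by (simp add: e_def field_simps power2_eq_square)
    also have "\<dots> \<le> max 0 (1 - l\<^sup>2 / K\<^sup>2) * (norm v)\<^sup>2" by (intro mult_right_mono) auto
    also have "\<dots> = (q * norm v)\<^sup>2" by (simp add: q_def power_mult_distrib)
    finally show "(norm (?B *v v))\<^sup>2 \<le> (q * norm v)\<^sup>2" .
  qed (use q in simp)
  moreover have "transpose ?B = ?B" using A by (simp add: transpose_simps sym_posdef_def)
  ultimately obtain C where C: "sym_posdef C" "C ** C = mat 1 - ?B" using sqrt_near_identity[OF q] by blast
  let ?D = "(1 / sqrt e) *\<^sub>R C"
  have "?D ** ?D = A" using C(2) e by (simp add: matrix_scaleR_mult flip: power2_eq_square)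
  moreover have "sym_posdef ?D"
    using C(1) e unfolding sym_posdef_def posdef_def by (simp add: transpose_simps scaleR_matrix_vector_assoc[symmetric])
  ultimately show ?thesis by blast
qed

text \<open>For \<open>D = B - C\<close> the equation reads \<open>B D + D C = 0\<close>. Multiplied
  by \<open>D\<close> and traced, it says that a sum of nonnegative terms is zero, namely of the
  values of the forms \<open>B\<close> and \<open>C\<close> on the vectors \<open>D e_i\<close>; so
  all these vectors vanish.\<close>

lemma spd_sqrt_unique:
  fixes B C :: "real^'n::finite^'n"
  assumes B: "sym_posdef B" and C: "sym_posdef C" and eq: "B ** B = C ** C"
  shows "B = C"
proof -
  let ?D = "B - C"
  have nn: "v \<bullet> (X *v v) \<ge> 0" if "sym_posdef X" for X :: "real^'n^'n" and v
    using that unfolding sym_posdef_def posdef_def by (cases "v = 0") (auto intro: less_imp_le)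
  have "transpose ?D = ?D" using B C by (simp add: sym_posdef_def transpose_simps)
  then have sym: "(?D *v u) \<bullet> w = u \<bullet> (?D *v w)" for u w by (metis dot_lmul_matrix transpose_matrix_vector)
  have form: "(\<Sum>i\<in>UNIV. axis i 1 \<bullet> (X *v axis i 1)) = trace X" for X :: "real^'n^'n"
    by (simp add: trace_def inner_axis' matrix_vector_mult_basis column_def)
  have "B ** ?D + ?D ** C = 0" using eq by (simp add: matrix_mult_distrib)
  then have "trace (?D ** (B ** ?D + ?D ** C)) = 0" by (simp add: trace_def)
  then have "trace (?D ** (B ** ?D)) + trace (?D ** (?D ** C)) = 0"
    by (simp add: matrix_mult_distrib(3) trace_add)
  moreover have "trace (?D ** (?D ** C)) = trace (?D ** (C ** ?D))"
    using trace_mul_sym[of ?D "?D ** C"] by (simp add: matrix_mul_assoc)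
  ultimately have "(\<Sum>i\<in>UNIV. (?D *v axis i 1) \<bullet> (B *v (?D *v axis i 1))) + (\<Sum>i\<in>UNIV. (?D *v axis i 1) \<bullet> (C *v (?D *v axis i 1))) = 0"
    unfolding form[symmetric] by (simp add: sym flip: matrix_vector_mul_assoc)
  then have "(\<Sum>i\<in>UNIV. (?D *v axis i 1) \<bullet> (B *v (?D *v axis i 1))) = 0"
    using sum_nonneg[of UNIV "\<lambda>i. (?D *v axis i 1) \<bullet> (B *v (?D *v axis i 1))"]
      sum_nonneg[of UNIV "\<lambda>i. (?D *v axis i 1) \<bullet> (C *v (?D *v axis i 1))"] nn[OF B] nn[OF C] by simp
  then have "\<forall>i\<in>UNIV. (?D *v axis i 1) \<bullet> (B *v (?D *v axis i 1)) = 0"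
    using nn[OF B] by (subst (asm) sum_nonneg_eq_0_iff) auto
  then have "?D *v axis i 1 = 0" for i
    using B unfolding sym_posdef_def posdef_def by (metis UNIV_I less_irrefl)
  then have "column i ?D = 0" for i by (simp add: matrix_vector_mult_basis)
  then have "?D = 0" by (simp add: column_def vec_eq_iff)
  then show ?thesis by simp
qed

lemma sqrt_spd:
  assumes "sym_posdef A" shows "sym_posdef (sqrt_spd A)" "sqrt_spd A ** sqrt_spd A = A"
proof -
  have "\<exists>!B. sym_posdef B \<and> B ** B = A"
    using sqrt_spd_exists[OF assms] spd_sqrt_unique by metis
  from theI'[OF this] show "sym_posdef (sqrt_spd A)" "sqrt_spd A ** sqrt_spd A = A"
    unfolding sqrt_spd_def by auto
qed

lemma matrix_inv_mult:
  assumes "invertible A" shows "A ** matrix_inv A = mat 1" "matrix_inv A ** A = mat 1"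
  using someI_ex[OF assms[unfolded invertible_def]] unfolding matrix_inv_def by auto

lemma posdef_invertible:
  fixes A :: "real^'n::finite^'n" assumes "sym_posdef A" shows "invertible A"
proof -
  have "v = 0" if "A *v v = 0" for v
    using assms that unfolding sym_posdef_def posdef_def by (metis inner_zero_right less_irrefl)
  then show ?thesis using matrix_left_invertible_ker invertible_left_inverse by metis
qed

text \<open>The determinant is the square of that of the positive root, which is invertible.\<close>

lemma det_sym_posdef:
  fixes A :: "real^'n::finite^'n" assumes "sym_posdef A" shows "det A > 0"
proof -
  have "det A = det (sqrt_spd A) * det (sqrt_spd A)" by (metis det_mul sqrt_spd(2)[OF assms])
  moreover have "det (sqrt_spd A) \<noteq> 0"
    using posdef_invertible[OF sqrt_spd(1)[OF assms]] invertible_det_nz by blast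
  ultimately show ?thesis by (auto simp: zero_less_mult_iff linorder_neq_iff)
qed

lemma sym_posdef_nth: "sym_posdef A \<Longrightarrow> A $ i $ j = A $ j $ i"
proof -
  assume "sym_posdef A"
  then have "transpose A $ j $ i = A $ j $ i" by (simp add: sym_posdef_def)
  then show ?thesis by (simp add: transpose_def)
qed

lemma sym_posdef_blk2:
  assumes "sym_posdef A" shows "sym_posdef (blk2 A)"
  unfolding sym_posdef_def posdef_def
proof (intro conjI allI impI)
  show "transpose (blk2 A) = blk2 A" 
    unfolding blk2_def transpose_def vec_eq_iff vec_lambda_beta by (intro allI sym_posdef_nth[OF assms])
  fix v :: "real^2" assume v: "v \<noteq> 0"
  then have "ext3 v \<noteq> 0" by (auto simp: ext3_def vec_eq_iff forall_2 forall_3 vector_3)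
  then have "0 < ext3 v \<bullet> (A *v ext3 v)" using assms unfolding sym_posdef_def posdef_def by blast
  then show "0 < v \<bullet> (blk2 A *v v)"
    by (simp add: ext3_def inner_vec_def sum_2 sum_3 matrix_vector_mult_def blk2_def e23_def vector_3)
qed

lemma trace_sym_posdef:
  fixes A :: "real^'n::finite^'n"
  assumes "sym_posdef A" shows "trace A > 0"
proof -
  have "0 < A $ i $ i" for i
  proof -
    have "axis i (1::real) \<noteq> 0" by (simp add: axis_eq_0_iff)
    then have "0 < axis i 1 \<bullet> (A *v axis i 1)" using assms unfolding sym_posdef_def posdef_def by blast
    then show ?thesis by (simp add: inner_axis' matrix_vector_mult_basis column_def)
  qed
  then show ?thesis unfolding trace_def by (intro sum_pos) auto
qed

lemma msym_simps:
  "msym (A + B) = msym A + msym B" "msym (A - B) = msym A - msym B" "msym (t *\<^sub>R A) = t *\<^sub>R msym A"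
  "transpose (msym A) = msym A" "msym (msym A) = msym A"
  for A B :: "real^'n::finite^'n"
  by (simp_all add: msym_def transpose_def vec_eq_iff field_simps)

lemma msym_of_symmetric: "transpose A = A \<Longrightarrow> msym A = A" for A :: "real^'n::finite^'n"
  by (simp add: msym_def)

section \<open>The quadratic forms\<close>

text \<open>Second-order Taylor expansion by l'Hopital; only first derivatives near 0 and the second
  derivative at 0 itself enter.\<close>

lemma quotient_square_tendsto:
  fixes f f' :: "real \<Rightarrow> real"
  assumes "f 0 = 0" "f' 0 = 0" "\<forall>\<^sub>F t in nhds 0. (f has_real_derivative f' t) (at t)"
    "(f' has_real_derivative L) (at 0)"
  shows "((\<lambda>t. f t / t\<^sup>2) \<longlongrightarrow> L / 2) (at_right 0)"
proof (rule lhopital_right[where f' = f' and g' = "\<lambda>t. 2 * t"])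
  have "isCont f 0" using eventually_nhds_x_imp_x[OF assms(3)] DERIV_isCont by blast
  then show "(f \<longlongrightarrow> 0) (at_right 0)"
    using assms(1) unfolding isCont_def by (metis at_within_le_at tendsto_mono top_greatest)
  show "((\<lambda>t::real. t\<^sup>2) \<longlongrightarrow> 0) (at_right 0)" by (auto intro!: tendsto_eq_intros)
  show "\<forall>\<^sub>F t in at_right 0. t\<^sup>2 \<noteq> (0::real)" "\<forall>\<^sub>F t in at_right 0. 2 * t \<noteq> (0::real)"
    by (auto simp: eventually_at_filter)
  show "\<forall>\<^sub>F t in at_right 0. (f has_real_derivative f' t) (at t)"
    using assms(3) unfolding eventually_at_filter by eventually_elim simp
  show "\<forall>\<^sub>F t in at_right 0. ((\<lambda>t::real. t\<^sup>2) has_real_derivative 2 * t) (at t)"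
    by (auto intro!: always_eventually derivative_eq_intros)
  have "((\<lambda>h. (f' (0 + h) - f' 0) / h) \<longlongrightarrow> L) (at 0)" using assms(4) unfolding DERIV_def .
  then have "((\<lambda>h. f' h / h) \<longlongrightarrow> L) (at_right 0)"
    using assms(2) by (simp add: filterlim_at_split)
  from tendsto_divide[OF this tendsto_const[of 2]]
  show "((\<lambda>t. f' t / (2 * t)) \<longlongrightarrow> L / 2) (at_right 0)" by (simp add: field_simps)
qed

text \<open>Generator \<open>K\<close> of the rotations in the coordinate plane of distinct
  \<open>a\<close> and \<open>b\<close>. Its square is \<open>- P\<close> with
  \<open>P = plane_proj a b\<close>, so its exponential is the explicit matrix
  \<open>1 + sin t K + (cos t - 1) P\<close> used below.\<close>

definition plane_skew :: "3 \<Rightarrow> 3 \<Rightarrow> real^3^3" where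
  "plane_skew a b = (\<chi> i j. if i = a \<and> j = b then 1 else if i = b \<and> j = a then -1 else 0)"

definition plane_proj :: "3 \<Rightarrow> 3 \<Rightarrow> real^3^3" where
  "plane_proj a b = (\<chi> i j. if i = j \<and> (i = a \<or> i = b) then 1 else 0)"

lemma plane_rotation_in_SO3:
  assumes "a \<noteq> b"
  shows "mat 1 + sin t *\<^sub>R plane_skew a b + (cos t - 1) *\<^sub>R plane_proj a b \<in> SO3"
proof -
  have cs: "cos t * cos t + sin t * sin t = 1" by (metis power2_eq_square sin_cos_squared_add2)
  \<comment> \<open>Quantifying over all index pairs reduces the claim to finitely many explicit
    matrices.\<close>
  have "\<forall>a b::3. a \<noteq> b \<longrightarrow> (let R = mat 1 + sin t *\<^sub>R plane_skew a b + (cos t - 1) *\<^sub>R plane_proj a b in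
     transpose R ** R = mat 1 \<and> det R = 1)"
    using cs by (simp add: forall_3 Let_def vec_eq_iff matrix_matrix_mult_def sum_3 transpose_def mat_def
      plane_skew_def plane_proj_def det_3 algebra_simps)
  then show ?thesis using assms unfolding SO3_def Let_def by (simp add: orthogonal_matrix)
qed

lemma skew_nth:
  fixes K :: "real^'n::finite^'n" assumes "transpose K = - K" shows "K $ i $ j = - K $ j $ i"
proof -
  have "transpose K $ j $ i = (- K) $ j $ i" by (simp only: assms)
  then show ?thesis by (simp add: transpose_def)
qed

lemma skew_decompose:
  fixes K :: "real^3^3" assumes "transpose K = - K"
  shows "K = K $ 1 $ 2 *\<^sub>R plane_skew 1 2 + K $ 1 $ 3 *\<^sub>R plane_skew 1 3 + K $ 2 $ 3 *\<^sub>R plane_skew 2 3"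
proof -
  have "K $ i $ i = 0" for i using skew_nth[OF assms, of i i] by simp
  then show ?thesis using skew_nth[OF assms, of 2 1] skew_nth[OF assms, of 3 1] skew_nth[OF assms, of 3 2]
    by (simp add: vec_eq_iff forall_3 plane_skew_def)
qed

lemma norm_SO3_le: "R \<in> SO3 \<Longrightarrow> norm R \<le> 2"
proof -
  assume "R \<in> SO3"
  then have "transpose R ** R = mat 1" by (simp add: SO3_def orthogonal_matrix)
  then have "(transpose R ** R) $ j $ j = 1" for j by (simp add: mat_def)
  then have "(\<Sum>i\<in>UNIV. (R $ i $ j)\<^sup>2) = 1" for j
    by (simp add: matrix_matrix_mult_def transpose_def power2_eq_square)
  then have "(norm R)\<^sup>2 = (\<Sum>j\<in>(UNIV::3 set). 1)"
    unfolding norm_matrix_sq by (subst sum.swap) simp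
  then have "(norm R)\<^sup>2 \<le> 2\<^sup>2" by simp
  then show ?thesis by (rule power2_le_imp_le) simp
qed

lemma mat1_in_SO3: "mat 1 \<in> SO3"
  by (simp add: SO3_def orthogonal_matrix)

text \<open>For a rotation \<open>R\<close> one has
  \<open>A^T A - 1 = A^T (A - R) + (A - R)^T R\<close>, and \<open>|R| <= 2\<close>. For
  \<open>A = 1 + t F\<close> the left side is \<open>2 t\<close> times the symmetric part of
  \<open>F\<close> to first order, which links the distance to \<open>msym F\<close>.\<close>

lemma infdist_SO3_ge: "norm (transpose A ** A - mat 1) / (norm A + 2) \<le> infdist A SO3"
proof -
  have "norm (transpose A ** A - mat 1) / (norm A + 2) \<le> dist A R" if R: "R \<in> SO3" for R
  proof -
    have "transpose R ** R = mat 1" using R by (simp add: SO3_def orthogonal_matrix)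
    then have "transpose A ** A - mat 1 = transpose A ** (A - R) + transpose (A - R) ** R"
      by (simp add: matrix_mult_distrib transpose_simps)
    then have "norm (transpose A ** A - mat 1) \<le> norm (transpose A ** (A - R)) + norm (transpose (A - R) ** R)"
      using norm_triangle_ineq by metis
    also have "\<dots> \<le> norm A * norm (A - R) + norm (A - R) * norm R"
      using norm_matrix_mult_le[of "transpose A" "A - R"] norm_matrix_mult_le[of "transpose (A - R)" R]
      by (simp add: norm_transpose)
    also have "\<dots> \<le> norm A * norm (A - R) + norm (A - R) * 2"
      using norm_SO3_le[OF R] by (intro add_mono mult_left_mono) auto
    finally show ?thesis by (simp add: divide_le_eq add_nonneg_pos dist_norm algebra_simps)
  qed
  moreover have "SO3 \<noteq> {}" using mat1_in_SO3 by blast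
  ultimately show ?thesis by (auto simp: infdist_def intro!: cINF_greatest)
qed

text \<open>Each rotation minimises \<open>W\<close>, so the first derivative vanishes along
  \<open>SO3\<close>; differentiating this along rotations in the coordinate planes kills all skew
  directions. For the lower bound, coercivity along \<open>mat 1 + t *\<^sub>R F\<close> is divided
  by the square of \<open>t\<close>, and \<open>t\<close> tends to 0.\<close>

lemma
  assumes W_zero: "\<And>R. R \<in> SO3 \<Longrightarrow> W R = 0" and c_pos: "c > 0"
    and W_coerc: "\<And>F. ennreal (c * (infdist F SO3)^2) \<le> W F"
    and W_reg: "\<exists>U. open U \<and> SO3 \<subseteq> U \<and> (\<forall>F\<in>U. W F < \<infinity>) \<and> C2_on U (Wr W)"
  shows Q3_lower: "c / 2 * (norm (msym F))\<^sup>2 \<le> Q3 W F"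
    and Q3_skew: "transpose F = - F \<Longrightarrow> Q3 W F = 0"
proof -
  obtain U D D2 where U: "open U" "SO3 \<subseteq> U" "\<And>F. F \<in> U \<Longrightarrow> W F < \<infinity>"
    and D: "\<And>x. x \<in> U \<Longrightarrow> (Wr W has_derivative blinfun_apply (D x)) (at x)"
    and D2: "\<And>x. x \<in> U \<Longrightarrow> (D has_derivative blinfun_apply (D2 x)) (at x)"
    using W_reg unfolding C2_on_def by metis
  have one: "mat 1 \<in> U" using mat1_in_SO3 U(2) by blast
  have W0: "Wr W R = 0" if "R \<in> SO3" for R using W_zero[OF that] by (simp add: Wr_def)
  have Wnn: "0 \<le> Wr W F" for F by (simp add: Wr_def)
  have D0: "D R = 0" if R: "R \<in> SO3" for R
  proof -
    have "blinfun_apply (D R) = (\<lambda>v. 0)"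
      by (rule differential_zero_maxmin[of R U "Wr W"]) (use R U D W0 Wnn in auto)
    then show ?thesis by (simp add: blinfun_eqI)
  qed
  have line: "((\<lambda>t. mat 1 + t *\<^sub>R F) has_vector_derivative F) (at t)" for F :: "real^3^3" and t
    by (auto intro!: derivative_eq_intros)
  have near: "\<forall>\<^sub>F t in nhds 0. mat 1 + t *\<^sub>R F \<in> U" for F :: "real^3^3"
  proof -
    have "open ((\<lambda>t. mat 1 + t *\<^sub>R F) -` U)" by (intro open_vimage U continuous_intros)
    then show ?thesis using one eventually_nhds_in_open[of "(\<lambda>t. mat 1 + t *\<^sub>R F) -` U" 0] by simp
  qed
  let ?f = "\<lambda>F t. Wr W (mat 1 + t *\<^sub>R F)" and ?f' = "\<lambda>F t. blinfun_apply (D (mat 1 + t *\<^sub>R F)) F"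
  have f': "\<forall>\<^sub>F t in nhds 0. (?f F has_real_derivative ?f' F t) (at t)" for F
    using near[of F]
  proof eventually_elim
    case (elim t)
    show ?case
      using vector_derivative_diff_chain_within[OF line has_derivative_at_withinI[OF D[OF elim]]]
      by (simp add: has_real_derivative_iff_has_vector_derivative o_def)
  qed
  have DR: "((\<lambda>t. D (g t)) has_vector_derivative blinfun_apply (D2 (mat 1)) K) (at 0)"
    if g: "(g has_vector_derivative K) (at 0)" "g 0 = mat 1" for g K
    using vector_derivative_diff_chain_within[OF g(1), of D "blinfun_apply (D2 (mat 1))"] D2[OF one] g(2)
    by (simp add: o_def has_derivative_at_withinI)
  have f'': "(?f' F has_real_derivative blinfun_apply (blinfun_apply (D2 (mat 1)) F) F) (at 0)" for F
    using bounded_linear.has_vector_derivative[OF blinfun.bounded_linear_left DR[OF line], of F F]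
    by (simp add: has_real_derivative_iff_has_vector_derivative)
  \<comment> \<open>Near the identity the inner \<open>deriv\<close> is a directional derivative of
    \<open>Wr W\<close>, so the iterated \<open>deriv\<close> in \<open>Q3\<close> is a value of the
    second differential.\<close>
  have Q3: "Q3 W F = blinfun_apply (blinfun_apply (D2 (mat 1)) F) F" for F
  proof -
    have "\<forall>\<^sub>F t in nhds 0. deriv (?f F) t = ?f' F t" using f'[of F] by eventually_elim (rule DERIV_imp_deriv)
    then have "deriv (deriv (?f F)) 0 = deriv (?f' F) 0" by (rule deriv_cong_ev) simp
    then show ?thesis unfolding Q3_def using DERIV_imp_deriv[OF f''[of F]] by simp
  qed
  have plane: "blinfun_apply (D2 (mat 1)) (plane_skew a b) = 0" if ab: "a \<noteq> b" for a b
  proof -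
    let ?R = "\<lambda>t. mat 1 + sin t *\<^sub>R plane_skew a b + (cos t - 1) *\<^sub>R plane_proj a b"
    have "(?R has_vector_derivative (cos 0 *\<^sub>R plane_skew a b + (- sin 0) *\<^sub>R plane_proj a b)) (at 0)"
      by (auto intro!: derivative_eq_intros)
    then have R: "(?R has_vector_derivative plane_skew a b) (at 0)" by simp
    have "((\<lambda>t. D (?R t)) has_vector_derivative blinfun_apply (D2 (mat 1)) (plane_skew a b)) (at 0)"
      by (rule DR[OF R]) simp
    then have "((\<lambda>t::real. 0) has_vector_derivative blinfun_apply (D2 (mat 1)) (plane_skew a b)) (at 0)"
      using D0[OF plane_rotation_in_SO3[OF ab]] by simp
    then show ?thesis using vector_derivative_unique_at[OF _ has_vector_derivative_const] by blast
  qed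
  show "Q3 W F = 0" if "transpose F = - F"
  proof -
    have "blinfun_apply (D2 (mat 1)) F = 0"
      by (subst skew_decompose[OF that]) (simp add: blinfun.add_right blinfun.scaleR_right plane)
    then show ?thesis unfolding Q3 by simp
  qed
  have lim1: "((\<lambda>t. ?f F t / t\<^sup>2) \<longlongrightarrow> Q3 W F / 2) (at_right 0)"
    unfolding Q3 by (rule quotient_square_tendsto[OF _ _ f' f'']) (simp_all add: W0 D0 mat1_in_SO3)
  let ?N = "\<lambda>t. norm (2 *\<^sub>R msym F + t *\<^sub>R (transpose F ** F))"
  have "((\<lambda>t. c * (?N t / (norm (mat 1 + t *\<^sub>R F) + 2))\<^sup>2) \<longlongrightarrow> c * (norm (2 *\<^sub>R msym F + 0 *\<^sub>R (transpose F ** F)) / (norm (mat 1 + 0 *\<^sub>R F) + 2))\<^sup>2) (at_right 0)"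
    by (intro tendsto_intros) (use norm_ge_zero[of "mat 1 + 0 *\<^sub>R F"] in linarith)
  then have lim2: "((\<lambda>t. c * (?N t / (norm (mat 1 + t *\<^sub>R F) + 2))\<^sup>2) \<longlongrightarrow> c * (2 * norm (msym F) / (norm (mat 1 :: real^3^3) + 2))\<^sup>2) (at_right 0)"
    by simp
  have "\<forall>\<^sub>F t in at_right 0. c * (?N t / (norm (mat 1 + t *\<^sub>R F) + 2))\<^sup>2 \<le> ?f F t / t\<^sup>2"
    using near[of F] unfolding eventually_at_filter
  proof eventually_elim
    case (elim t)
    show ?case
    proof (intro impI)
      assume t: "t \<in> {0<..}"
      let ?A = "mat 1 + t *\<^sub>R F"
      have "transpose ?A ** ?A - mat 1 = t *\<^sub>R (2 *\<^sub>R msym F + t *\<^sub>R (transpose F ** F))"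
        by (simp add: msym_def transpose_simps matrix_mult_distrib matrix_scaleR_mult scaleR_add_right)
      then have "t * ?N t / (norm ?A + 2) \<le> infdist ?A SO3"
        using infdist_SO3_ge[of ?A] t by simp
      then have "(t * ?N t / (norm ?A + 2))\<^sup>2 \<le> (infdist ?A SO3)\<^sup>2"
        using t by (intro power_mono) auto
      then have "c * (t * ?N t / (norm ?A + 2))\<^sup>2 \<le> c * (infdist ?A SO3)\<^sup>2" using c_pos by simp
      also have "\<dots> \<le> ?f F t"
      proof -
        have "enn2real (ennreal (c * (infdist ?A SO3)\<^sup>2)) \<le> enn2real (W ?A)"
          using W_coerc[of ?A] U(3)[OF elim] by (intro enn2real_mono) auto
        then show ?thesis using c_pos by (simp add: Wr_def)
      qed
      finally show "c * (?N t / (norm ?A + 2))\<^sup>2 \<le> ?f F t / t\<^sup>2"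
        using t by (simp add: le_divide_eq power_mult_distrib power_divide mult_ac)
    qed
  qed
  from tendsto_le[OF _ lim1 lim2 this]
  have "c * (2 * norm (msym F) / (norm (mat 1 :: real^3^3) + 2))\<^sup>2 \<le> Q3 W F / 2" by simp
  \<comment> \<open>Since \<open>norm (mat 1) + 2\<close> is at most 4, the limit is at least
    \<open>c * (norm (msym F) / 2)^2\<close>; doubling gives the constant
    \<open>c / 2\<close>.\<close>
  moreover have "c / 4 * (norm (msym F))\<^sup>2 \<le> c * (2 * norm (msym F) / (norm (mat 1 :: real^3^3) + 2))\<^sup>2"
  proof -
    have "2 * norm (msym F) / 4 \<le> 2 * norm (msym F) / (norm (mat 1 :: real^3^3) + 2)"
      using norm_SO3_le[OF mat1_in_SO3] by (intro divide_left_mono) (auto intro!: mult_pos_pos add_nonneg_pos)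
    then have "(norm (msym F) / 2)\<^sup>2 \<le> (2 * norm (msym F) / (norm (mat 1 :: real^3^3) + 2))\<^sup>2"
      by (intro power_mono) auto
    from mult_left_mono[OF this, of c] show ?thesis using c_pos by (simp add: power_divide)
  qed
  ultimately show "c / 2 * (norm (msym F))\<^sup>2 \<le> Q3 W F" by linarith
qed

section \<open>The reduced form on in-plane matrices\<close>

definition embed3 :: "real^2^2 \<Rightarrow> real^3^3" where
  "embed3 F = (\<chi> i j. if i = 3 \<or> j = 3 then 0 else F $ (if i = 1 then 1 else 2) $ (if j = 1 then 1 else 2))"

lemma blk2_embed3: "blk2 (embed3 F) = F"
  by (simp add: blk2_def embed3_def e23_def vec_eq_iff forall_2)

lemma embed3_skew: "transpose F = - F \<Longrightarrow> transpose (embed3 F) = - embed3 F"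
proof -
  assume F: "transpose F = - F"
  have "F $ 1 $ 1 = 0" "F $ 2 $ 2 = 0" "F $ 2 $ 1 = - F $ 1 $ 2"
    using skew_nth[OF F, of 1 1] skew_nth[OF F, of 2 2] skew_nth[OF F, of 2 1] by auto
  then show ?thesis by (simp add: embed3_def vec_eq_iff transpose_def forall_3)
qed

lemma norm_blk2_le: "norm (blk2 A) \<le> norm A"
proof (rule power2_le_imp_le)
  show "(norm (blk2 A))\<^sup>2 \<le> (norm A)\<^sup>2"
    unfolding norm_matrix_sq blk2_def by (simp add: sum_2 sum_3 e23_def)
qed simp

lemma msym_eq_0_iff: "msym F = 0 \<longleftrightarrow> transpose F = - F"
  by (auto simp: msym_def add_eq_0_iff)

text \<open>An explicit norm for the root: it makes the weight in the lower bound for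
  \<open>Q2\<close> a visibly measurable function of the point, without studying how
  \<open>sqrt_spd\<close> depends on it.\<close>

lemma norm_sq_sqrt_spd:
  assumes "sym_posdef A" shows "(norm (sqrt_spd A))\<^sup>2 = trace A"
proof -
  have "trace A = trace (transpose (sqrt_spd A) ** sqrt_spd A)"
    using sqrt_spd[OF assms] by (simp add: sym_posdef_def)
  also have "\<dots> = (\<Sum>j\<in>UNIV. \<Sum>i\<in>UNIV. (sqrt_spd A $ i $ j)\<^sup>2)"
    by (simp add: trace_def matrix_matrix_mult_def transpose_def power2_eq_square)
  also have "\<dots> = (norm (sqrt_spd A))\<^sup>2" unfolding norm_matrix_sq by (rule sum.swap)
  finally show ?thesis by simp
qed

text \<open>The congruence by the symmetric \<open>?B\<close> commutes with taking symmetric parts,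
  so \<open>msym Ft = ?A ** ?N ** ?A\<close>, and the squared norm of \<open>?A\<close> is the
  trace. For a skew argument the extension by zero is skew as well, and so is its congruence, which
  attains the value 0.\<close>

lemma
  assumes lower: "\<And>F. k * (norm (msym F))\<^sup>2 \<le> Q3 W F" and skew: "\<And>F. transpose F = - F \<Longrightarrow> Q3 W F = 0"
    and k: "k > 0" and G: "sym_posdef (Gbar G x)"
  shows Q2_lower: "k / (trace (Gbar G x))\<^sup>2 * (norm (msym F))\<^sup>2 \<le> Q2 W G x F"
    and Q2_skew: "msym F = 0 \<Longrightarrow> Q2 W G x F = 0"
proof -
  let ?A = "sqrt_spd (Gbar G x)" and ?B = "matrix_inv (sqrt_spd (Gbar G x))"
  let ?S = "\<lambda>F. {Q3 W (?B ** Ft ** ?B) | Ft. blk2 Ft = F}"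
  have A: "sym_posdef ?A" "?A ** ?A = Gbar G x" using sqrt_spd[OF G] .
  have AB: "?A ** ?B = mat 1" "?B ** ?A = mat 1"
    using matrix_inv_mult[OF posdef_invertible[OF A(1)]] by auto
  have Asym: "transpose ?A = ?A" using A(1) by (simp add: sym_posdef_def)
  have Bsym: "transpose ?B = ?B"
  proof -
    have "transpose ?B ** ?A = mat 1"
      using arg_cong[OF AB(1), of transpose] by (simp add: matrix_transpose_mul Asym transpose_mat)
    then have "transpose ?B ** (?A ** ?B) = mat 1 ** ?B" by (simp add: matrix_mul_assoc)
    then show ?thesis by (simp add: AB)
  qed
  have tr: "trace (Gbar G x) > 0" by (rule trace_sym_posdef[OF G])
  have ne: "?S F \<noteq> {}" for F using blk2_embed3 by blast
  have lb: "k / (trace (Gbar G x))\<^sup>2 * (norm (msym F))\<^sup>2 \<le> s" if "s \<in> ?S F" for s F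
  proof -
    obtain Ft where Ft: "s = Q3 W (?B ** Ft ** ?B)" "blk2 Ft = F" using \<open>s \<in> ?S F\<close> by blast
    let ?N = "msym (?B ** Ft ** ?B)"
    have N: "?N = ?B ** msym Ft ** ?B"
      by (simp add: msym_def matrix_transpose_mul Bsym matrix_mult_distrib matrix_scaleR_mult matrix_mul_assoc)
    have "?A ** ?N ** ?A = (?A ** ?B) ** msym Ft ** (?B ** ?A)" unfolding N by (simp only: matrix_mul_assoc)
    then have eq: "msym Ft = ?A ** ?N ** ?A" by (simp add: AB)
    have "msym F = blk2 (msym Ft)" unfolding Ft(2)[symmetric] by (simp add: msym_def blk2_def vec_eq_iff transpose_def)
    then have "norm (msym F) \<le> norm (?A ** ?N ** ?A)" using norm_blk2_le[of "msym Ft"] eq by metis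
    also have "\<dots> \<le> norm ?A * norm ?N * norm ?A"
      using norm_matrix_mult_le[of "?A ** ?N" ?A] mult_right_mono[OF norm_matrix_mult_le[of ?A ?N], of "norm ?A"] by simp
    also have "\<dots> = trace (Gbar G x) * norm ?N" using norm_sq_sqrt_spd[OF G] by (simp add: power2_eq_square mult_ac)
    finally have "(norm (msym F))\<^sup>2 \<le> (trace (Gbar G x) * norm ?N)\<^sup>2" by (intro power_mono) auto
    then have "(norm (msym F))\<^sup>2 / (trace (Gbar G x))\<^sup>2 \<le> (norm ?N)\<^sup>2" using tr by (simp add: field_simps power_mult_distrib)
    from mult_left_mono[OF this, of k] lower[of "?B ** Ft ** ?B"] show ?thesis using k Ft(1) by simp
  qed
  show "k / (trace (Gbar G x))\<^sup>2 * (norm (msym F))\<^sup>2 \<le> Q2 W G x F"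
    unfolding Q2_def by (rule cInf_greatest[OF ne lb])
  show "Q2 W G x F = 0" if "msym F = 0"
  proof (rule antisym)
    have "transpose (?B ** embed3 F ** ?B) = - (?B ** embed3 F ** ?B)"
      using embed3_skew[of F] that unfolding msym_eq_0_iff
      by (simp add: matrix_transpose_mul Bsym matrix_mult_distrib matrix_mul_assoc)
    then have "Q3 W (?B ** embed3 F ** ?B) = 0" by (rule skew)
    then have "0 \<in> ?S F" using blk2_embed3[of F] by force
    moreover have "bdd_below (?S F)" using lb by (rule bdd_belowI)
    ultimately show "Q2 W G x F \<le> 0" unfolding Q2_def by (rule cInf_lower)
    show "0 \<le> Q2 W G x F" unfolding Q2_def using lb[of _ F] that by (intro cInf_greatest[OF ne]) simp
  qed
qed

section \<open>The frame along the midplate\<close>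

lemma smooth_bdd_det:
  assumes "open S" "\<And>i j. smooth_bdd S (\<lambda>x. A x $ i $ j)"
  shows "smooth_bdd S (\<lambda>x. det (A x :: real^'m::finite^'m))"
  unfolding det_def by (intro smooth_bdd_sum smooth_bdd_mult smooth_bdd_prod smooth_bdd_const assms)

text \<open>Cramer's rule writes each entry of the inverse as a quotient of determinants, which are
  polynomials in the entries; the lower bound controls the denominator.\<close>

lemma smooth_bdd_matrix_inv:
  fixes A :: "real^'n::finite \<Rightarrow> real^'m::finite^'m"
  assumes S: "open S" and A: "\<And>i j. smooth_bdd S (\<lambda>x. A x $ i $ j)" and d: "d > 0" "\<And>x. x \<in> S \<Longrightarrow> d \<le> \<bar>det (A x)\<bar>"
  shows "smooth_bdd S (\<lambda>x. matrix_inv (A x) $ i $ j)"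
proof -
  let ?C = "\<lambda>x. \<chi> r s. if s = i then axis j 1 $ r else A x $ r $ s"
  have C: "smooth_bdd S (\<lambda>x. ?C x $ r $ s)" for r s
    by (cases "s = i") (simp_all add: smooth_bdd_const[OF S] A)
  have "smooth_bdd S (\<lambda>x. det (?C x) * inverse (det (A x)))"
    by (rule smooth_bdd_mult[OF S smooth_bdd_det[OF S C] smooth_bdd_inverse[OF S smooth_bdd_det[OF S A] d]])
  moreover have "det (?C x) * inverse (det (A x)) = matrix_inv (A x) $ i $ j" if x: "x \<in> S" for x
  proof -
    have nz: "det (A x) \<noteq> 0" using d(1) d(2)[OF x] by auto
    then have "A x ** matrix_inv (A x) = mat 1" using matrix_inv_mult invertible_det_nz by blast
    then have "A x *v (matrix_inv (A x) *v axis j 1) = axis j 1" by (simp add: matrix_vector_mul_assoc)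
    then have "matrix_inv (A x) *v axis j 1 = (\<chi> k. det (\<chi> r s. if s = k then axis j 1 $ r else A x $ r $ s) / det (A x))"
      using cramer[OF nz] by blast
    then have "(matrix_inv (A x) *v axis j 1) $ i = det (?C x) / det (A x)" by simp
    then show ?thesis by (simp add: matrix_vector_mult_basis column_def divide_inverse)
  qed
  ultimately show ?thesis by (rule smooth_bdd_cong_open[OF S, rotated])
qed

lemma smooth_bdd_inner:
  fixes f g :: "real^'n::finite \<Rightarrow> real^'m::finite"
  assumes "open S" "\<And>j. smooth_bdd S (\<lambda>x. f x $ j)" "\<And>j. smooth_bdd S (\<lambda>x. g x $ j)"
  shows "smooth_bdd S (\<lambda>x. f x \<bullet> g x)"
  unfolding inner_vec_def inner_real_def by (intro smooth_bdd_sum smooth_bdd_mult assms)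

lemma smooth_field_has_pd:
  fixes f :: "real^'n::finite \<Rightarrow> real^'m::finite"
  assumes "\<And>j. smooth_bdd S (\<lambda>x. f x $ j)" "x \<in> S"
  shows "has_pd k f x (pd k f x)" "pd k f x $ j = pd k (\<lambda>x. f x $ j) x"
proof -
  have *: "has_pd k f x (\<chi> j. pd k (\<lambda>x. f x $ j) x)"
    unfolding has_pd_vec_nth_iff using smooth_bdd_has_pd[OF assms(1,2)] by simp
  show "has_pd k f x (pd k f x)" "pd k f x $ j = pd k (\<lambda>x. f x $ j) x"
    using * has_pd_imp_pd[OF *] by simp_all
qed

lemma smooth_field_pd:
  fixes f :: "real^'n::finite \<Rightarrow> real^'m::finite"
  assumes "open S" "\<And>j. smooth_bdd S (\<lambda>x. f x $ j)"
  shows "smooth_bdd S (\<lambda>x. pd k f x $ j)"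
  by (rule smooth_bdd_cong_open[OF assms(1) _ smooth_bdd_pd[OF assms(2)]])
    (rule smooth_field_has_pd(2)[OF assms(2), symmetric])

lemma pt_nth: "pt x t $ 1 = x $ 1" "pt x t $ 2 = x $ 2" "pt x t $ 3 = t"
  by (simp_all add: pt_def)

lemma xy_pt: "xy (pt x t) = x"
  by (simp add: xy_def pt_nth vec_eq_iff forall_2)

lemma e23_simps: "e23 1 = 1" "e23 2 = 2"
  by (simp_all add: e23_def)

lemma pt_shift: "pt (x + t *\<^sub>R axis i 1) 0 = pt x 0 + t *\<^sub>R axis (e23 i) 1"
  using exhaust_2[of i] by (auto simp: vec_eq_iff forall_3 pt_nth axis_def e23_simps)

lemma continuous_on_pt: "continuous_on S (\<lambda>x. pt x 0)"
proof -
  have "pt x 0 = x $ 1 *\<^sub>R axis 1 1 + x $ 2 *\<^sub>R axis 2 1" for x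
    by (simp add: vec_eq_iff forall_3 pt_nth axis_def)
  then show ?thesis by (simp add: continuous_intros)
qed

section \<open>The midplate and the frame along it\<close>

locale plate =
  fixes \<omega> :: "(real^2) set" and G :: "real^3 \<Rightarrow> real^3^3" and y0 :: "real^2 \<Rightarrow> real^3"
  assumes om_open: "open \<omega>" and om_bdd: "bounded \<omega>"
    and G_smooth: "smooth_closure (Omega_h \<omega> 1) G"
    and G_spd: "\<And>x. x \<in> closure (Omega_h \<omega> 1) \<Longrightarrow> sym_posdef (G x)"
    and y0_smooth: "smooth_closure \<omega> y0"
    and y0_metric: "\<And>x'. x' \<in> \<omega> \<Longrightarrow> transpose (cgrad y0 x') ** cgrad y0 x' = blk2 (Gbar G x')"
begin

abbreviation "Om \<equiv> Omega_h \<omega> 1"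
abbreviation "b \<equiv> b0 G y0"
abbreviation "d \<equiv> d0 G y0"

lemma Om_open: "open Om"
proof -
  have c: "continuous_on UNIV xy"
  proof -
    have "xy x = x $ 1 *\<^sub>R axis 1 1 + x $ 2 *\<^sub>R axis 2 1" for x
      by (simp add: vec_eq_iff forall_2 xy_def axis_def)
    then show ?thesis by (simp add: continuous_intros)
  qed
  have "Om = xy -` \<omega> \<inter> {x. \<bar>x $ 3\<bar> < 1 / 2}" by (auto simp: Omega_h_def)
  moreover have "open (xy -` \<omega>)" by (rule open_vimage[OF om_open c])
  moreover have "open {x::real^3. \<bar>x $ 3\<bar> < 1 / 2}" by (intro open_Collect_less continuous_intros)
  ultimately show ?thesis by auto
qed

lemma Om_bdd: "bounded Om"
proof -
  obtain B where B: "\<And>x. x \<in> \<omega> \<Longrightarrow> norm x \<le> B" using om_bdd unfolding bounded_iff by blast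
  have "norm x \<le> 2 * B + 1" if x: "x \<in> Om" for x
  proof -
    have "\<bar>xy x $ 1\<bar> \<le> B" "\<bar>xy x $ 2\<bar> \<le> B" "\<bar>x $ 3\<bar> < 1/2"
      using x B[of "xy x"] component_le_norm_cart[of "xy x" 1] component_le_norm_cart[of "xy x" 2]
      by (auto simp: Omega_h_def)
    moreover have "xy x $ 1 = x $ 1" "xy x $ 2 = x $ 2" by (simp_all add: xy_def)
    ultimately show ?thesis using norm_le_l1_cart[of x] by (simp add: sum_3)
  qed
  then show ?thesis unfolding bounded_iff by blast
qed

lemma pt_in_Om: "x \<in> \<omega> \<Longrightarrow> pt x 0 \<in> Om"
  by (simp add: Omega_h_def xy_pt pt_nth)

lemma pt_in_closure: "x \<in> closure \<omega> \<Longrightarrow> pt x 0 \<in> closure Om"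
  using image_closure_subset[OF continuous_on_pt closed_closure, of \<omega> Om] pt_in_Om closure_subset[of Om] by blast

lemma Gbar_spd: "x \<in> closure \<omega> \<Longrightarrow> sym_posdef (Gbar G x)"
  unfolding Gbar_def by (rule G_spd[OF pt_in_closure])

text \<open>In-plane derivatives commute with restriction to the midplate, so the traces of
  \<open>smooth_bdd\<close> functions form a family closed under partial derivatives.\<close>

lemma smooth_bdd_restrict:
  assumes g: "smooth_bdd Om g"
  shows "smooth_bdd \<omega> (\<lambda>x. g (pt x 0))"
    and "x \<in> \<omega> \<Longrightarrow> pd i (\<lambda>x. g (pt x 0)) x = pd (e23 i) g (pt x 0)"
proof -
  have d: "has_pd i (\<lambda>x. h (pt x 0)) x (pd (e23 i) h (pt x 0))" if "smooth_bdd Om h" "x \<in> \<omega>" for h i x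
    using smooth_bdd_has_pd[OF that(1) pt_in_Om[OF that(2)], of "e23 i"] unfolding has_pd_def pt_shift .
  let ?C = "{\<lambda>x. h (pt x 0) | h. smooth_bdd Om h}"
  have C: "\<And>f. f \<in> ?C \<Longrightarrow> continuous_on \<omega> f"
    "\<And>f i. f \<in> ?C \<Longrightarrow> \<exists>f'\<in>?C. \<forall>x\<in>\<omega>. has_pd i f x (f' x)" "(\<lambda>x. g (pt x 0)) \<in> ?C"
  proof -
    fix f i assume "f \<in> ?C"
    then obtain h where h: "smooth_bdd Om h" "f = (\<lambda>x. h (pt x 0))" by blast
    show "continuous_on \<omega> f"
      unfolding h(2) by (rule continuous_on_compose2[OF smooth_bdd_continuous[OF h(1)] continuous_on_pt])
        (use pt_in_Om in blast)
    show "\<exists>f'\<in>?C. \<forall>x\<in>\<omega>. has_pd i f x (f' x)"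
    proof (rule bexI[of _ "\<lambda>x. pd (e23 i) h (pt x 0)"])
      show "\<forall>x\<in>\<omega>. has_pd i f x (pd (e23 i) h (pt x 0))" unfolding h(2) using d[OF h(1)] by blast
      show "(\<lambda>x. pd (e23 i) h (pt x 0)) \<in> ?C" using smooth_bdd_pd[OF h(1)] by blast
    qed
  qed (use g in blast)
  show "smooth_bdd \<omega> (\<lambda>x. g (pt x 0))"
    unfolding smooth_bdd_def
  proof (intro conjI allI)
    show "smooth_on \<omega> (\<lambda>x. g (pt x 0))" by (rule pd_closed_family_smooth[OF om_open C])
    fix "is"
    have "\<exists>f'\<in>?C. \<forall>x\<in>\<omega>. pds is (\<lambda>x. g (pt x 0)) x = f' x"
      by (rule pd_closed_family_pds[OF om_open C])
    then obtain f' where f': "f' \<in> ?C" "\<forall>x\<in>\<omega>. pds is (\<lambda>x. g (pt x 0)) x = f' x" by (elim bexE)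
    obtain h where h: "smooth_bdd Om h" "f' = (\<lambda>x. h (pt x 0))" using f'(1) by blast
    have "pds is (\<lambda>x. g (pt x 0)) ` \<omega> \<subseteq> h ` Om" using f' h(2) pt_in_Om by auto
    then show "bounded (pds is (\<lambda>x. g (pt x 0)) ` \<omega>)" using smooth_bdd_bounded[OF h(1)] bounded_subset by blast
  qed
  show "x \<in> \<omega> \<Longrightarrow> pd i (\<lambda>x. g (pt x 0)) x = pd (e23 i) g (pt x 0)"
    by (rule has_pd_imp_pd[OF d[OF g]])
qed

lemma G_entry: "smooth_bdd Om (\<lambda>z. G z $ m $ k)"
  by (rule smooth_closure_imp_smooth_bdd[OF Om_open Om_bdd G_smooth])
    (intro bounded_linear_compose[OF bounded_linear_vec_nth bounded_linear_vec_nth])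

lemma pds_G_entry: "z \<in> Om \<Longrightarrow> pds js G z $ m $ k = pds js (\<lambda>z. G z $ m $ k) z"
  using pds_bounded_linear[OF Om_open _ bounded_linear_compose[OF bounded_linear_vec_nth bounded_linear_vec_nth], of G z js m k]
    G_smooth unfolding smooth_closure_def by simp

lemma pds_G_smooth: "smooth_bdd Om (\<lambda>z. pds js G z $ m $ k)"
  by (rule smooth_bdd_cong_open[OF Om_open _ smooth_bdd_pds[OF G_entry]]) (rule pds_G_entry[symmetric])

lemma pds_G_pt_smooth: "smooth_bdd \<omega> (\<lambda>x. pds js G (pt x 0) $ m $ k)"
  by (rule smooth_bdd_restrict(1)[OF pds_G_smooth])

lemma pd_G_pt:
  assumes "x \<in> \<omega>"
  shows "pd i (\<lambda>x. pds js G (pt x 0) $ m $ k) x = pds (e23 i # js) G (pt x 0) $ m $ k"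
proof -
  have "pd i (\<lambda>x. pds js G (pt x 0) $ m $ k) x = pd (e23 i) (\<lambda>z. pds js G z $ m $ k) (pt x 0)"
    by (rule smooth_bdd_restrict(2)[OF pds_G_smooth assms])
  also have "\<dots> = pd (e23 i) (pds js (\<lambda>z. G z $ m $ k)) (pt x 0)"
    by (rule pd_cong_open[OF Om_open pt_in_Om[OF assms]]) (rule pds_G_entry)
  also have "\<dots> = pds (e23 i # js) G (pt x 0) $ m $ k"
    using pds_G_entry[OF pt_in_Om[OF assms], of "e23 i # js"] by simp
  finally show ?thesis .
qed

lemma pds_G_sym:
  assumes "x \<in> \<omega>" shows "pds js G (pt x 0) $ m $ k = pds js G (pt x 0) $ k $ m"
proof -
  have "pds js (\<lambda>z. G z $ m $ k) (pt x 0) = pds js (\<lambda>z. G z $ k $ m) (pt x 0)"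
    by (rule pds_cong_open[OF Om_open _ pt_in_Om[OF assms]])
      (rule sym_posdef_nth[OF G_spd], use closure_subset in blast)
  then show ?thesis using pds_G_entry[OF pt_in_Om[OF assms]] by simp
qed

lemma pds_G_swap:
  assumes "x \<in> \<omega>" shows "pds [i, j] G (pt x 0) $ m $ k = pds [j, i] G (pt x 0) $ m $ k"
  unfolding pds_G_entry[OF pt_in_Om[OF assms]]
  by (rule pds_swap[OF Om_open _ pt_in_Om[OF assms]]) (use G_entry in \<open>simp add: smooth_bdd_def\<close>)

lemma y0_nth: "smooth_bdd \<omega> (\<lambda>x. y0 x $ j)"
  by (rule smooth_closure_imp_smooth_bdd[OF om_open om_bdd y0_smooth bounded_linear_vec_nth])

lemma dy0_nth: "smooth_bdd \<omega> (\<lambda>x. pd k y0 x $ j)"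
  by (rule smooth_field_pd[OF om_open y0_nth])

lemma Gbar_nth: "smooth_bdd \<omega> (\<lambda>x. Gbar G x $ m $ k)"
  using pds_G_pt_smooth[of "[]" m k] by (simp add: Gbar_def)

lemma blk2_Gbar_nth: "smooth_bdd \<omega> (\<lambda>x. blk2 (Gbar G x) $ i $ j)"
  using Gbar_nth[of "e23 i" "e23 j"] by (simp add: blk2_def)

lemma metric_inner: "x \<in> \<omega> \<Longrightarrow> pd i y0 x \<bullet> pd j y0 x = Gbar G x $ e23 i $ e23 j"
proof -
  assume x: "x \<in> \<omega>"
  have "(transpose (cgrad y0 x) ** cgrad y0 x) $ i $ j = blk2 (Gbar G x) $ i $ j" using y0_metric[OF x] by simp
  then show ?thesis
    by (simp add: matrix_matrix_mult_def transpose_def cgrad_def blk2_def inner_vec_def)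
qed

lemma closure_lower_bound:
  fixes g :: "real^2 \<Rightarrow> real"
  assumes "continuous_on (closure \<omega>) g" "\<And>x. x \<in> closure \<omega> \<Longrightarrow> g x > 0"
  obtains e where "e > 0" "\<And>x. x \<in> \<omega> \<Longrightarrow> e \<le> g x"
proof (cases "\<omega> = {}")
  case True
  then show ?thesis using that[of 1] by simp
next
  case False
  have "compact (closure \<omega>)" using om_bdd by (simp add: compact_closure)
  then obtain u where u: "u \<in> closure \<omega>" "\<And>x. x \<in> closure \<omega> \<Longrightarrow> g u \<le> g x"
    using continuous_attains_inf[OF _ _ assms(1)] False by auto
  show ?thesis by (rule that[of "g u"]) (use u assms(2) closure_subset in auto)
qed

lemma Gbar_continuous: "continuous_on (closure \<omega>) (\<lambda>x. Gbar G x $ m $ k)"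
proof -
  have "continuous_on (closure Om) G" using G_smooth unfolding smooth_closure_def by blast
  then have "continuous_on (closure \<omega>) (\<lambda>x. G (pt x 0))"
    by (rule continuous_on_compose2[OF _ continuous_on_pt]) (use pt_in_closure in blast)
  then show ?thesis unfolding Gbar_def by (intro continuous_intros)
qed

text \<open>Positive definiteness up to the boundary and compactness give one bound for the whole
  midplate; the inverses and roots in \<open>b\<close> and the inverse of \<open>Q0\<close> stay
  \<open>smooth_bdd\<close> because of it.\<close>

lemma det_lower_bounds:
  obtains e where "e > 0" "\<And>x. x \<in> \<omega> \<Longrightarrow> e \<le> det (Gbar G x)" "\<And>x. x \<in> \<omega> \<Longrightarrow> e \<le> det (blk2 (Gbar G x))"
proof -
  have c: "continuous_on (closure \<omega>) (\<lambda>x. det (Gbar G x))" "continuous_on (closure \<omega>) (\<lambda>x. det (blk2 (Gbar G x)))"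
    unfolding det_3 det_2 blk2_def vec_lambda_beta 
    by (intro continuous_on_add continuous_on_diff continuous_on_mult Gbar_continuous)+
  obtain e1 where e1: "e1 > 0" "\<And>x. x \<in> \<omega> \<Longrightarrow> e1 \<le> det (Gbar G x)"
    using closure_lower_bound[OF c(1) det_sym_posdef[OF Gbar_spd]] by metis
  obtain e2 where e2: "e2 > 0" "\<And>x. x \<in> \<omega> \<Longrightarrow> e2 \<le> det (blk2 (Gbar G x))"
    using closure_lower_bound[OF c(2) det_sym_posdef[OF sym_posdef_blk2[OF Gbar_spd]]] by metis
  show ?thesis by (rule that[of "min e1 e2"]) (use e1 e2 in \<open>auto intro: min.coboundedI1 min.coboundedI2\<close>)
qed

text \<open>Lagrange's identity, with the Gram matrix of the tangent vectors given by the
  metric.\<close>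

lemma norm_cross_dy0: "x \<in> \<omega> \<Longrightarrow> (norm (cross3 (pd 1 y0 x) (pd 2 y0 x)))\<^sup>2 = det (blk2 (Gbar G x))"
proof -
  assume x: "x \<in> \<omega>"
  have "(norm (cross3 (pd 1 y0 x) (pd 2 y0 x)))\<^sup>2 = (norm (pd 1 y0 x))\<^sup>2 * (norm (pd 2 y0 x))\<^sup>2 - (pd 1 y0 x \<bullet> pd 2 y0 x)\<^sup>2"
    using norm_cross_dot[of "pd 1 y0 x" "pd 2 y0 x"] by (simp add: power_mult_distrib)
  also have "\<dots> = det (blk2 (Gbar G x))"
    unfolding power2_norm_eq_inner det_2 blk2_def vec_lambda_beta metric_inner[OF x, symmetric]
    by (simp add: power2_eq_square inner_commute)
  finally show ?thesis .
qed

text \<open>The norm of the cross product is replaced by the root of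
  \<open>det (blk2 (Gbar G x))\<close>; then only sums, products, and inverses and roots of
  functions bounded away from 0 remain.\<close>

lemma b_nth: "smooth_bdd \<omega> (\<lambda>x. b x $ j)"
proof -
  obtain e where e: "e > 0" "\<And>x. x \<in> \<omega> \<Longrightarrow> e \<le> det (Gbar G x)" "\<And>x. x \<in> \<omega> \<Longrightarrow> e \<le> det (blk2 (Gbar G x))"
    using det_lower_bounds by metis
  have dG: "smooth_bdd \<omega> (\<lambda>x. det (Gbar G x))" by (rule smooth_bdd_det[OF om_open Gbar_nth])
  have dB: "smooth_bdd \<omega> (\<lambda>x. det (blk2 (Gbar G x)))" by (rule smooth_bdd_det[OF om_open blk2_Gbar_nth])
  have iB: "smooth_bdd \<omega> (\<lambda>x. inverse (det (blk2 (Gbar G x))))"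
    by (rule smooth_bdd_inverse[OF om_open dB e(1)]) (use e(3) in force)
  obtain M where M: "\<And>x. x \<in> \<omega> \<Longrightarrow> norm (det (blk2 (Gbar G x))) \<le> M"
    using smooth_bdd_bounded[OF dB] unfolding bounded_iff by auto
  have quot: "smooth_bdd \<omega> (\<lambda>x. sqrt (det (Gbar G x) * inverse (det (blk2 (Gbar G x)))))"
  proof (rule smooth_bdd_sqrt[OF om_open smooth_bdd_mult[OF om_open dG iB]])
    \<comment> \<open>The quotient under the root has numerator at least \<open>e\<close> and
      denominator at most \<open>\<bar>M\<bar> + 1\<close>.\<close>
    show "0 < e / (\<bar>M\<bar> + 1)" using e(1) by (intro divide_pos_pos) auto
    fix x assume x: "x \<in> \<omega>"
    have D: "0 < det (blk2 (Gbar G x))" "det (blk2 (Gbar G x)) \<le> \<bar>M\<bar> + 1" using e(1) e(3)[OF x] M[OF x] by auto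
    have "e * inverse (\<bar>M\<bar> + 1) \<le> det (Gbar G x) * inverse (det (blk2 (Gbar G x)))"
      using e(1) e(2)[OF x] D by (intro mult_mono le_imp_inverse_le) auto
    then show "e / (\<bar>M\<bar> + 1) \<le> det (Gbar G x) * inverse (det (blk2 (Gbar G x)))" by (simp add: divide_inverse)
  qed
  have sq: "smooth_bdd \<omega> (\<lambda>x. sqrt (det (blk2 (Gbar G x))))" by (rule smooth_bdd_sqrt[OF om_open dB e(1,3)])
  have isq: "smooth_bdd \<omega> (\<lambda>x. inverse (sqrt (det (blk2 (Gbar G x)))))"
  proof (rule smooth_bdd_inverse[OF om_open sq, of "sqrt e"])
    fix x assume "x \<in> \<omega>"
    then show "sqrt e \<le> \<bar>sqrt (det (blk2 (Gbar G x)))\<bar>"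
      using real_sqrt_le_mono[OF e(3)] abs_ge_self order_trans by blast
  qed (use e in simp)
  have inv: "smooth_bdd \<omega> (\<lambda>x. matrix_inv (blk2 (Gbar G x)) $ i $ k)" for i k
    by (rule smooth_bdd_matrix_inv[OF om_open blk2_Gbar_nth e(1)]) (use e(3) in force)
  let ?g = "\<lambda>x. (vector [Gbar G x $ 1 $ 3, Gbar G x $ 2 $ 3] :: real^2)"
  have g: "smooth_bdd \<omega> (\<lambda>x. ?g x $ i)" for i
    using exhaust_2[of i] by (auto simp: Gbar_nth)
  have cr: "smooth_bdd \<omega> (\<lambda>x. cross3 (pd 1 y0 x) (pd 2 y0 x) $ j)"
    using exhaust_3[of j] by (auto simp: cross3_def intro!: smooth_bdd_diff smooth_bdd_mult om_open dy0_nth)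
  let ?h = "\<lambda>x. (\<Sum>k\<in>UNIV. pd k y0 x $ j * (\<Sum>i\<in>UNIV. matrix_inv (blk2 (Gbar G x)) $ k $ i * ?g x $ i))
     + sqrt (det (Gbar G x) * inverse (det (blk2 (Gbar G x)))) * (inverse (sqrt (det (blk2 (Gbar G x)))) * cross3 (pd 1 y0 x) (pd 2 y0 x) $ j)"
  have "smooth_bdd \<omega> ?h"
    by (intro smooth_bdd_add smooth_bdd_mult smooth_bdd_sum om_open dy0_nth inv g quot isq cr)
  moreover have "?h x = b x $ j" if x: "x \<in> \<omega>" for x
  proof -
    have "norm (cross3 (pd 1 y0 x) (pd 2 y0 x)) = sqrt (det (blk2 (Gbar G x)))"
      by (simp add: norm_cross_dy0[OF x, symmetric])
    then show ?thesis
      unfolding b0_def by (simp add: matrix_vector_mult_def cgrad_def divide_inverse)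
  qed
  ultimately show ?thesis by (rule smooth_bdd_cong_open[OF om_open, rotated])
qed

text \<open>The columns of \<open>Q0\<close> as a family, two tangent vectors and the transversal
  \<open>b\<close>, so that vectors along the surface can be indexed like the entries of
  \<open>G\<close>.\<close>

definition X :: "3 \<Rightarrow> real^2 \<Rightarrow> real^3" where
  "X a x = (if a = 1 then pd 1 y0 x else if a = 2 then pd 2 y0 x else b x)"

lemma X_simps: "X 1 = pd 1 y0" "X 2 = pd 2 y0" "X 3 = b" "X (e23 i) = pd i y0"
  using exhaust_2[of i] by (auto simp: X_def fun_eq_iff e23_simps)

lemma X_nth: "smooth_bdd \<omega> (\<lambda>x. X a x $ j)"
  using exhaust_3[of a] by (auto simp: X_simps dy0_nth b_nth)

text \<open>The tangential coefficients \<open>a\<close> solve \<open>?B *v a = ?g\<close>, which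
  fixes the products with the tangent vectors. The squared normal coefficient is
  \<open>det (Gbar G x) / det ?B\<close>, the Schur complement of the in-plane block, which is
  exactly what the tangential part lacks in squared length.\<close>

lemma b_gram:
  assumes x: "x \<in> \<omega>"
  shows "pd i y0 x \<bullet> b x = Gbar G x $ e23 i $ 3" "b x \<bullet> b x = Gbar G x $ 3 $ 3"
proof -
  have spd: "sym_posdef (Gbar G x)" using Gbar_spd x closure_subset by blast
  let ?B = "blk2 (Gbar G x)" and ?g = "vector [Gbar G x $ 1 $ 3, Gbar G x $ 2 $ 3] :: real^2"
  let ?n = "cross3 (pd 1 y0 x) (pd 2 y0 x)"
  define a where "a = matrix_inv ?B *v ?g"
  define s where "s = sqrt (det (Gbar G x) / det ?B)"
  have dB: "det ?B > 0" by (rule det_sym_posdef[OF sym_posdef_blk2[OF spd]])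
  have dG: "det (Gbar G x) > 0" by (rule det_sym_posdef[OF spd])
  have Ba: "?B *v a = ?g"
    unfolding a_def matrix_vector_mul_assoc
    using matrix_inv_mult(1)[OF posdef_invertible[OF sym_posdef_blk2[OF spd]]] by simp
  have bx: "b x = a $ 1 *\<^sub>R pd 1 y0 x + a $ 2 *\<^sub>R pd 2 y0 x + (s / norm ?n) *\<^sub>R ?n"
    unfolding b0_def a_def[symmetric] s_def[symmetric]
    by (simp add: vec_eq_iff matrix_vector_mult_def cgrad_def sum_2 mult.commute)
  have n0: "pd i y0 x \<bullet> ?n = 0" for i using exhaust_2[of i] by (auto simp: dot_cross_self)
  have nn: "?n \<bullet> ?n = det ?B" using norm_cross_dy0[OF x] by (simp add: power2_norm_eq_inner)
  have g: "Gbar G x $ e23 i $ 3 = a $ 1 * (pd i y0 x \<bullet> pd 1 y0 x) + a $ 2 * (pd i y0 x \<bullet> pd 2 y0 x)" for i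
  proof -
    have "(?B *v a) $ i = ?g $ i" by (simp add: Ba)
    then show ?thesis using exhaust_2[of i]
      by (auto simp: matrix_vector_mult_def sum_2 blk2_def metric_inner[OF x] e23_simps mult.commute)
  qed
  show i3: "pd i y0 x \<bullet> b x = Gbar G x $ e23 i $ 3" for i
    unfolding bx g by (simp add: inner_add_right n0)
  have s2: "(s / norm ?n) * (s / norm ?n) * det ?B = det (Gbar G x) / det ?B"
  proof -
    have "s * s = det (Gbar G x) / det ?B" unfolding s_def using dB dG by (simp flip: power2_eq_square)
    moreover have "norm ?n * norm ?n = det ?B" using nn by (simp add: dot_square_norm power2_eq_square)
    ultimately show ?thesis using dB by (simp add: field_simps)
  qed
  have "b x \<bullet> b x = a $ 1 * (pd 1 y0 x \<bullet> b x) + a $ 2 * (pd 2 y0 x \<bullet> b x) + (s / norm ?n) * (?n \<bullet> b x)"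
    by (subst (1) bx) (simp add: inner_add_left)
  also have "?n \<bullet> b x = (s / norm ?n) * det ?B"
    unfolding bx by (simp add: inner_add_right nn dot_cross_self)
  finally have bb: "b x \<bullet> b x = a $ 1 * Gbar G x $ 1 $ 3 + a $ 2 * Gbar G x $ 2 $ 3 + det (Gbar G x) / det ?B"
    using s2 i3[of 1] i3[of 2] by (simp add: e23_simps)
  define p where "p = pd 1 y0 x \<bullet> pd 1 y0 x"
  define q where "q = pd 1 y0 x \<bullet> pd 2 y0 x"
  define r where "r = pd 2 y0 x \<bullet> pd 2 y0 x"
  have G: "Gbar G x $ 1 $ 1 = p" "Gbar G x $ 1 $ 2 = q" "Gbar G x $ 2 $ 1 = q" "Gbar G x $ 2 $ 2 = r"
    using metric_inner[OF x, of 1 1] metric_inner[OF x, of 1 2] metric_inner[OF x, of 2 1] metric_inner[OF x, of 2 2]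
    by (simp_all add: p_def q_def r_def e23_simps inner_commute)
  have G3: "Gbar G x $ 1 $ 3 = a $ 1 * p + a $ 2 * q" "Gbar G x $ 2 $ 3 = a $ 1 * q + a $ 2 * r"
    using g[of 1] g[of 2] by (simp_all add: p_def q_def r_def e23_simps inner_commute)
  have G3': "Gbar G x $ 3 $ 1 = Gbar G x $ 1 $ 3" "Gbar G x $ 3 $ 2 = Gbar G x $ 2 $ 3"
    using sym_posdef_nth[OF spd] by blast+
  have dB': "det ?B = p * r - q * q" by (simp add: det_2 blk2_def e23_simps G)
  \<comment> \<open>With the mixed entries written through \<open>a\<close>, the determinant factors
    as Schur complement times block determinant; this identifies the last summand of
    \<open>bb\<close>.\<close>
  have "det (Gbar G x) = (Gbar G x $ 3 $ 3 - (a $ 1 * Gbar G x $ 1 $ 3 + a $ 2 * Gbar G x $ 2 $ 3)) * det ?B"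
    unfolding det_3 G3' G G3 dB' by (simp add: algebra_simps)
  then show "b x \<bullet> b x = Gbar G x $ 3 $ 3" unfolding bb using dB by simp
qed

lemma X_gram: "x \<in> \<omega> \<Longrightarrow> X m x \<bullet> X k x = Gbar G x $ m $ k"
proof -
  assume x: "x \<in> \<omega>"
  have spd: "sym_posdef (Gbar G x)" using Gbar_spd x closure_subset by blast
  show ?thesis
    using exhaust_3[of m] exhaust_3[of k] metric_inner[OF x, of 1 1] metric_inner[OF x, of 1 2]
      metric_inner[OF x, of 2 1] metric_inner[OF x, of 2 2] b_gram(1)[OF x, of 1] b_gram(1)[OF x, of 2] b_gram(2)[OF x]
      sym_posdef_nth[OF spd, of 3 1] sym_posdef_nth[OF spd, of 3 2]
    by (auto simp: X_simps e23_simps inner_commute)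
qed

lemma Q0_nth: "Q0 G y0 x $ j $ a = X a x $ j"
  by (simp add: Q0_def X_def)

lemma Q0_gram: "x \<in> \<omega> \<Longrightarrow> transpose (Q0 G y0 x) ** Q0 G y0 x = Gbar G x"
  using X_gram[of x] by (simp add: vec_eq_iff matrix_matrix_mult_def transpose_def Q0_nth inner_vec_def)

lemma det_Q0: "x \<in> \<omega> \<Longrightarrow> det (Q0 G y0 x) * det (Q0 G y0 x) = det (Gbar G x)"
  by (metis Q0_gram det_mul det_transpose)

lemma Q0_invertible: "x \<in> \<omega> \<Longrightarrow> invertible (Q0 G y0 x)"
proof -
  assume x: "x \<in> \<omega>"
  have "det (Gbar G x) > 0" using det_sym_posdef Gbar_spd x closure_subset by blast
  then have "det (Q0 G y0 x) \<noteq> 0" using det_Q0[OF x] by auto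
  then show ?thesis by (simp add: invertible_det_nz)
qed

lemma Q0_inv_nth:
  "smooth_bdd \<omega> (\<lambda>x. matrix_inv (Q0 G y0 x) $ i $ j)"
  "smooth_bdd \<omega> (\<lambda>x. matrix_inv (transpose (Q0 G y0 x)) $ i $ j)"
proof -
  obtain e where e: "e > 0" "\<And>x. x \<in> \<omega> \<Longrightarrow> e \<le> det (Gbar G x)" using det_lower_bounds by metis
  \<comment> \<open>The Gram identity makes \<open>det (Gbar G x)\<close> the square of the
    determinant of the frame, hence the root of the bound.\<close>
  have lb: "sqrt e \<le> \<bar>det (Q0 G y0 x)\<bar>" if "x \<in> \<omega>" for x
    using e(2)[OF that] det_Q0[OF that] by (metis real_sqrt_abs2 real_sqrt_le_iff)
  show "smooth_bdd \<omega> (\<lambda>x. matrix_inv (Q0 G y0 x) $ i $ j)"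
    by (rule smooth_bdd_matrix_inv[OF om_open, of _ "sqrt e"]) (use e(1) lb in \<open>auto simp: Q0_nth X_nth\<close>)
  show "smooth_bdd \<omega> (\<lambda>x. matrix_inv (transpose (Q0 G y0 x)) $ i $ j)"
  proof (rule smooth_bdd_matrix_inv[OF om_open, of _ "sqrt e"])
    show "smooth_bdd \<omega> (\<lambda>x. transpose (Q0 G y0 x) $ k $ l)" for k l
      by (simp add: transpose_def Q0_nth X_nth)
    show "sqrt e \<le> \<bar>det (transpose (Q0 G y0 x))\<bar>" if "x \<in> \<omega>" for x
      using lb[OF that] by (simp add: det_transpose)
  qed (use e(1) in simp)
qed

lemma Q0_transpose_mult: "(transpose (Q0 G y0 x) *v u) $ a = X a x \<bullet> u"
  by (simp add: matrix_vector_mult_def transpose_def Q0_nth inner_vec_def)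

text \<open>The frame is a basis, so a vector is known from its products with the frame; later
  vector identities are tested in this way.\<close>

lemma frame_eqI:
  assumes "x \<in> \<omega>" "\<And>a. X a x \<bullet> u = X a x \<bullet> v" shows "u = v"
proof -
  have "transpose (Q0 G y0 x) *v u = transpose (Q0 G y0 x) *v v"
    using assms(2) by (simp add: vec_eq_iff matrix_vector_mult_def transpose_def Q0_nth inner_vec_def)
  moreover have "matrix_inv (transpose (Q0 G y0 x)) ** transpose (Q0 G y0 x) = mat 1"
    by (rule matrix_inv_mult(2)) (use Q0_invertible[OF assms(1)] in \<open>simp add: invertible_det_nz det_transpose\<close>)
  moreover have "matrix_inv (transpose (Q0 G y0 x)) *v (transpose (Q0 G y0 x) *v w) = w" for w
    unfolding matrix_vector_mul_assoc by (simp add: calculation(2))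
  ultimately show ?thesis by metis
qed

lemma inner_X_inv_transpose:
  assumes "x \<in> \<omega>" shows "X a x \<bullet> (matrix_inv (transpose (Q0 G y0 x)) *v w) = w $ a"
proof -
  have "transpose (Q0 G y0 x) ** matrix_inv (transpose (Q0 G y0 x)) = mat 1"
    by (rule matrix_inv_mult(1)) (use Q0_invertible[OF assms] in \<open>simp add: invertible_det_nz det_transpose\<close>)
  then have "transpose (Q0 G y0 x) *v (matrix_inv (transpose (Q0 G y0 x)) *v w) = w"
    by (simp add: matrix_vector_mul_assoc)
  then have "(transpose (Q0 G y0 x) *v (matrix_inv (transpose (Q0 G y0 x)) *v w)) $ a = w $ a" by simp
  then show ?thesis unfolding Q0_transpose_mult .
qed

end

text \<open>Left inverse of \<open>e23\<close>; the value at the normal index 3 is a dummy.\<close>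

definition r32 :: "3 \<Rightarrow> 2" where "r32 a = (if a = 1 then 1 else 2)"

lemma r32_e23: "r32 (e23 i) = i" and e23_r32: "a \<noteq> 3 \<Longrightarrow> e23 (r32 a) = a" and e23_neq_3: "e23 i \<noteq> 3"
  using exhaust_2[of i] exhaust_3[of a] by (auto simp: r32_def e23_simps)

lemma index3_cases: obtains (in_plane) i where "a = e23 i" | (normal) "a = 3"
  by (cases "a = 3") (metis e23_r32)+

lemma (in plate) smooth_field_swap:
  fixes f :: "real^2 \<Rightarrow> real^3"
  assumes f: "\<And>j. smooth_bdd \<omega> (\<lambda>x. f x $ j)" and x: "x \<in> \<omega>"
  shows "pd i (pd j f) x = pd j (pd i f) x"
proof -
  have "pd i (pd j f) x $ n = pds [i, j] (\<lambda>x. f x $ n) x" for i j n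
  proof -
    have "pd i (pd j f) x $ n = pd i (\<lambda>x. pd j f x $ n) x"
      by (rule smooth_field_has_pd(2)[OF smooth_field_pd[OF om_open f] x])
    also have "\<dots> = pd i (pd j (\<lambda>x. f x $ n)) x"
      by (rule pd_cong_open[OF om_open x]) (rule smooth_field_has_pd(2)[OF f])
    finally show ?thesis by simp
  qed
  moreover have "pds [i, j] (\<lambda>x. f x $ n) x = pds [j, i] (\<lambda>x. f x $ n) x" for n
    by (rule pds_swap[OF om_open _ x]) (use f in \<open>simp add: smooth_bdd_def\<close>)
  ultimately show ?thesis by (simp add: vec_eq_iff)
qed

section \<open>Flatness and the curvature identity\<close>

locale flat_plate = plate +
  assumes flat: "\<And>x' i k l m. x' \<in> \<omega> \<Longrightarrow> riemann G (pt x' 0) i k l m = 0"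
    and y0_b0: "\<And>x'. x' \<in> \<omega> \<Longrightarrow>
                  msym (transpose (cgrad y0 x') ** cgrad (b0 G y0) x') = (1/2) *\<^sub>R blk2 (pd 3 G (pt x' 0))"
begin

lemma db_nth: "smooth_bdd \<omega> (\<lambda>x. pd i b x $ j)"
  by (rule smooth_field_pd[OF om_open b_nth])

lemma y0_b0_inner:
  assumes x: "x \<in> \<omega>"
  shows "pd i y0 x \<bullet> pd j b x + pd j y0 x \<bullet> pd i b x = pd 3 G (pt x 0) $ e23 i $ e23 j"
proof -
  have "msym (transpose (cgrad y0 x) ** cgrad b x) $ i $ j = ((1/2) *\<^sub>R blk2 (pd 3 G (pt x 0))) $ i $ j"
    by (simp only: y0_b0[OF x])
  then show ?thesis
    by (simp add: msym_def transpose_def matrix_matrix_mult_def cgrad_def blk2_def inner_vec_def)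
qed

text \<open>The inverse transpose of the frame in \<open>d0\<close> prescribes these products.
  Solved for the derivatives of \<open>G\<close>, they say that the entries \<open>i3\<close> and
  \<open>33\<close> have the normal derivative of the metric induced by the quadratic thickening of
  the surface.\<close>

lemma d_inner:
  assumes x: "x \<in> \<omega>"
  shows "pd i y0 x \<bullet> d x = pd 3 G (pt x 0) $ e23 i $ 3 - pd i b x \<bullet> b x"
    and "b x \<bullet> d x = (1/2) * pd 3 G (pt x 0) $ 3 $ 3"
proof -
  let ?w = "pd 3 G (pt x 0) *v axis 3 1 - ((1/2) * (pd 3 G (pt x 0) $ 3 $ 3)) *\<^sub>R axis 3 1
      - ext3 (transpose (cgrad b x) *v b x)"
  have dX: "X a x \<bullet> d x = ?w $ a" for a unfolding d0_def by (rule inner_X_inv_transpose[OF x])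
  have c: "(pd 3 G (pt x 0) *v axis 3 1) $ a = pd 3 G (pt x 0) $ a $ 3" for a
    by (simp add: matrix_vector_mult_basis column_def)
  have t: "(transpose (cgrad b x) *v b x) $ i = pd i b x \<bullet> b x" for i
    by (simp add: matrix_vector_mult_def transpose_def cgrad_def inner_vec_def)
  have ax: "axis 3 (1::real) $ (1::3) = 0" "axis 3 (1::real) $ (2::3) = 0" "axis 3 (1::real) $ (3::3) = 1"
    by (simp_all add: axis_def)
  have "X (e23 i) x \<bullet> d x = pd 3 G (pt x 0) $ e23 i $ 3 - pd i b x \<bullet> b x"
    unfolding dX using exhaust_2[of i]
    by (auto simp: c t ax ext3_def e23_simps simp del: transpose_matrix_vector)
  then show "pd i y0 x \<bullet> d x = pd 3 G (pt x 0) $ e23 i $ 3 - pd i b x \<bullet> b x" by (simp add: X_simps)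
  have "X 3 x \<bullet> d x = (1/2) * pd 3 G (pt x 0) $ 3 $ 3"
    unfolding dX by (simp add: c ax ext3_def)
  then show "b x \<bullet> d x = (1/2) * pd 3 G (pt x 0) $ 3 $ 3" by (simp add: X_simps)
qed

lemma pd3G_smooth: "smooth_bdd \<omega> (\<lambda>x. pd 3 G (pt x 0) $ m $ k)"
  using pds_G_pt_smooth[of "[3]" m k] by simp

lemma d_nth: "smooth_bdd \<omega> (\<lambda>x. d x $ j)"
proof -
  let ?w = "\<lambda>x. pd 3 G (pt x 0) *v axis 3 1 - ((1/2) * (pd 3 G (pt x 0) $ 3 $ 3)) *\<^sub>R axis 3 1
      - ext3 (transpose (cgrad b x) *v b x)"
  have e: "smooth_bdd \<omega> (\<lambda>x. ext3 (transpose (cgrad b x) *v b x) $ a)" for a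
  proof -
    have t: "(transpose (cgrad b x) *v b x) $ i = pd i b x \<bullet> b x" for i x
      by (simp add: matrix_vector_mult_def transpose_def cgrad_def inner_vec_def)
    show ?thesis using exhaust_3[of a]
      by (auto simp: ext3_def t smooth_bdd_const[OF om_open] simp del: transpose_matrix_vector
        intro!: smooth_bdd_inner om_open db_nth b_nth)
  qed
  have "smooth_bdd \<omega> (\<lambda>x. pd 3 G (pt x 0) $ a $ 3 - ((1/2) * (pd 3 G (pt x 0) $ 3 $ 3)) * axis 3 1 $ a
      - ext3 (transpose (cgrad b x) *v b x) $ a)" for a
    by (intro smooth_bdd_diff smooth_bdd_mult smooth_bdd_const om_open pd3G_smooth e)
  then have w: "smooth_bdd \<omega> (\<lambda>x. ?w x $ a)" for a
    by (simp add: matrix_vector_mult_basis column_def)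
  have "smooth_bdd \<omega> (\<lambda>x. \<Sum>k\<in>UNIV. matrix_inv (transpose (Q0 G y0 x)) $ j $ k * ?w x $ k)"
    by (rule smooth_bdd_sum[OF om_open smooth_bdd_mult[OF om_open Q0_inv_nth(2) w]])
  then show ?thesis unfolding d0_def by (simp add: matrix_vector_mult_def[of "matrix_inv _"])
qed

text \<open>\<open>H k l\<close> is the second derivative \<open>\<partial>\<^sub>k\<partial>\<^sub>l\<close> along the midplate of
  \<open>y\<^sub>0 + t b\<^sub>0 + t\<^sup>2 d\<^sub>0 / 2\<close>, whose induced metric agrees with \<open>G\<close> to first order in \<open>t\<close>.\<close>

definition H :: "3 \<Rightarrow> 3 \<Rightarrow> real^2 \<Rightarrow> real^3" where
  "H k l x = (if k \<noteq> 3 then pd (r32 k) (X l) x else if l \<noteq> 3 then pd (r32 l) b x else d x)"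

lemma H_simps:
  "H (e23 i) l x = pd i (X l) x" "H (e23 i) (e23 j) x = pd i (pd j y0) x"
  "H (e23 i) 3 x = pd i b x" "H 3 (e23 i) x = pd i b x" "H 3 3 x = d x"
  by (simp_all add: H_def e23_neq_3 r32_e23 X_simps)

lemma H_sym: "x \<in> \<omega> \<Longrightarrow> H k l x = H l k x"
  by (cases k rule: index3_cases; cases l rule: index3_cases)
    (auto simp: H_simps(2-5) intro: smooth_field_swap[OF y0_nth])

lemma pd_X_inner:
  assumes x: "x \<in> \<omega>"
  shows "pds [e23 i] G (pt x 0) $ m $ k = X m x \<bullet> pd i (X k) x + pd i (X m) x \<bullet> X k x"
proof -
  have "pds [e23 i] G (pt x 0) $ m $ k = pd i (\<lambda>x. Gbar G x $ m $ k) x"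
    using pd_G_pt[OF x, of i "[]" m k] by (simp add: Gbar_def)
  also have "\<dots> = pd i (\<lambda>x. X m x \<bullet> X k x) x"
    by (rule pd_cong_open[OF om_open x]) (rule X_gram[symmetric])
  also have "\<dots> = X m x \<bullet> pd i (X k) x + pd i (X m) x \<bullet> X k x"
    by (rule has_pd_imp_pd[OF has_pd_inner[OF smooth_field_has_pd(1)[OF X_nth x] smooth_field_has_pd(1)[OF X_nth x]]])
  finally show ?thesis .
qed

text \<open>The metric behaves as if \<open>X\<close> held the first and \<open>H\<close> the second
  derivatives of one map. In-plane derivatives come from differentiating the Gram matrix; the normal
  derivative of the in-plane block is the assumption \<open>y0_b0\<close>, and the remaining normal
  derivatives are encoded in \<open>d\<close>.\<close>

lemma pd_G_frame:
  assumes x: "x \<in> \<omega>"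
  shows "pd l G (pt x 0) $ m $ k = H l m x \<bullet> X k x + X m x \<bullet> H l k x"
proof (cases l rule: index3_cases)
  case (in_plane i)
  then show ?thesis using pd_X_inner[OF x, of i m k] by (simp add: H_simps(1))
next
  case normal
  have s: "pd 3 G (pt x 0) $ 3 $ k = pd 3 G (pt x 0) $ k $ 3" for k using pds_G_sym[OF x, of "[3]"] by simp
  show ?thesis
  proof (cases m rule: index3_cases; cases k rule: index3_cases)
    fix i j assume "m = e23 i" "k = e23 j"
    then show ?thesis using y0_b0_inner[OF x, of i j] normal by (simp add: H_simps X_simps inner_commute)
  next
    fix i assume "m = e23 i" "k = 3"
    then show ?thesis using d_inner(1)[OF x, of i] normal by (simp add: H_simps X_simps inner_commute)
  next
    fix j assume "m = 3" "k = e23 j"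
    then show ?thesis using d_inner(1)[OF x, of j] normal s by (simp add: H_simps X_simps inner_commute)
  next
    assume "m = 3" "k = 3"
    then show ?thesis using d_inner(2)[OF x] normal by (simp add: H_simps X_simps inner_commute)
  qed
qed

text \<open>Koszul's argument: \<open>H\<close> is symmetric in its indices and compatible with the
  metric, so the combination of metric derivatives in the Christoffel symbol leaves only twice the
  product of \<open>X m x\<close> and \<open>H k l x\<close>.\<close>

lemma christoffel_frame:
  assumes x: "x \<in> \<omega>"
  shows "(\<Sum>n\<in>UNIV. christoffel G (pt x 0) n k l *\<^sub>R X n x) = H k l x"
proof (rule frame_eqI[OF x])
  fix m
  let ?z = "pt x 0"
  let ?T = "\<lambda>p. pd l G ?z $ p $ k + pd k G ?z $ p $ l - pd p G ?z $ k $ l"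
  have spd: "sym_posdef (Gbar G x)" using Gbar_spd x closure_subset by blast
  have GG: "(\<Sum>n\<in>UNIV. Gbar G x $ m $ n * matrix_inv (Gbar G x) $ n $ p) = (if m = p then 1 else 0)" for p
  proof -
    have "(Gbar G x ** matrix_inv (Gbar G x)) $ m $ p = mat 1 $ m $ p"
      using matrix_inv_mult(1)[OF posdef_invertible[OF spd]] by simp
    then show ?thesis by (simp add: matrix_matrix_mult_def mat_def)
  qed
  have delta: "(\<Sum>p\<in>UNIV. (if m = p then 1 else 0) * f p) = f m" for f :: "3 \<Rightarrow> real"
    using exhaust_3[of m] by (auto simp: sum_3)
  have "X m x \<bullet> (\<Sum>n\<in>UNIV. christoffel G ?z n k l *\<^sub>R X n x)
      = (\<Sum>n\<in>UNIV. Gbar G x $ m $ n * christoffel G ?z n k l)"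
    by (simp add: inner_sum_right X_gram[OF x] mult.commute)
  also have "\<dots> = (\<Sum>n\<in>UNIV. \<Sum>p\<in>UNIV. Gbar G x $ m $ n * matrix_inv (Gbar G x) $ n $ p * ((1/2) * ?T p))"
    unfolding christoffel_def Gbar_def[symmetric] by (simp only: sum_distrib_left mult_ac)
  also have "\<dots> = (\<Sum>p\<in>UNIV. \<Sum>n\<in>UNIV. Gbar G x $ m $ n * matrix_inv (Gbar G x) $ n $ p * ((1/2) * ?T p))"
    by (rule sum.swap)
  also have "\<dots> = (\<Sum>p\<in>UNIV. (if m = p then 1 else 0) * ((1/2) * ?T p))"
    by (simp only: GG flip: sum_distrib_right)
  also have "\<dots> = (1/2) * ?T m" by (rule delta)
  also have "\<dots> = X m x \<bullet> H k l x"
    unfolding pd_G_frame[OF x] H_sym[OF x, of l m] H_sym[OF x, of l k] H_sym[OF x, of k m]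
    by (simp add: inner_commute)
  finally show "X m x \<bullet> (\<Sum>n\<in>UNIV. christoffel G ?z n k l *\<^sub>R X n x) = X m x \<bullet> H k l x" .
qed

lemma christoffel_product:
  assumes x: "x \<in> \<omega>"
  shows "(\<Sum>n\<in>UNIV. \<Sum>p\<in>UNIV. G (pt x 0) $ n $ p * (christoffel G (pt x 0) n k l * christoffel G (pt x 0) p i m))
    = H k l x \<bullet> H i m x"
proof -
  have "H k l x \<bullet> H i m x = (\<Sum>n\<in>UNIV. christoffel G (pt x 0) n k l *\<^sub>R X n x) \<bullet> (\<Sum>p\<in>UNIV. christoffel G (pt x 0) p i m *\<^sub>R X p x)"
    by (simp only: christoffel_frame[OF x])
  also have "\<dots> = (\<Sum>n\<in>UNIV. \<Sum>p\<in>UNIV. (X n x \<bullet> X p x) * (christoffel G (pt x 0) n k l * christoffel G (pt x 0) p i m))"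
    by (subst sum.swap) (simp add: inner_sum_left inner_sum_right sum_distrib_left mult_ac)
  finally show ?thesis by (simp add: X_gram[OF x] Gbar_def)
qed

text \<open>The Christoffel symbols are the frame coordinates of the vectors \<open>H\<close>, so
  their products contracted with the metric become inner products of these vectors.\<close>

lemma riemann_frame:
  assumes x: "x \<in> \<omega>"
  shows "riemann G (pt x 0) i k l m =
     (1/2) * (pds [k, l] G (pt x 0) $ i $ m + pds [i, m] G (pt x 0) $ k $ l - pds [k, m] G (pt x 0) $ i $ l - pds [i, l] G (pt x 0) $ k $ m)
     + (H k l x \<bullet> H i m x - H k m x \<bullet> H i l x)"
  unfolding riemann_def christoffel_product[OF x, symmetric]
  by (simp only: right_diff_distrib sum_subtractf)

lemma pds_n3:
  assumes x: "x \<in> \<omega>"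
  shows "pds [e23 j, 3] G (pt x 0) $ e23 i $ 3
    = pd i y0 x \<bullet> pd j d x + pd j (pd i y0) x \<bullet> d x + (pd i b x \<bullet> pd j b x + pd j (pd i b) x \<bullet> b x)"
proof -
  have "pds [e23 j, 3] G (pt x 0) $ e23 i $ 3 = pd j (\<lambda>x. pd 3 G (pt x 0) $ e23 i $ 3) x"
    using pd_G_pt[OF x, of j "[3]" "e23 i" 3] by simp
  also have "\<dots> = pd j (\<lambda>x. pd i y0 x \<bullet> d x + pd i b x \<bullet> b x) x"
    by (rule pd_cong_open[OF om_open x]) (simp add: d_inner(1))
  also have "\<dots> = (pd i y0 x \<bullet> pd j d x + pd j (pd i y0) x \<bullet> d x) + (pd i b x \<bullet> pd j b x + pd j (pd i b) x \<bullet> b x)"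
    by (rule has_pd_imp_pd[OF has_pd_add[OF has_pd_inner has_pd_inner]])
      (rule smooth_field_has_pd(1)[OF _ x], rule dy0_nth d_nth db_nth b_nth)+
  finally show ?thesis by simp
qed

lemma pds_33:
  assumes x: "x \<in> \<omega>"
  shows "pds [e23 i, e23 j] G (pt x 0) $ 3 $ 3 = 2 * (b x \<bullet> pd i (pd j b) x + pd i b x \<bullet> pd j b x)"
proof -
  have "pds [e23 i, e23 j] G (pt x 0) $ 3 $ 3 = pd i (\<lambda>x. pd (e23 j) G (pt x 0) $ 3 $ 3) x"
    using pd_G_pt[OF x, of i "[e23 j]" 3 3] by simp
  also have "\<dots> = pd i (\<lambda>x. b x \<bullet> pd j b x + b x \<bullet> pd j b x) x"
  proof (rule pd_cong_open[OF om_open x])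
    fix y assume "y \<in> \<omega>"
    from pd_X_inner[OF this, of j 3 3] show "pd (e23 j) G (pt y 0) $ 3 $ 3 = b y \<bullet> pd j b y + b y \<bullet> pd j b y"
      by (simp add: X_simps inner_commute)
  qed
  also have "\<dots> = (b x \<bullet> pd i (pd j b) x + pd i b x \<bullet> pd j b x) + (b x \<bullet> pd i (pd j b) x + pd i b x \<bullet> pd j b x)"
    by (rule has_pd_imp_pd[OF has_pd_add[OF has_pd_inner has_pd_inner]])
      (rule smooth_field_has_pd(1)[OF _ x], rule db_nth b_nth)+
  finally show ?thesis by simp
qed

text \<open>Only the second normal derivative of \<open>G\<close> lies beyond first-order agreement,
  and it is kept. The other terms are in-plane derivatives of known products. They create second
  derivatives of \<open>y0\<close> and of \<open>b\<close>; the former cancel against the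
  Christoffel part, the latter against the second derivative of the entry \<open>33\<close>.\<close>

lemma curvature_identity:
  assumes x: "x \<in> \<omega>"
  shows "(1/2) * (pd i y0 x \<bullet> pd j d x + pd j y0 x \<bullet> pd i d x) + pd i b x \<bullet> pd j b x
    - (1/2) * pds [3, 3] G (pt x 0) $ e23 i $ e23 j = 0"
proof -
  have "0 = riemann G (pt x 0) (e23 i) 3 (e23 j) 3" by (simp add: flat[OF x])
  also have "\<dots> = (1/2) * (pds [e23 j, 3] G (pt x 0) $ e23 i $ 3 + pds [e23 i, 3] G (pt x 0) $ e23 j $ 3
      - pds [3, 3] G (pt x 0) $ e23 i $ e23 j - pds [e23 i, e23 j] G (pt x 0) $ 3 $ 3)
      + (pd j b x \<bullet> pd i b x - d x \<bullet> pd i (pd j y0) x)"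
    unfolding riemann_frame[OF x] pds_G_swap[OF x, of 3 "e23 j"] pds_G_sym[OF x, of "[e23 i, 3]" 3 "e23 j"]
    by (simp only: H_simps X_simps)
  finally show ?thesis
    unfolding pds_n3[OF x] pds_33[OF x] smooth_field_swap[OF b_nth x, of j i] smooth_field_swap[OF y0_nth x, of j i]
    by (simp add: inner_commute algebra_simps)
qed

lemma curvature_identity_matrix:
  assumes x: "x \<in> \<omega>"
  shows "msym (transpose (cgrad y0 x) ** cgrad d x) + transpose (cgrad b x) ** cgrad b x
    - (1/2) *\<^sub>R blk2 (pds [3, 3] G (pt x 0)) = 0"
  using curvature_identity[OF x]
  by (simp add: vec_eq_iff msym_def transpose_def matrix_matrix_mult_def cgrad_def blk2_def inner_vec_def del: pds.simps)

end

section \<open>Rigidity of infinitesimal bendings\<close>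

lemma AE_finite_all:
  assumes "\<And>i::'i::finite. AE x in M. P i x"
  shows "AE x in M. \<forall>i. P i x"
  using assms by (simp add: AE_all_countable)

lemma inner_mult_skew:
  fixes S :: "real^3^3" assumes "transpose S = - S"
  shows "u \<bullet> (S *v w) = - ((S *v u) \<bullet> w)" "u \<bullet> (S *v u) = 0"
proof -
  have s: "u \<bullet> (S *v w) = - ((S *v u) \<bullet> w)" for u w
  proof -
    have "u \<bullet> (S *v w) = (transpose S *v u) \<bullet> w" by (simp add: dot_lmul_matrix[symmetric])
    also have "\<dots> = - ((S *v u) \<bullet> w)" unfolding assms
      by (simp add: matrix_vector_mult_def inner_vec_def sum_negf)
    finally show ?thesis .
  qed
  show "u \<bullet> (S *v w) = - ((S *v u) \<bullet> w)" by (rule s)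
  show "u \<bullet> (S *v u) = 0" using s[of u u] by (simp add: inner_commute)
qed

sublocale plate \<subseteq> bdd_domain \<omega>
  by unfold_locales (rule om_open, rule om_bdd)

lemma has_wd_zero_imp_const:
  fixes U :: "(real^2) set"
  assumes "bdd_domain U" "connected U" "\<And>k. bdd_domain.has_wd U k f (g k)"
    "\<And>k. AE x in lebesgue_on U. g k x = 0"
  shows "\<exists>c. AE x in lebesgue_on U. f x = c"
proof -
  interpret bdd_domain U by fact
  have w: "has_wd k f (\<lambda>x. 0)" for k
    by (rule has_wd_cong_AE_right[OF assms(4) L2_const assms(3)])
  show ?thesis
    by (rule weak_grad_zero_imp_const[OF U_open assms(2) L2_integrable[OF has_wd_L2(1)[OF w]]])
      (use w in \<open>simp add: has_wd_def\<close>)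
qed

context plate
begin

text \<open>The matrices \<open>A l\<close> stand for the partial derivatives of the skew field. A
  matrix is zero once its products between frame vectors vanish; by skewness three of them per
  matrix remain, and these six are settled by \<open>comm\<close> and \<open>sym\<close>.\<close>

lemma frame_rigid:
  fixes A :: "2 \<Rightarrow> real^3^3"
  assumes x: "x \<in> \<omega>" and skew: "\<And>l. transpose (A l) = - A l"
    and comm: "\<And>k l. A l *v pd k y0 x = A k *v pd l y0 x"
    and sym: "\<And>k l. pd k y0 x \<bullet> (A l *v b x) + pd l y0 x \<bullet> (A k *v b x) = 0"
  shows "A l = 0"
proof -
  let ?u = "pd 1 y0 x" and ?w = "pd 2 y0 x"
  note sk = inner_mult_skew[OF skew]
  \<comment> \<open>Trading \<open>A 1\<close> on the second tangent vector for \<open>A 2\<close>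
    on the first produces a diagonal product, which is zero for a skew matrix.\<close>
  have 1: "?u \<bullet> (A 1 *v ?w) = 0" using sk(2)[of ?u 2] comm[of 2 1] by simp
  have 2: "?w \<bullet> (A 2 *v ?u) = 0" using sk(2)[of ?w 1] comm[of 1 2] by simp
  have 3: "?u \<bullet> (A 1 *v b x) = 0" "?w \<bullet> (A 2 *v b x) = 0" using sym[of 1 1] sym[of 2 2] by auto
  have 4: "?u \<bullet> (A 2 *v b x) + ?w \<bullet> (A 1 *v b x) = 0" using sym[of 1 2] by simp
  \<comment> \<open>\<open>comm\<close> and skewness make the two mixed products with
    \<open>b x\<close> equal, \<open>sym\<close> makes them opposite.\<close>
  have "b x \<bullet> (A 2 *v ?u) = b x \<bullet> (A 1 *v ?w)" using comm[of 1 2] by simp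
  then have 5: "?u \<bullet> (A 2 *v b x) = ?w \<bullet> (A 1 *v b x)"
    using sk(1)[of ?u 2 "b x"] sk(1)[of ?w 1 "b x"] by (simp add: inner_commute)
  then have 6: "?u \<bullet> (A 2 *v b x) = 0" "?w \<bullet> (A 1 *v b x) = 0" using 4 by auto
  have off: "?u \<bullet> (A l *v ?w) = 0" "?u \<bullet> (A l *v b x) = 0" "?w \<bullet> (A l *v b x) = 0" for l
    using exhaust_2[of l] 1 2 3 6 sk(1)[of ?u 2 ?w] by (auto simp: inner_commute)
  have z: "X a x \<bullet> (A l *v X c x) = 0" for a c l
    using exhaust_3[of a] exhaust_3[of c] off[of l] sk(2)[of _ l]
      sk(1)[of ?w l ?u] sk(1)[of "b x" l ?u] sk(1)[of "b x" l ?w]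
    by (auto simp: X_simps inner_commute)
  have "A l *v X c x = 0" for c by (rule frame_eqI[OF x]) (simp add: z)
  then have "X c x \<bullet> (A l *v u) = 0" for c u using sk(1)[of "X c x" l u] by simp
  then have "A l *v u = 0" for u by (intro frame_eqI[OF x]) simp
  then have "\<forall>u. A l *v u = 0 *v u" by simp
  then show ?thesis unfolding matrix_eq[symmetric] .
qed

lemma has_wd_matrix_field:
  fixes S :: "real^3^3"
  assumes f: "\<And>j. smooth_bdd \<omega> (\<lambda>x. f x $ j)"
  shows "has_wd k (\<lambda>x. (S *v f x + c0) $ i) (\<lambda>x. (S ** cgrad f x) $ i $ k)"
proof -
  have "has_wd k (\<lambda>x. (\<Sum>j\<in>UNIV. S $ i $ j * f x $ j) + c0 $ i) (\<lambda>x. (\<Sum>j\<in>UNIV. S $ i $ j * pd k (\<lambda>x. f x $ j) x) + pd k (\<lambda>x. c0 $ i) x)"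
    by (intro has_wd_add has_wd_sum has_wd_cmult has_wd_smooth f smooth_bdd_const om_open)
  then show ?thesis
    by (rule has_wd_cong[rotated 2])
      (simp_all add: matrix_vector_mult_def matrix_matrix_mult_def cgrad_def smooth_field_has_pd(2)[OF f] has_pd_imp_pd[OF has_pd_const])
qed

lemma wgrad_AE_eq:
  fixes S :: "real^3^3"
  assumes V: "\<And>i k. has_wd k (\<lambda>x. V x $ i) (\<lambda>x. wgrad \<omega> V x $ i $ k)"
    and AEV: "AE x in lebesgue_on \<omega>. V x = S *v f x + c0"
    and f: "\<And>j. smooth_bdd \<omega> (\<lambda>x. f x $ j)"
  shows "AE x in lebesgue_on \<omega>. wgrad \<omega> V x = S ** cgrad f x"
proof -
  have "AE x in lebesgue_on \<omega>. wgrad \<omega> V x $ i $ k = (S ** cgrad f x) $ i $ k" for i k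
  proof (rule has_wd_unique_AE[OF V has_wd_matrix_field[OF f]])
    show "AE x in lebesgue_on \<omega>. V x $ i = (S *v f x + c0) $ i" using AEV by eventually_elim simp
  qed
  then have "AE x in lebesgue_on \<omega>. \<forall>i k. wgrad \<omega> V x $ i $ k = (S ** cgrad f x) $ i $ k"
    by (intro AE_finite_all)
  then show ?thesis by eventually_elim (simp add: vec_eq_iff)
qed

text \<open>These products make the third row and column of \<open>X^T M\<close> skew; the
  tangential block is skew by the constraint on \<open>V\<close>.\<close>

lemma pvec_inner:
  assumes x: "x \<in> \<omega>"
  shows "pd i y0 x \<bullet> pvec G y0 \<omega> V x = - (column i (wgrad \<omega> V x) \<bullet> b x)" "b x \<bullet> pvec G y0 \<omega> V x = 0"
proof -
  let ?w = "ext3 (transpose (wgrad \<omega> V x) *v b x)"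
  have p: "X a x \<bullet> pvec G y0 \<omega> V x = - ?w $ a" for a
    unfolding pvec_def inner_minus_right inner_X_inv_transpose[OF x] by simp
  have t: "(transpose (wgrad \<omega> V x) *v b x) $ i = column i (wgrad \<omega> V x) \<bullet> b x" for i
    by (simp add: matrix_vector_mult_def transpose_def column_def inner_vec_def)
  show "pd i y0 x \<bullet> pvec G y0 \<omega> V x = - (column i (wgrad \<omega> V x) \<bullet> b x)"
    using p[of "e23 i"] exhaust_2[of i]
    by (auto simp: X_simps ext3_def e23_simps t simp del: transpose_matrix_vector)
  show "b x \<bullet> pvec G y0 \<omega> V x = 0" using p[of 3] by (simp add: X_simps ext3_def)
qed

text \<open>\<open>pvec\<close> is linear in the first derivatives of \<open>V\<close> with
  \<open>smooth_bdd\<close> coefficients, so the second derivatives of \<open>V\<close> supply its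
  weak gradient.\<close>

lemma pvec_has_wd:
  assumes V: "sobolev 2 \<omega> V"
  shows "has_wd l (\<lambda>x. pvec G y0 \<omega> V x $ i) (\<lambda>x. wgrad \<omega> (pvec G y0 \<omega> V) x $ i $ l)"
proof -
  obtain h where h: "\<And>j k l. has_wd l (\<lambda>x. wgrad \<omega> V x $ j $ k) (h j k l)"
    using sobolev2_second_wd[OF V] by metis
  let ?a = "\<lambda>k j x. - (matrix_inv (transpose (Q0 G y0 x)) $ i $ e23 k * b x $ j)"
  have a: "smooth_bdd \<omega> (?a k j)" for k j
    by (intro smooth_bdd_minus smooth_bdd_mult om_open Q0_inv_nth b_nth)
  have "has_wd l (\<lambda>x. \<Sum>k\<in>UNIV. \<Sum>j\<in>UNIV. ?a k j x * wgrad \<omega> V x $ j $ k)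
     (\<lambda>x. \<Sum>k\<in>UNIV. \<Sum>j\<in>UNIV. ?a k j x * h j k l x + pd l (?a k j) x * wgrad \<omega> V x $ j $ k)"
    by (rule has_wd_sum, rule has_wd_sum, rule has_wd_mult[OF a h])
  moreover have "(\<Sum>k\<in>UNIV. \<Sum>j\<in>UNIV. ?a k j x * wgrad \<omega> V x $ j $ k) = pvec G y0 \<omega> V x $ i" for x
    by (simp add: pvec_def matrix_vector_mult_def transpose_def[of "wgrad \<omega> V x"] ext3_def sum_2 sum_3 e23_simps algebra_simps
      del: transpose_matrix_vector)
  ultimately have "has_wd l (\<lambda>x. pvec G y0 \<omega> V x $ i)
     (\<lambda>x. \<Sum>k\<in>UNIV. \<Sum>j\<in>UNIV. ?a k j x * h j k l x + pd l (?a k j) x * wgrad \<omega> V x $ j $ k)"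
    by simp
  then show ?thesis by (rule wgrad_has_wd)
qed

text \<open>The weak derivatives \<open>A l\<close> of \<open>S\<close> exist by the product rule
  for \<open>M\<close> and the inverse frame. Differentiating \<open>M = S X\<close> instead,
  uniqueness gives \<open>N l = A l X + S (pd l X)\<close> almost everywhere, so the derivative of
  the inverse frame never has to be computed.\<close>

lemma bending_rigid:
  assumes conn: "connected \<omega>" and V: "V \<in> Vspace y0 \<omega>"
    and bend: "AE x in lebesgue_on \<omega>. msym (transpose (cgrad y0 x) ** wgrad \<omega> (pvec G y0 \<omega> V) x
           + transpose (wgrad \<omega> V x) ** cgrad b x) = 0"
  shows "\<exists>S. transpose S = - S \<and> (\<exists>c0. AE x in lebesgue_on \<omega>. V x = S *v y0 x + c0)"
\<comment> \<open>Skewness of the constant matrix found below is read off at a point of the domain,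
  so the empty domain is treated apart with the zero matrix.\<close>
proof (cases "\<omega> = {}")
  case True
  have "AE x in lebesgue_on \<omega>. V x = 0 *v y0 x + 0" using True AE_lebesgue_on_iff[OF om_open] by simp
  then show ?thesis by (intro exI[of _ 0] conjI exI[of _ "0::real^3"]) (simp_all add: transpose_simps)
next
  case False
  let ?P = "pvec G y0 \<omega> V"
  have sob: "sobolev 2 \<omega> V" and iso: "AE x in lebesgue_on \<omega>. msym (transpose (cgrad y0 x) ** wgrad \<omega> V x) = 0"
    using V unfolding Vspace_def by auto
  obtain h where h: "\<And>j k l. has_wd l (\<lambda>x. wgrad \<omega> V x $ j $ k) (h j k l)"
    and hs: "\<And>j k l. AE x in lebesgue_on \<omega>. h j k l x = h j l k x"
    by (rule sobolev2_second_wd[OF sob]) (rule that)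
  note P = pvec_has_wd[OF sob]
  define M :: "real^2 \<Rightarrow> real^3^3" where "M x = (\<chi> i a. if a = 1 then wgrad \<omega> V x $ i $ 1 else if a = 2 then wgrad \<omega> V x $ i $ 2 else ?P x $ i)" for x
  define N :: "2 \<Rightarrow> real^2 \<Rightarrow> real^3^3" where "N l x = (\<chi> i a. if a = 1 then h i 1 l x else if a = 2 then h i 2 l x else wgrad \<omega> ?P x $ i $ l)" for l x
  have MN: "has_wd l (\<lambda>x. M x $ i $ a) (\<lambda>x. N l x $ i $ a)" for l i and a :: 3
    using exhaust_3[of a] by (auto simp: M_def N_def h P)
  define Qi where "Qi x = matrix_inv (Q0 G y0 x)" for x
  define S where "S x = M x ** Qi x" for x
  define A :: "2 \<Rightarrow> real^2 \<Rightarrow> real^3^3" where "A l x = (\<chi> i j. \<Sum>a\<in>UNIV. Qi x $ a $ j * N l x $ i $ a + pd l (\<lambda>x. Qi x $ a $ j) x * M x $ i $ a)" for l x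
  have SA: "has_wd l (\<lambda>x. S x $ i $ j) (\<lambda>x. A l x $ i $ j)" for l i j
  proof -
    have "has_wd l (\<lambda>x. \<Sum>a\<in>UNIV. Qi x $ a $ j * M x $ i $ a)
      (\<lambda>x. \<Sum>a\<in>UNIV. Qi x $ a $ j * N l x $ i $ a + pd l (\<lambda>x. Qi x $ a $ j) x * M x $ i $ a)"
      by (rule has_wd_sum, rule has_wd_mult[OF _ MN]) (simp add: Qi_def Q0_inv_nth)
    then show ?thesis by (simp add: S_def A_def matrix_matrix_mult_def mult.commute)
  qed
  have SQ: "S x ** Q0 G y0 x = M x" if x: "x \<in> \<omega>" for x
    unfolding S_def Qi_def matrix_mul_assoc[symmetric]
    using matrix_inv_mult(2)[OF Q0_invertible[OF x]] by simp
  have SX: "M x $ i $ a = (\<Sum>j\<in>UNIV. X a x $ j * S x $ i $ j)" if x: "x \<in> \<omega>" for x i a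
    unfolding SQ[OF x, symmetric] by (simp add: matrix_matrix_mult_def Q0_nth mult.commute)
  have N_eq: "AE x in lebesgue_on \<omega>. N l x $ i $ a = (\<Sum>j\<in>UNIV. X a x $ j * A l x $ i $ j + pd l (\<lambda>x. X a x $ j) x * S x $ i $ j)" for l i a
  proof (rule has_wd_unique[OF MN])
    have "has_wd l (\<lambda>x. \<Sum>j\<in>UNIV. X a x $ j * S x $ i $ j)
      (\<lambda>x. \<Sum>j\<in>UNIV. X a x $ j * A l x $ i $ j + pd l (\<lambda>x. X a x $ j) x * S x $ i $ j)"
      by (rule has_wd_sum, rule has_wd_mult[OF X_nth SA])
    then show "has_wd l (\<lambda>x. M x $ i $ a) (\<lambda>x. \<Sum>j\<in>UNIV. X a x $ j * A l x $ i $ j + pd l (\<lambda>x. X a x $ j) x * S x $ i $ j)"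
      by (rule has_wd_cong[rotated 2]) (simp_all add: SX)
  qed
  have M_cols: "column (e23 k) (M x) = column k (wgrad \<omega> V x)" "column 3 (M x) = ?P x" for k x
    using exhaust_2[of k] by (auto simp: M_def column_def vec_eq_iff e23_simps)
  have N_cols: "column (e23 k) (N l x) = (\<chi> i. h i k l x)" "column 3 (N l x) = column l (wgrad \<omega> ?P x)" for k l x
    using exhaust_2[of k] by (auto simp: N_def column_def vec_eq_iff e23_simps)
  have colM: "column a (M x) = S x *v X a x" if "x \<in> \<omega>" for a x
    by (simp add: vec_eq_iff column_def SX[OF that] matrix_vector_mult_def mult.commute)
  have in_om: "AE x in lebesgue_on \<omega>. x \<in> \<omega>" by (rule AE_I2) simp
  have S_skew: "AE x in lebesgue_on \<omega>. transpose (S x) = - S x"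
    using iso in_om
  proof eventually_elim
    case (elim x)
    have i: "pd i y0 x \<bullet> column j (wgrad \<omega> V x) + pd j y0 x \<bullet> column i (wgrad \<omega> V x) = 0" for i j
    proof -
      have "msym (transpose (cgrad y0 x) ** wgrad \<omega> V x) $ i $ j = 0" using elim(1) by simp
      then show ?thesis
        by (simp add: msym_def transpose_def matrix_matrix_mult_def cgrad_def inner_vec_def column_def)
    qed
    have T: "X a x \<bullet> column c (M x) + X c x \<bullet> column a (M x) = 0" for a c
    proof -
      have "a = e23 1 \<or> a = e23 2 \<or> a = 3" "c = e23 1 \<or> c = e23 2 \<or> c = 3"
        using exhaust_3[of a] exhaust_3[of c] by (auto simp: e23_simps)
      then show ?thesis
        by (auto simp: M_cols X_simps(4) X_simps(3) i pvec_inner[OF elim(2)] inner_commute)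
    qed
    let ?Q = "Q0 G y0 x"
    have TQ: "transpose ?Q ** M x + transpose (transpose ?Q ** M x) = 0"
    proof -
      have "(transpose ?Q ** M x) $ a $ c = X a x \<bullet> column c (M x)" for a c
        by (simp add: matrix_matrix_mult_def transpose_def Q0_nth inner_vec_def column_def)
      then show ?thesis using T by (simp add: vec_eq_iff transpose_def[of "_ ** _"])
    qed
    have Q1: "?Q ** Qi x = mat 1" unfolding Qi_def by (rule matrix_inv_mult(1)[OF Q0_invertible[OF elim(2)]])
    have Qt: "transpose (Qi x) ** transpose ?Q = mat 1"
      using Q1 by (metis matrix_transpose_mul transpose_mat)
    \<comment> \<open>\<open>S x\<close> is the congruence of the skew matrix \<open>X^T M\<close>
      by the inverse frame, hence skew.\<close>
    have "S x = transpose (Qi x) ** (transpose ?Q ** M x) ** Qi x"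
      unfolding matrix_mul_assoc by (simp only: Qt matrix_mul_lid S_def)
    moreover have "transpose (transpose (Qi x) ** (transpose ?Q ** M x) ** Qi x) = transpose (Qi x) ** transpose (transpose ?Q ** M x) ** Qi x"
      by (simp only: matrix_transpose_mul transpose_transpose matrix_mul_assoc)
    ultimately have "S x + transpose (S x) = transpose (Qi x) ** (transpose ?Q ** M x + transpose (transpose ?Q ** M x)) ** Qi x"
      by (simp only: matrix_mult_distrib)
    also have "\<dots> = 0" unfolding TQ by simp
    finally show ?case by (simp add: add_eq_0_iff)
  qed
  \<comment> \<open>\<open>S\<close> equals minus its transpose almost everywhere, and uniqueness
    transfers this to the weak derivatives.\<close>
  have A_skew: "AE x in lebesgue_on \<omega>. A l x $ i $ j = - A l x $ j $ i" for l i j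
  proof (rule has_wd_unique_AE[OF SA has_wd_minus[OF SA]])
    show "AE x in lebesgue_on \<omega>. S x $ i $ j = - S x $ j $ i"
      using S_skew by eventually_elim (rule skew_nth)
  qed
  have "AE x in lebesgue_on \<omega>. \<forall>l i j. A l x $ i $ j = - A l x $ j $ i"
    by (intro AE_finite_all A_skew)
  moreover have "AE x in lebesgue_on \<omega>. \<forall>l i a. N l x $ i $ a = (\<Sum>j\<in>UNIV. X a x $ j * A l x $ i $ j + pd l (\<lambda>x. X a x $ j) x * S x $ i $ j)"
    by (intro AE_finite_all N_eq)
  moreover have "AE x in lebesgue_on \<omega>. \<forall>j k l. h j k l x = h j l k x"
    by (intro AE_finite_all hs)
  ultimately have A0: "AE x in lebesgue_on \<omega>. \<forall>l. A l x = 0"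
    using S_skew bend in_om
  proof eventually_elim
    case (elim x)
    have x: "x \<in> \<omega>" using elim by blast
    have N: "column a (N l x) = A l x *v X a x + S x *v pd l (X a) x" for l a
      using elim(2) by (simp add: vec_eq_iff column_def matrix_vector_mult_def sum.distrib mult.commute smooth_field_has_pd(2)[OF X_nth x])
    have skA: "transpose (A l x) = - A l x" for l
      unfolding vec_eq_iff transpose_def vec_lambda_beta vector_uminus_component
      by (intro allI, rule elim(1)[rule_format])
    have comm: "A l x *v pd k y0 x = A k x *v pd l y0 x" for k l
    proof -
      have "column (e23 k) (N l x) = column (e23 l) (N k x)" unfolding N_cols using elim(3) by simp
      moreover have "pd l (pd k y0) x = pd k (pd l y0) x" by (rule smooth_field_swap[OF y0_nth x])
      ultimately show ?thesis unfolding N X_simps by simp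
    qed
    have sym: "pd k y0 x \<bullet> (A l x *v b x) + pd l y0 x \<bullet> (A k x *v b x) = 0" for k l
    proof -
      have "msym (transpose (cgrad y0 x) ** wgrad \<omega> ?P x + transpose (wgrad \<omega> V x) ** cgrad b x) $ k $ l = 0"
        using elim(5) by simp
      then have "pd k y0 x \<bullet> column l (wgrad \<omega> ?P x) + column k (wgrad \<omega> V x) \<bullet> pd l b x
         + (pd l y0 x \<bullet> column k (wgrad \<omega> ?P x) + column l (wgrad \<omega> V x) \<bullet> pd k b x) = 0"
        by (simp add: msym_def transpose_def matrix_matrix_mult_def cgrad_def inner_vec_def column_def)
      \<comment> \<open>With \<open>p = S b\<close> and the gradient of \<open>V\<close> equal to
        \<open>S\<close> applied to that of \<open>y0\<close>, the two terms containing
        \<open>S\<close> cancel by skewness and only the derivative of \<open>S\<close> is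
        left.\<close>
      moreover have "pd i y0 x \<bullet> column j (wgrad \<omega> ?P x) + column i (wgrad \<omega> V x) \<bullet> pd j b x = pd i y0 x \<bullet> (A j x *v b x)" for i j
        unfolding N_cols(2)[symmetric] N M_cols(1)[symmetric] colM[OF x] X_simps inner_add_right
          inner_mult_skew(1)[OF elim(4), of "pd i y0 x" "pd j b x"] by simp
      ultimately show ?thesis by simp
    qed
    show ?case by (intro allI frame_rigid[OF x skA comm sym])
  qed
  have "\<exists>c. AE x in lebesgue_on \<omega>. S x $ i $ j = c" for i j
  proof (rule has_wd_zero_imp_const[OF _ conn SA])
    show "bdd_domain \<omega>" by (rule bdd_domain_axioms)
    show "AE x in lebesgue_on \<omega>. A k x $ i $ j = 0" for k using A0 by eventually_elim simp
  qed
  from someI_ex[OF this]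
  obtain s where s: "\<And>i j. AE x in lebesgue_on \<omega>. S x $ i $ j = s i j" by (rule that)
  define R :: "real^3^3" where "R = (\<chi> i j. s i j)"
  have "AE x in lebesgue_on \<omega>. \<forall>i j. S x $ i $ j = s i j" by (intro AE_finite_all s)
  then have SR: "AE x in lebesgue_on \<omega>. S x = R" by eventually_elim (simp add: R_def vec_eq_iff)
  \<comment> \<open>A statement that does not depend on the point and holds almost everywhere on a
    nonempty open set is true.\<close>
  have R_skew: "transpose R = - R"
  proof -
    have "AE x in lebesgue_on \<omega>. transpose R = - R" using SR S_skew by eventually_elim simp
    then have "AE x in lborel. x \<in> \<omega> \<longrightarrow> transpose R = - R" unfolding AE_lebesgue_on_iff[OF om_open] .
    moreover obtain x where "x \<in> \<omega>" using False by blast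
    moreover obtain r where r: "r > 0" "ball x r \<subseteq> \<omega>" by (rule openE[OF om_open \<open>x \<in> \<omega>\<close>])
    ultimately obtain y where "y \<in> ball x r" "y \<in> \<omega> \<longrightarrow> transpose R = - R"
      using AE_ball_exists[of "\<lambda>x. x \<in> \<omega> \<longrightarrow> transpose R = - R" r x] by metis
    then show ?thesis using r(2) by (meson subsetD)
  qed
  have wV: "has_wd k (\<lambda>x. V x $ i) (\<lambda>x. wgrad \<omega> V x $ i $ k)" for i k by (rule sobolev_wgrad[OF sob]) simp
  \<comment> \<open>\<open>V\<close> minus the image of \<open>y0\<close> under \<open>R\<close> has
    zero weak gradient; the \<open>+ 0\<close> instantiates the free constant of
    \<open>has_wd_matrix_field\<close>.\<close>
  have "\<exists>c. AE x in lebesgue_on \<omega>. V x $ i + - (R *v y0 x + 0) $ i = c" for i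
  proof (rule has_wd_zero_imp_const[OF bdd_domain_axioms conn has_wd_add[OF wV has_wd_minus[OF has_wd_matrix_field[OF y0_nth]]]])
    show "AE x in lebesgue_on \<omega>. wgrad \<omega> V x $ i $ k + - (R ** cgrad y0 x) $ i $ k = 0" for k
      using SR in_om
    proof eventually_elim
      case (elim x)
      have "column k (wgrad \<omega> V x) = R *v pd k y0 x"
        using colM[OF elim(2), of "e23 k"] elim(1) by (simp add: M_cols X_simps)
      then have "column k (wgrad \<omega> V x) $ i = (R *v pd k y0 x) $ i" by simp
      then show ?case by (simp add: column_def matrix_vector_mult_def matrix_matrix_mult_def cgrad_def)
    qed
  qed
  from someI_ex[OF this]
  obtain c where c: "\<And>i. AE x in lebesgue_on \<omega>. V x $ i + - (R *v y0 x + 0) $ i = c i" by (rule that)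
  have "AE x in lebesgue_on \<omega>. \<forall>i. V x $ i + - (R *v y0 x + 0) $ i = c i" by (intro AE_finite_all c)
  then have "AE x in lebesgue_on \<omega>. V x = R *v y0 x + (\<chi> i. c i)"
    by eventually_elim (simp add: vec_eq_iff algebra_simps)
  then show ?thesis using R_skew by blast
qed

end

section \<open>Zero set of the energy\<close>

lemma nn_integral_zero_imp_AE:
  fixes U :: "'a::euclidean_space set"
  assumes U: "open U" and g: "g \<in> borel_measurable (lebesgue_on U)" "\<And>x. 0 \<le> g x"
    and zero: "(\<integral>\<^sup>+x\<in>U. ennreal (g x) \<partial>lborel) = 0"
  shows "AE x in lebesgue_on U. g x = 0"
proof -
  have "(\<lambda>x. ennreal (g x)) \<in> borel_measurable (lebesgue_on U)" using g(1) by measurable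
  then have m: "(\<lambda>x. ennreal (g x) * indicator U x) \<in> borel_measurable lebesgue"
    using borel_measurable_restrict_space_iff_ennreal[of U lebesgue "\<lambda>x. ennreal (g x)"] U by simp
  have "(\<integral>\<^sup>+x. ennreal (g x) * indicator U x \<partial>lebesgue) = 0" unfolding nn_integral_completion by (rule zero)
  then have "AE x in lebesgue. ennreal (g x) * indicator U x = 0" using nn_integral_0_iff_AE[OF m] by simp
  then have "AE x in lborel. ennreal (g x) * indicator U x = 0" by (simp add: AE_completion_iff)
  then have "AE x in lborel. x \<in> U \<longrightarrow> g x = 0"
  proof eventually_elim
    case (elim x)
    show ?case
    proof
      assume "x \<in> U"
      then have "ennreal (g x) = 0" using elim by simp
      then show "g x = 0" using g(2)[of x] by (simp add: ennreal_eq_0_iff)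
    qed
  qed
  then show ?thesis unfolding AE_lebesgue_on_iff[OF U] .
qed

lemma borel_measurable_matrix_mult:
  fixes A :: "'a \<Rightarrow> real^'m::finite^'n::finite" and B :: "'a \<Rightarrow> real^'p::finite^'m"
  assumes "\<And>i j. (\<lambda>x. A x $ i $ j) \<in> borel_measurable M" "\<And>i j. (\<lambda>x. B x $ i $ j) \<in> borel_measurable M"
  shows "(\<lambda>x. (A x ** B x) $ i $ j) \<in> borel_measurable M"
  unfolding matrix_matrix_mult_def vec_lambda_beta by (intro borel_measurable_sum borel_measurable_times assms)

lemma borel_measurable_transpose:
  "(\<lambda>x. A x $ j $ i) \<in> borel_measurable M \<Longrightarrow> (\<lambda>x. transpose (A x) $ i $ j) \<in> borel_measurable M"
  by (simp add: transpose_def)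

context plate
begin

text \<open>\<open>Q2\<close> is an infimum at each point, so it is compared from below with the
  explicit integrand \<open>?g\<close>: monotonicity of the integral asks nothing of
  \<open>Q2\<close>, and measurability is checked for \<open>?g\<close> only. Conversely
  \<open>Q2\<close> is zero wherever the symmetric part is.\<close>

lemma Q2_integral_zero_iff:
  assumes lower: "\<And>F. k * (norm (msym F))\<^sup>2 \<le> Q3 W F" and skew: "\<And>F. transpose F = - F \<Longrightarrow> Q3 W F = 0"
    and k: "k > 0" and F: "\<And>i j. (\<lambda>x. F x $ i $ j) \<in> borel_measurable (lebesgue_on \<omega>)"
  shows "(\<integral>\<^sup>+x\<in>\<omega>. ennreal (Q2 W G x (F x)) \<partial>lborel) = 0 \<longleftrightarrow> (AE x in lebesgue_on \<omega>. msym (F x) = 0)"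
proof
  have spd: "sym_posdef (Gbar G x)" if "x \<in> \<omega>" for x using Gbar_spd closure_subset that by blast
  have Q2: "k / (trace (Gbar G x))\<^sup>2 * (norm (msym B))\<^sup>2 \<le> Q2 W G x B" "msym B = 0 \<Longrightarrow> Q2 W G x B = 0"
    if "x \<in> \<omega>" for x B
    by (rule Q2_lower[OF lower _ k spd[OF that]], erule skew) (rule Q2_skew[OF lower _ k spd[OF that]], erule skew)
  {
    assume zero: "(\<integral>\<^sup>+x\<in>\<omega>. ennreal (Q2 W G x (F x)) \<partial>lborel) = 0"
    let ?g = "\<lambda>x. k / (trace (Gbar G x))\<^sup>2 * (norm (msym (F x)))\<^sup>2"
    have "(\<integral>\<^sup>+x\<in>\<omega>. ennreal (?g x) \<partial>lborel) \<le> (\<integral>\<^sup>+x\<in>\<omega>. ennreal (Q2 W G x (F x)) \<partial>lborel)"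
    proof (rule nn_integral_mono)
      fix x
      show "ennreal (?g x) * indicator \<omega> x \<le> ennreal (Q2 W G x (F x)) * indicator \<omega> x"
      proof (cases "x \<in> \<omega>")
        case True
        show ?thesis by (rule mult_right_mono[OF ennreal_leI[OF Q2(1)[OF True]]]) simp
      qed simp
    qed
    then have z: "(\<integral>\<^sup>+x\<in>\<omega>. ennreal (?g x) \<partial>lborel) = 0" using zero by simp
    have tr: "(\<lambda>x. trace (Gbar G x)) \<in> borel_measurable (lebesgue_on \<omega>)"
      unfolding trace_def by (intro borel_measurable_sum smooth_bdd_measurable Gbar_nth)
    have "(norm (msym (F x)))\<^sup>2 = (\<Sum>i\<in>UNIV. \<Sum>j\<in>UNIV. ((F x $ i $ j + F x $ j $ i) / 2)\<^sup>2)" for x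
      unfolding norm_matrix_sq by (simp add: msym_def transpose_def)
    then have nm: "(\<lambda>x. (norm (msym (F x)))\<^sup>2) \<in> borel_measurable (lebesgue_on \<omega>)"
      by (simp only:) (intro borel_measurable_sum borel_measurable_power borel_measurable_divide
          borel_measurable_add F borel_measurable_const)
    have "AE x in lebesgue_on \<omega>. ?g x = 0"
    proof (rule nn_integral_zero_imp_AE[OF om_open _ _ z])
      show "?g \<in> borel_measurable (lebesgue_on \<omega>)" using tr nm by measurable
      show "0 \<le> ?g x" for x using k by simp
    qed
    moreover have "AE x in lebesgue_on \<omega>. x \<in> \<omega>" by (rule AE_I2) simp
    ultimately show "AE x in lebesgue_on \<omega>. msym (F x) = 0"
    proof eventually_elim
      case (elim x)
      then show ?case using k trace_sym_posdef[OF spd[of x]] by simp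
    qed
  }
  assume "AE x in lebesgue_on \<omega>. msym (F x) = 0"
  then have "AE x in lborel. x \<in> \<omega> \<longrightarrow> msym (F x) = 0" unfolding AE_lebesgue_on_iff[OF om_open] .
  then have "AE x in lborel. ennreal (Q2 W G x (F x)) * indicator \<omega> x = 0"
    by eventually_elim (auto split: split_indicator simp: Q2(2))
  from nn_integral_cong_AE[OF this]
  show "(\<integral>\<^sup>+x\<in>\<omega>. ennreal (Q2 W G x (F x)) \<partial>lborel) = 0" by simp
qed

text \<open>Every symmetric matrix is at distance at least \<open>norm (T - transpose T) / 2\<close>
  from \<open>T\<close>, so an L2 limit of symmetric fields has vanishing antisymmetric part. This
  lets the symmetric part seen by \<open>Q2\<close> determine the whole strain.\<close>

lemma Sspace_symmetric:
  assumes "T \<in> Sspace y0 \<omega>"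
  shows "AE x in lebesgue_on \<omega>. transpose (T x) = T x"
proof -
  obtain w :: "nat \<Rightarrow> real^2 \<Rightarrow> real^3" where L: "\<And>i j. L2 \<omega> (\<lambda>x. T x $ i $ j)"
    and lim: "(\<lambda>n. \<integral>\<^sup>+x\<in>\<omega>. ennreal ((norm (msym (transpose (cgrad y0 x) ** wgrad \<omega> (w n) x) - T x))^2) \<partial>lborel) \<longlonglongrightarrow> 0"
    using assms unfolding Sspace_def by blast
  let ?g = "\<lambda>x. (norm (T x - transpose (T x)) / 2)\<^sup>2"
  have bound: "norm (T - transpose T) / 2 \<le> norm (msym B - T)" for T B :: "real^2^2"
  proof -
    have "T - transpose T = - ((msym B - T) - transpose (msym B - T))"
      by (simp add: msym_def transpose_simps)
    then have "norm (T - transpose T) \<le> norm (msym B - T) + norm (transpose (msym B - T))"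
      by (metis norm_minus_cancel norm_triangle_ineq4)
    then show ?thesis by (simp add: norm_transpose)
  qed
  have "(\<integral>\<^sup>+x\<in>\<omega>. ennreal (?g x) \<partial>lborel)
     \<le> (\<integral>\<^sup>+x\<in>\<omega>. ennreal ((norm (msym (transpose (cgrad y0 x) ** wgrad \<omega> (w n) x) - T x))^2) \<partial>lborel)" for n
    by (intro nn_integral_mono mult_right_mono ennreal_leI power_mono bound) auto
  then have "(\<integral>\<^sup>+x\<in>\<omega>. ennreal (?g x) \<partial>lborel) \<le> 0"
    by (intro LIMSEQ_le_const[OF lim]) blast
  then have z: "(\<integral>\<^sup>+x\<in>\<omega>. ennreal (?g x) \<partial>lborel) = 0" by simp
  have "?g x = (\<Sum>i\<in>UNIV. \<Sum>j\<in>UNIV. (T x $ i $ j - T x $ j $ i)\<^sup>2) / 4" for x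
    unfolding power_divide norm_matrix_sq by (simp add: transpose_def)
  then have m: "?g \<in> borel_measurable (lebesgue_on \<omega>)"
    by (simp only:) (intro borel_measurable_sum borel_measurable_power borel_measurable_divide
          borel_measurable_diff L2_measurable[OF L] borel_measurable_const)
  have "AE x in lebesgue_on \<omega>. ?g x = 0" by (rule nn_integral_zero_imp_AE[OF om_open m _ z]) simp
  then show ?thesis by eventually_elim simp
qed

lemma cgrad_measurable:
  assumes "\<And>j. smooth_bdd \<omega> (\<lambda>x. f x $ j)"
  shows "(\<lambda>x. cgrad f x $ i $ j) \<in> borel_measurable (lebesgue_on \<omega>)"
  using smooth_bdd_measurable[OF smooth_field_pd[OF om_open assms, of j i]] by (simp add: cgrad_def)

lemma cgrad_add_scale:
  fixes S :: "real^3^3"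
  assumes f: "\<And>j. smooth_bdd \<omega> (\<lambda>x. f x $ j)" and g: "\<And>j. smooth_bdd \<omega> (\<lambda>x. g x $ j)" and x: "x \<in> \<omega>"
  shows "cgrad (\<lambda>z. S *v f z + c *\<^sub>R g z) x = S ** cgrad f x + c *\<^sub>R cgrad g x"
proof -
  have "has_pd k (\<lambda>z. S *v f z + c *\<^sub>R g z) x (S *v pd k f x + c *\<^sub>R pd k g x)" for k
    by (intro has_pd_add has_pd_bounded_linear[OF matrix_vector_mul_bounded_linear]
      has_pd_bounded_linear[OF bounded_linear_scaleR_right] smooth_field_has_pd(1)[OF f x] smooth_field_has_pd(1)[OF g x])
  from has_pd_imp_pd[OF this] show ?thesis
    by (simp add: cgrad_def vec_eq_iff matrix_vector_mult_def matrix_matrix_mult_def)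
qed

end

context flat_plate
begin

text \<open>With \<open>Y\<close> the gradient of \<open>y0\<close>, skewness turns
  \<open>(S Y)^T (S Y)\<close> into \<open>- Y^T S^2 Y\<close>, the source of \<open>S ** S\<close>.
  By the curvature identity the two terms with factors 1/24 and 1/48 add up to -1/24 times the
  symmetric part of \<open>Y^T\<close> times the gradient of \<open>d\<close>, and 1/24 is half of
  1/12.\<close>

lemma stretching_term:
  fixes S :: "real^3^3"
  assumes x: "x \<in> \<omega>" and S: "transpose S = - S"
  shows "T + (1/2) *\<^sub>R (transpose (S ** cgrad y0 x) ** (S ** cgrad y0 x))
      + (1/24) *\<^sub>R (transpose (cgrad b x) ** cgrad b x) - (1/48) *\<^sub>R blk2 (pds [3, 3] G (pt x 0))
    = T - (1/2) *\<^sub>R msym (transpose (cgrad y0 x) ** cgrad (\<lambda>z. (S ** S) *v y0 z + (1/12) *\<^sub>R d z) x)"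
proof -
  let ?Y = "cgrad y0 x" and ?E = "transpose (cgrad y0 x) ** cgrad d x"
  let ?SS = "transpose ?Y ** (S ** S ** ?Y)"
  have 1: "transpose (S ** ?Y) ** (S ** ?Y) = - ?SS"
    by (simp add: matrix_transpose_mul S matrix_mult_distrib matrix_mul_assoc)
  have sym: "transpose ?SS = ?SS"
    by (simp add: matrix_transpose_mul S matrix_mult_distrib matrix_mul_assoc)
  have "cgrad (\<lambda>z. (S ** S) *v y0 z + (1/12) *\<^sub>R d z) x = S ** S ** ?Y + (1/12) *\<^sub>R cgrad d x"
    by (rule cgrad_add_scale[OF y0_nth d_nth x])
  then have 2: "msym (transpose ?Y ** cgrad (\<lambda>z. (S ** S) *v y0 z + (1/12) *\<^sub>R d z) x) = ?SS + (1/12) *\<^sub>R msym ?E"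
    by (simp add: matrix_mult_distrib matrix_scaleR_mult msym_simps msym_of_symmetric[OF sym])
  have "transpose (cgrad b x) ** cgrad b x = (1/2) *\<^sub>R blk2 (pds [3, 3] G (pt x 0)) - msym ?E"
    using curvature_identity_matrix[OF x] by (simp add: algebra_simps)
  then show ?thesis unfolding 1 2
    by (simp add: scaleR_diff_right scaleR_add_right)
qed

end

theorem theorem8p2:
  fixes \<omega> :: "(real^2) set"
    and W :: "real^3^3 \<Rightarrow> ennreal"
    and c :: real
    and G :: "real^3 \<Rightarrow> real^3^3"
    and y0 :: "real^2 \<Rightarrow> real^3"
    and V :: "real^2 \<Rightarrow> real^3"
    and \<SS> :: "real^2 \<Rightarrow> real^2^2"
  assumes dom: "open \<omega>" "bounded \<omega>" "connected \<omega>" "lipschitz_boundary \<omega>"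
    and W_borel: "W \<in> borel_measurable borel"
    and W_frame: "\<And>R F. R \<in> SO3 \<Longrightarrow> W (R ** F) = W F"
    and W_zero: "\<And>R. R \<in> SO3 \<Longrightarrow> W R = 0"
    and c_pos: "c > 0"
    and W_coerc: "\<And>F. ennreal (c * (infdist F SO3)^2) \<le> W F"
    and W_reg: "\<exists>U. open U \<and> SO3 \<subseteq> U \<and> (\<forall>F\<in>U. W F < \<infinity>) \<and> C2_on U (Wr W)"
    and G_smooth: "smooth_closure (Omega_h \<omega> 1) G"
    and G_spd: "\<And>x. x \<in> closure (Omega_h \<omega> 1) \<Longrightarrow> sym_posdef (G x)"
    and energy_lim: "((\<lambda>h. ennreal (1 / h^2) * inf_energy W G \<omega> h) \<longlongrightarrow> 0) (at_right 0)"
    and flat: "\<And>x' i k l m. x' \<in> \<omega> \<Longrightarrow> riemann G (pt x' 0) i k l m = 0"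
    and y0_smooth: "smooth_closure \<omega> y0"
    and y0_metric: "\<And>x'. x' \<in> \<omega> \<Longrightarrow> transpose (cgrad y0 x') ** cgrad y0 x' = blk2 (Gbar G x')"
    and y0_b0: "\<And>x'. x' \<in> \<omega> \<Longrightarrow>
                  msym (transpose (cgrad y0 x') ** cgrad (b0 G y0) x') = (1/2) *\<^sub>R blk2 (pd 3 G (pt x' 0))"
    and V_in: "V \<in> Vspace y0 \<omega>"
    and S_in: "\<SS> \<in> Sspace y0 \<omega>"
  shows "I4 W G y0 \<omega> V \<SS> = 0 \<longleftrightarrow>
         (\<exists>S::real^3^3. transpose S = - S \<and> (\<exists>c0::real^3.
            (AE x in lebesgue_on \<omega>. V x = S *v y0 x + c0) \<and>
            (AE x in lebesgue_on \<omega>. \<SS> x = (1/2) *\<^sub>R msym (transpose (cgrad y0 x) **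
                 cgrad (\<lambda>z. (S ** S) *v y0 z + (1/12) *\<^sub>R d0 G y0 z) x))))"
proof -
  interpret flat_plate \<omega> G y0
    by unfold_locales (use dom G_smooth G_spd y0_smooth y0_metric flat y0_b0 in auto)
  have sob: "sobolev 2 \<omega> V" using V_in unfolding Vspace_def by auto
  have wV: "has_wd k (\<lambda>x. V x $ i) (\<lambda>x. wgrad \<omega> V x $ i $ k)" for i k by (rule sobolev_wgrad[OF sob]) simp
  note wP = pvec_has_wd[OF sob]
  let ?P = "pvec G y0 \<omega> V"
  define F1 where "F1 x = \<SS> x + (1/2) *\<^sub>R (transpose (wgrad \<omega> V x) ** wgrad \<omega> V x)
          + (1/24) *\<^sub>R (transpose (cgrad b x) ** cgrad b x) - (1/48) *\<^sub>R blk2 (pds [3, 3] G (pt x 0))" for x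
  define F2 where "F2 x = transpose (cgrad y0 x) ** wgrad \<omega> ?P x + transpose (wgrad \<omega> V x) ** cgrad b x" for x
  define F3 where "F3 x = (\<chi> i j. riemann G (pt x 0) (e23 i) 3 (e23 j) 3)" for x
  define T where "T S x = (1/2) *\<^sub>R msym (transpose (cgrad y0 x) ** cgrad (\<lambda>z. (S ** S) *v y0 z + (1/12) *\<^sub>R d z) x)"
    for S :: "real^3^3" and x
  have in_om: "AE x in lebesgue_on \<omega>. x \<in> \<omega>" by (rule AE_I2) simp
  have Q3: "c / 2 * (norm (msym F))\<^sup>2 \<le> Q3 W F" "transpose F = - F \<Longrightarrow> Q3 W F = 0" for F
    by (rule Q3_lower[OF _ c_pos W_coerc W_reg], erule W_zero) (rule Q3_skew[OF _ c_pos W_coerc W_reg], erule W_zero)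
  have c2: "c / 2 > 0" using c_pos by simp
  have iff: "(\<integral>\<^sup>+x\<in>\<omega>. ennreal (Q2 W G x (F x)) \<partial>lborel) = 0 \<longleftrightarrow> (AE x in lebesgue_on \<omega>. msym (F x) = 0)"
    if "\<And>i j. (\<lambda>x. F x $ i $ j) \<in> borel_measurable (lebesgue_on \<omega>)" for F
    by (rule Q2_integral_zero_iff[OF Q3(1) _ c2 that]) (erule Q3(2))
  have mV: "(\<lambda>x. wgrad \<omega> V x $ i $ k) \<in> borel_measurable (lebesgue_on \<omega>)" for i k
    by (rule L2_measurable[OF has_wd_L2(2)[OF wV]])
  have mP: "(\<lambda>x. wgrad \<omega> ?P x $ i $ k) \<in> borel_measurable (lebesgue_on \<omega>)" for i k
    by (rule L2_measurable[OF has_wd_L2(2)[OF wP]])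
  have mS: "(\<lambda>x. \<SS> x $ i $ j) \<in> borel_measurable (lebesgue_on \<omega>)" for i j
    using S_in unfolding Sspace_def by (auto intro: L2_measurable)
  have mG: "(\<lambda>x. blk2 (pds [3, 3] G (pt x 0)) $ i $ j) \<in> borel_measurable (lebesgue_on \<omega>)" for i j
    using smooth_bdd_measurable[OF pds_G_pt_smooth[of "[3, 3]" "e23 i" "e23 j"]] by (simp add: blk2_def del: pds.simps)
  note mcg = cgrad_measurable[OF b_nth] cgrad_measurable[OF y0_nth]
  have m1: "(\<lambda>x. F1 x $ i $ j) \<in> borel_measurable (lebesgue_on \<omega>)" for i j
    unfolding F1_def vector_add_component vector_minus_component vector_scaleR_component
    by (intro borel_measurable_add borel_measurable_diff borel_measurable_scaleR borel_measurable_const mS mG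
        borel_measurable_matrix_mult borel_measurable_transpose mV mcg)
  have m2: "(\<lambda>x. F2 x $ i $ j) \<in> borel_measurable (lebesgue_on \<omega>)" for i j
    unfolding F2_def vector_add_component
    by (intro borel_measurable_add borel_measurable_matrix_mult borel_measurable_transpose mV mP mcg)
  have F3: "F3 x = 0" if "x \<in> \<omega>" for x using flat[OF that] by (simp add: F3_def vec_eq_iff)
  have m3: "(\<lambda>x. F3 x $ i $ j) \<in> borel_measurable (lebesgue_on \<omega>)" for i j
    by (rule smooth_bdd_measurable[OF smooth_bdd_cong_open[OF om_open _ smooth_bdd_const[OF om_open, of 0]]]) (simp add: F3)
  have "(AE x in lebesgue_on \<omega>. msym (F3 x) = 0)"
    using in_om by eventually_elim (simp add: F3 msym_def transpose_simps)
  \<comment> \<open>The three summands are nonnegative, so the sum vanishes exactly when each of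
    them does; flatness on the midplate makes the third one zero.\<close>
  then have "I4 W G y0 \<omega> V \<SS> = 0 \<longleftrightarrow> (AE x in lebesgue_on \<omega>. msym (F1 x) = 0) \<and> (AE x in lebesgue_on \<omega>. msym (F2 x) = 0)"
    using iff[OF m1] iff[OF m2] iff[OF m3] unfolding I4_def F1_def[symmetric] F2_def[symmetric] F3_def[symmetric]
    by simp
  also have "\<dots> \<longleftrightarrow> (\<exists>S. transpose S = - S \<and> (\<exists>c0. (AE x in lebesgue_on \<omega>. V x = S *v y0 x + c0) \<and> (AE x in lebesgue_on \<omega>. \<SS> x = T S x)))"
  proof
    assume F: "(AE x in lebesgue_on \<omega>. msym (F1 x) = 0) \<and> (AE x in lebesgue_on \<omega>. msym (F2 x) = 0)"
    then obtain S c0 where S: "transpose S = - S" "AE x in lebesgue_on \<omega>. V x = S *v y0 x + c0"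
      using bending_rigid[OF dom(3) V_in] unfolding F2_def by blast
    from F have "AE x in lebesgue_on \<omega>. msym (F1 x) = 0" ..
    then have "AE x in lebesgue_on \<omega>. \<SS> x = T S x"
      using wgrad_AE_eq[OF wV S(2) y0_nth] Sspace_symmetric[OF S_in] in_om
    proof eventually_elim
      case (elim x)
      have "F1 x = \<SS> x - T S x" unfolding F1_def T_def elim(2) by (rule stretching_term[OF elim(4) S(1)])
      \<comment> \<open>\<open>Q2\<close> controls symmetric parts only, but both fields are
        symmetric, so they agree entirely.\<close>
      then have "msym (\<SS> x) - msym (T S x) = 0" using elim(1) by (simp add: msym_simps)
      moreover have "msym (\<SS> x) = \<SS> x" by (rule msym_of_symmetric[OF elim(3)])
      moreover have "msym (T S x) = T S x" unfolding T_def by (simp add: msym_simps)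
      ultimately show ?case by simp
    qed
    with S show "\<exists>S. transpose S = - S \<and> (\<exists>c0. (AE x in lebesgue_on \<omega>. V x = S *v y0 x + c0) \<and> (AE x in lebesgue_on \<omega>. \<SS> x = T S x))"
      by blast
  next
    assume "\<exists>S. transpose S = - S \<and> (\<exists>c0. (AE x in lebesgue_on \<omega>. V x = S *v y0 x + c0) \<and> (AE x in lebesgue_on \<omega>. \<SS> x = T S x))"
    then obtain S c0 where S: "transpose S = - S" and VS: "AE x in lebesgue_on \<omega>. V x = S *v y0 x + c0"
      and SS: "AE x in lebesgue_on \<omega>. \<SS> x = T S x" by blast
    note gV = wgrad_AE_eq[OF wV VS y0_nth]
    \<comment> \<open>For such \<open>V\<close> the products defining \<open>pvec\<close> are those
      of \<open>S *v b x\<close>: skewness moves \<open>S\<close> across the inner product and makes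
      the product of \<open>b x\<close> with \<open>S *v b x\<close> zero.\<close>
    have "AE x in lebesgue_on \<omega>. ?P x = S *v b x + 0"
      using gV in_om
    proof eventually_elim
      case (elim x)
      have col: "column i (wgrad \<omega> V x) = S *v pd i y0 x" for i
        unfolding elim(1) by (simp add: vec_eq_iff column_def matrix_vector_mult_def matrix_matrix_mult_def cgrad_def)
      have "?P x = S *v b x"
      proof (rule frame_eqI[OF elim(2)])
        fix a
        show "X a x \<bullet> ?P x = X a x \<bullet> (S *v b x)"
        proof (cases a rule: index3_cases)
          case (in_plane i)
          then show ?thesis
            using pvec_inner(1)[OF elim(2), of i V] inner_mult_skew(1)[OF S, of "pd i y0 x" "b x"] by (simp add: X_simps col)
        next
          case normal
          then show ?thesis
            using pvec_inner(2)[OF elim(2), of V] inner_mult_skew(2)[OF S, of "b x"] by (simp add: X_simps)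
        qed
      qed
      then show ?case by simp
    qed
    note gP = wgrad_AE_eq[OF wP this b_nth]
    have "AE x in lebesgue_on \<omega>. msym (F2 x) = 0"
      using gV gP
    proof eventually_elim
      case (elim x)
      \<comment> \<open>The two terms are \<open>Y^T S B\<close> and \<open>(S Y)^T B\<close>, with
        \<open>Y\<close> and \<open>B\<close> the gradients of \<open>y0\<close> and
        \<open>b\<close>; they are opposite because \<open>S\<close> is skew.\<close>
      have "F2 x = 0" unfolding F2_def elim
        by (simp add: matrix_transpose_mul S matrix_mult_distrib matrix_mul_assoc)
      then show ?case by (simp add: msym_def transpose_simps)
    qed
    moreover have "AE x in lebesgue_on \<omega>. msym (F1 x) = 0"
      using gV SS in_om
    proof eventually_elim
      case (elim x)
      have "F1 x = \<SS> x - T S x" unfolding F1_def T_def elim(1) by (rule stretching_term[OF elim(3) S])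
      then show ?case using elim(2) by (simp add: msym_def transpose_simps)
    qed
    ultimately show "(AE x in lebesgue_on \<omega>. msym (F1 x) = 0) \<and> (AE x in lebesgue_on \<omega>. msym (F2 x) = 0)" by blast
  qed
  finally show ?thesis unfolding T_def .
qed

end
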